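(* Let $T$ be an algebraic $k$-torus split by a finite Galois extension $L/k$ such that the pair $(\widehat{T_L},\mathrm{Gal}(L/k))$ corresponds to one of the nine maximal finite subgroups of $\mathrm{GL}(4,\mathbb{Z})$, i.e. is one of the pairs $(M_{G_i},G_i)$, $i=1,\dots,9$, listed in the context. Then, unless $i\in\{2,4,7\}$, there exists a (possibly reducible) root system $\Phi$ such that $(M_{G_i},G_i)=(\mathbb{Z}\Phi,\mathrm{Aut}(\Phi))$, and a Demazure model of $T$ can be given as a product of toric varieties of irreducible simply-laced root systems. More specifically, for the tori with $(\widehat{T_L},\mathrm{Gal}(L/k))=(M_{G_i},G_i)$ one may take the following Demazure models: \begin{itemize} \item $i=1$: $\Phi=A_2\times A_1^2$, with Demazure model $X(A_2)\times X(A_1)^2=X(A_2)\times(\mathbb{P}^1)^2$; \item $i=3$: $\Phi=A_3\times A_1$, with Demazure model $X(A_3)\times X(A_1)=X(A_3)\times\mathbb{P}^1$; \item $i=5$: $\Phi=A_2\times A_2$, with Demazure model $X(A_2)\times X(A_2)$; \item $i=6$: $\Phi=A_4$, with Demazure model $X(A_4)$; \item $i=8$: $\Phi=A_1^4$, with Demazure model $X(A_1)^4=(\mathbb{P}^1)^4$; \item $i=9$: $\Phi=D_4$, with Demazure model $X(D_4)$. \end{itemize}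
   Context: $k$ is a field. For an algebraic $k$-torus $T$ split by a finite Galois extension $L/k$ with group $G=\mathrm{Gal}(L/k)$, $\widehat{T_L}=\mathrm{Hom}_{L\text{-grp}}(T_L,\mathbb{G}_{m,L})$ is its character lattice, a $G$-lattice; equality of pairs (lattice, group) means isomorphism of lattices with group action. A Demazure model of $T$ is a smooth projective toric $T_L$-variety $X_\Sigma$ such that the natural action of $G$ on $T_L$ extends to $X_\Sigma$; equivalently it is given by a smooth projective fan $\Sigma$ in $(\widehat{T_L})^0\otimes\mathbb{R}$ (where $M^0=\mathrm{Hom}(M,\mathbb{Z})$) whose cones are permuted by $G$. A projective fan is a complete fan $\Sigma$ whose toric variety has a torus-invariant ample Cartier divisor. For a crystallographic reduced root system $\Phi$: $\mathbb{Z}\Phi$ is the root lattice, $\Lambda(\Phi)$ the weight lattice, $W(\Phi)$ the Weyl group, $\mathrm{Aut}(\Phi)$ the group of linear automorphisms of $\mathbb{R}\Phi$ preserving $\Phi$. The toric variety of the root system, $X(\Phi)$, is the toric variety (over $L$) of the fan in $(\mathbb{Z}\Phi)^0\otimes\mathbb{R}$ whose cones are the closed Weyl chambers of $\Phi$ and all their faces. The maximal finite subgroups $G_i$ of $\mathrm{GL}(4,\mathbb{Z})$ (up to conjugacy) and their lattices $M_{G_i}$ are: (1) $((\mathbb{Z}A_1)^2\oplus\mathbb{Z}A_2,\ \mathrm{Aut}(A_1^2)\times\mathrm{Aut}(A_2))$; (2) $(\Lambda(A_3)\oplus\mathbb{Z}A_1,\ \mathrm{Aut}(A_3)\times\mathrm{Aut}(A_1))$;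 (3) $(\mathbb{Z}A_3\oplus\mathbb{Z}A_1,\ \mathrm{Aut}(A_3)\times\mathrm{Aut}(A_1))$; (4) $(\mathbb{Z}A_2\otimes\mathbb{Z}A_2,\ ((W(A_2)\times W(A_2))\rtimes C_2)\times C_2)$, where the first $C_2$ swaps the tensor factors and the second acts by $-1$; (5) $(\mathbb{Z}A_2\oplus\mathbb{Z}A_2,\ \mathrm{Aut}(A_2\times A_2))$, with $\mathrm{Aut}(A_2\times A_2)=(\mathrm{Aut}(A_2)\times\mathrm{Aut}(A_2))\rtimes C_2$; (6) $(\mathbb{Z}A_4,\mathrm{Aut}(A_4))$; (7) $(\Lambda(A_4),\mathrm{Aut}(A_4))$; (8) $((\mathbb{Z}A_1)^4,\mathrm{Aut}(A_1^4))=(\mathbb{Z}B_4,W(B_4))$; (9) $(\mathbb{Z}D_4,\mathrm{Aut}(D_4))=(\mathbb{Z}F_4,W(F_4))$. *)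

theory Defs
  imports
    "HOL-Analysis.Analysis"
    "HOL-Algebra.Algebra"
    "HOL-Algebra.Algebraic_Closure_Type"
    "HOL-Library.Poly_Mapping"
begin

section \<open>Lattices with group action\<close>

text \<open>A pair \<open>(M, G)\<close>: a lattice \<open>M\<close> (an abelian group, written as an HOL-Algebra monoid), a group
  \<open>G\<close>, and the action of \<open>G\<close> on \<open>M\<close>.  Only the values of \<open>act\<close> on the carriers matter.\<close>

record ('m, 'g) glattice =
  lat :: "'m monoid"
  grp :: "'g monoid"
  act :: "'g \<Rightarrow> 'm \<Rightarrow> 'm"

text \<open>Equality of pairs (lattice, group).\<close>

definition glattice_iso :: "('m, 'g) glattice \<Rightarrow> ('n, 'h) glattice \<Rightarrow> bool" where
  "glattice_iso P Q \<longleftrightarrow>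
     (\<exists>f \<in> iso (lat P) (lat Q). \<exists>h \<in> iso (grp P) (grp Q).
        \<forall>g \<in> carrier (grp P). \<forall>x \<in> carrier (lat P). f (act P g x) = act Q (h g) (f x))"

definition glattice_sum ::
  "('m, 'g) glattice \<Rightarrow> ('n, 'h) glattice \<Rightarrow> ('m \<times> 'n, 'g \<times> 'h) glattice" where
  "glattice_sum P Q =
     \<lparr>lat = lat P \<times>\<times> lat Q, grp = grp P \<times>\<times> grp Q,
      act = (\<lambda>(g, h) (x, y). (act P g x, act Q h y))\<rparr>"

section \<open>Algebraic tori and their character lattices\<close>

subsection \<open>Finite Galois extensions\<close>

text \<open>The field \<open>L\<close> is a type; the base field \<open>k\<close> is a subset \<open>K\<close> of it.\<close>

definition galois_set :: "'l::field set \<Rightarrow> ('l \<Rightarrow> 'l) set" where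
  "galois_set K =
     {\<sigma> \<in> ring_iso ring_of_type_algebra ring_of_type_algebra. \<forall>x\<in>K. \<sigma> x = x}"

definition galois_group :: "'l::field set \<Rightarrow> ('l \<Rightarrow> 'l) monoid" where
  "galois_group K = BijGroup UNIV \<lparr>carrier := galois_set K\<rparr>"

definition finite_galois :: "'l::field set \<Rightarrow> bool" where
  "finite_galois K \<longleftrightarrow>
     subfield K (ring_of_type_algebra :: 'l ring) \<and>
     ring.finite_dimension (ring_of_type_algebra :: 'l ring) K UNIV \<and>
     {x. \<forall>\<sigma>\<in>galois_set K. \<sigma> x = x} = K"

subsection \<open>The Hopf algebra of the split torus\<close>

text \<open>The Hopf algebra \<open>L[\<int>\<^sup>n]\<close> of \<open>\<bbbG>\<^sub>m\<^sup>n\<close> over \<open>L\<close>.  Its tensor square over \<open>L\<close> is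
  \<open>L[\<int>\<^sup>n \<times> \<int>\<^sup>n]\<close>, with \<open>f \<otimes> g\<close> given by \<open>tens f g\<close>.\<close>

type_synonym ('n, 'l) laurent = "(int ^ 'n, 'l) poly_mapping"

type_synonym ('n, 'l) laurent2 = "((int ^ 'n) \<times> (int ^ 'n), 'l) poly_mapping"

definition scalar :: "'l::field \<Rightarrow> ('n::finite, 'l) laurent" where
  "scalar c = Poly_Mapping.single 0 c"

definition tens :: "('n::finite, 'l::field) laurent \<Rightarrow> ('n, 'l) laurent \<Rightarrow> ('n, 'l) laurent2" where
  "tens f g =
     (\<Sum>a\<in>Poly_Mapping.keys f. \<Sum>b\<in>Poly_Mapping.keys g.
        Poly_Mapping.single (a, b) (Poly_Mapping.lookup f a * Poly_Mapping.lookup g b))"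

definition comul :: "('n::finite, 'l::field) laurent \<Rightarrow> ('n, 'l) laurent2" where
  "comul f = (\<Sum>m\<in>Poly_Mapping.keys f. Poly_Mapping.single (m, m) (Poly_Mapping.lookup f m))"

definition counit :: "('n::finite, 'l::field) laurent \<Rightarrow> 'l" where
  "counit f = (\<Sum>m\<in>Poly_Mapping.keys f. Poly_Mapping.lookup f m)"

definition antipode :: "('n::finite, 'l::field) laurent \<Rightarrow> ('n, 'l) laurent" where
  "antipode f = (\<Sum>m\<in>Poly_Mapping.keys f. Poly_Mapping.single (- m) (Poly_Mapping.lookup f m))"

subsection \<open>Tori over k split by L\<close>

text \<open>A \<open>k\<close>-torus split by \<open>L\<close> is \<open>Spec H\<close> for a commutative \<open>k\<close>-Hopf algebra \<open>H\<close> with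
  \<open>L \<otimes>\<^sub>k H \<cong> L[\<int>\<^sup>n]\<close> as Hopf algebras over \<open>L\<close>.  As \<open>H \<rightarrow> L \<otimes>\<^sub>k H\<close> is injective, \<open>H\<close> is a subset of
  \<open>L[\<int>\<^sup>n]\<close>: a \<open>k\<close>-subalgebra, stable under the Hopf structure, for which multiplication
  \<open>L \<otimes>\<^sub>k H \<rightarrow> L[\<int>\<^sup>n]\<close> is bijective, i.e. some \<open>k\<close>-basis \<open>B\<close> of \<open>H\<close> is an \<open>L\<close>-basis of \<open>L[\<int>\<^sup>n]\<close>.\<close>

definition split_torus :: "'l::field set \<Rightarrow> ('n::finite, 'l) laurent set \<Rightarrow> bool" where
  "split_torus K H \<longleftrightarrow>
     1 \<in> H \<and> (\<forall>f\<in>H. \<forall>g\<in>H. f * g \<in> H) \<and>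
     (\<exists>B. \<not> module.dependent (\<lambda>c f. scalar c * f) B \<and>
          module.span (\<lambda>c f. scalar c * f) B = UNIV \<and>
          H = {\<Sum>b\<in>S. scalar (c b) * b | S c. finite S \<and> S \<subseteq> B \<and> c ` S \<subseteq> K}) \<and>
     (\<forall>f\<in>H. \<exists>ps. set ps \<subseteq> H \<times> H \<and> comul f = (\<Sum>(g, h)\<leftarrow>ps. tens g h)) \<and>
     (\<forall>f\<in>H. counit f \<in> K) \<and>
     (\<forall>f\<in>H. antipode f \<in> H)"

text \<open>The action \<open>\<sigma> \<otimes> id\<close> of a Galois automorphism on \<open>L \<otimes>\<^sub>k H = L[\<int>\<^sup>n]\<close>.\<close>

definition galois_act ::
  "('n::finite, 'l::field) laurent set \<Rightarrow> ('l \<Rightarrow> 'l) \<Rightarrow> ('n, 'l) laurent \<Rightarrow> ('n, 'l) laurent" where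
  "galois_act H \<sigma> =
     (THE s. (\<forall>f g. s (f + g) = s f + s g) \<and>
             (\<forall>c. \<forall>h\<in>H. s (scalar c * h) = scalar (\<sigma> c) * h))"

text \<open>A homomorphism \<open>T\<^sub>L \<rightarrow> \<bbbG>\<^sub>m\<close> of \<open>L\<close>-groups is a Hopf algebra map \<open>L[t, t\<^sup>-\<^sup>1] \<rightarrow> L[T]\<close>; it is
  determined by the image of \<open>t\<close>, an arbitrary group-like unit.\<close>

definition char_lattice :: "('n::finite, 'l::field) laurent monoid" where
  "char_lattice = \<lparr>carrier = {f. f dvd 1 \<and> comul f = tens f f}, monoid.mult = (*), one = 1\<rparr>"

definition torus_glattice ::
  "'l::field set \<Rightarrow> ('n::finite, 'l) laurent set \<Rightarrow> (('n, 'l) laurent, 'l \<Rightarrow> 'l) glattice" where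
  "torus_glattice K H = \<lparr>lat = char_lattice, grp = galois_group K, act = galois_act H\<rparr>"

section \<open>Fans and toric varieties\<close>

text \<open>For a lattice \<open>M\<close> the space \<open>M\<^sup>0 \<otimes> \<real>\<close> is \<open>Hom(M, \<real>)\<close>, realised by functions that vanish
  outside the carrier of \<open>M\<close>.\<close>

definition real_dual :: "'m monoid \<Rightarrow> ('m \<Rightarrow> real) set" where
  "real_dual M =
     {u. (\<forall>x\<in>carrier M. \<forall>y\<in>carrier M. u (x \<otimes>\<^bsub>M\<^esub> y) = u x + u y) \<and>
         (\<forall>x. x \<notin> carrier M \<longrightarrow> u x = 0)}"

definition int_dual :: "'m monoid \<Rightarrow> ('m \<Rightarrow> real) set" where
  "int_dual M = {u \<in> real_dual M. \<forall>x. u x \<in> \<int>}"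

definition int_dual_basis :: "'m monoid \<Rightarrow> ('m \<Rightarrow> real) set \<Rightarrow> bool" where
  "int_dual_basis M B \<longleftrightarrow>
     finite B \<and> B \<subseteq> int_dual M \<and>
     (\<forall>v\<in>int_dual M. \<exists>!c :: ('m \<Rightarrow> real) \<Rightarrow> int.
        (\<forall>b. b \<notin> B \<longrightarrow> c b = 0) \<and> v = (\<lambda>x. \<Sum>b\<in>B. of_int (c b) * b x))"

definition cone_gen :: "('m \<Rightarrow> real) set \<Rightarrow> ('m \<Rightarrow> real) set" where
  "cone_gen S = {(\<lambda>x. \<Sum>u\<in>S. c u * u x) | c. \<forall>u\<in>S. c u \<ge> 0}"

definition rational_cone :: "'m monoid \<Rightarrow> ('m \<Rightarrow> real) set \<Rightarrow> bool" where
  "rational_cone M \<sigma> \<longleftrightarrow> (\<exists>S. finite S \<and> S \<subseteq> int_dual M \<and> \<sigma> = cone_gen S)"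

definition strongly_convex :: "('m \<Rightarrow> real) set \<Rightarrow> bool" where
  "strongly_convex \<sigma> \<longleftrightarrow> (\<forall>u\<in>\<sigma>. (\<lambda>x. - u x) \<in> \<sigma> \<longrightarrow> u = (\<lambda>x. 0))"

definition cone_face :: "'m monoid \<Rightarrow> ('m \<Rightarrow> real) set \<Rightarrow> ('m \<Rightarrow> real) set \<Rightarrow> bool" where
  "cone_face M \<tau> \<sigma> \<longleftrightarrow>
     (\<exists>m\<in>carrier M. (\<forall>u\<in>\<sigma>. u m \<ge> 0) \<and> \<tau> = {u\<in>\<sigma>. u m = 0})"

definition fan :: "'m monoid \<Rightarrow> ('m \<Rightarrow> real) set set \<Rightarrow> bool" where
  "fan M \<Sigma> \<longleftrightarrow>
     finite \<Sigma> \<and> \<Sigma> \<noteq> {} \<and>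
     (\<forall>\<sigma>\<in>\<Sigma>. rational_cone M \<sigma> \<and> strongly_convex \<sigma>) \<and>
     (\<forall>\<sigma>\<in>\<Sigma>. \<forall>\<tau>. cone_face M \<tau> \<sigma> \<longrightarrow> \<tau> \<in> \<Sigma>) \<and>
     (\<forall>\<sigma>\<in>\<Sigma>. \<forall>\<tau>\<in>\<Sigma>. cone_face M (\<sigma> \<inter> \<tau>) \<sigma> \<and> cone_face M (\<sigma> \<inter> \<tau>) \<tau>)"

definition smooth_fan :: "'m monoid \<Rightarrow> ('m \<Rightarrow> real) set set \<Rightarrow> bool" where
  "smooth_fan M \<Sigma> \<longleftrightarrow> fan M \<Sigma> \<and> (\<forall>\<sigma>\<in>\<Sigma>. \<exists>B S. int_dual_basis M B \<and> S \<subseteq> B \<and> \<sigma> = cone_gen S)"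

definition complete_fan :: "'m monoid \<Rightarrow> ('m \<Rightarrow> real) set set \<Rightarrow> bool" where
  "complete_fan M \<Sigma> \<longleftrightarrow> fan M \<Sigma> \<and> \<Union>\<Sigma> = real_dual M"

subsection \<open>Torus-invariant Cartier divisors and ampleness\<close>

text \<open>A torus-invariant Cartier divisor \<open>D\<close> on \<open>X\<^sub>\<Sigma>\<close> is given by \<open>d \<sigma> \<in> M\<close> for \<open>\<sigma> \<in> \<Sigma>\<close>, the sheaf
  \<open>\<O>(D)\<close> being generated by the character \<open>\<chi>\<^bsup>d \<sigma>\<^esup>\<close> on the chart \<open>U\<^sub>\<sigma> = Spec L[\<sigma>\<^sup>\<or> \<inter> M]\<close>.  The
  generators have to agree up to a unit of \<open>L[\<tau>\<^sup>\<or> \<inter> M]\<close> on \<open>U\<^sub>\<tau> \<subseteq> U\<^sub>\<sigma>\<close> for every face \<open>\<tau>\<close> of \<open>\<sigma>\<close>.\<close>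

definition invariant_cartier ::
  "'m monoid \<Rightarrow> ('m \<Rightarrow> real) set set \<Rightarrow> (('m \<Rightarrow> real) set \<Rightarrow> 'm) \<Rightarrow> bool" where
  "invariant_cartier M \<Sigma> d \<longleftrightarrow>
     (\<forall>\<sigma>\<in>\<Sigma>. d \<sigma> \<in> carrier M) \<and>
     (\<forall>\<sigma>\<in>\<Sigma>. \<forall>\<tau>\<in>\<Sigma>. cone_face M \<tau> \<sigma> \<longrightarrow> (\<forall>u\<in>\<tau>. u (d \<sigma>) = u (d \<tau>)))"

text \<open>\<open>\<chi>\<^sup>m\<close> is a global section of \<open>\<O>(nD)\<close> iff \<open>m - n d \<sigma> \<in> \<sigma>\<^sup>\<or>\<close> for all \<open>\<sigma> \<in> \<Sigma>\<close>.\<close>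

definition invariant_section ::
  "'m monoid \<Rightarrow> ('m \<Rightarrow> real) set set \<Rightarrow> (('m \<Rightarrow> real) set \<Rightarrow> 'm) \<Rightarrow> nat \<Rightarrow> 'm \<Rightarrow> bool" where
  "invariant_section M \<Sigma> d n m \<longleftrightarrow>
     m \<in> carrier M \<and> (\<forall>\<sigma>\<in>\<Sigma>. \<forall>u\<in>\<sigma>. u m \<ge> real n * u (d \<sigma>))"

text \<open>The open set where the section \<open>\<chi>\<^sup>m\<close> of \<open>\<O>(nD)\<close> does not vanish, as the set of cones of its
  subfan: it contains \<open>U\<^sub>\<sigma>\<close> iff \<open>\<chi>\<^bsup>m - n d \<sigma>\<^esup>\<close> is a unit on \<open>U\<^sub>\<sigma>\<close>, i.e. \<open>m - n d \<sigma> \<in> \<sigma>\<^sup>\<bottom>\<close>.\<close>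

definition nonvanishing ::
  "('m \<Rightarrow> real) set set \<Rightarrow> (('m \<Rightarrow> real) set \<Rightarrow> 'm) \<Rightarrow> nat \<Rightarrow> 'm \<Rightarrow> ('m \<Rightarrow> real) set set" where
  "nonvanishing \<Sigma> d n m = {\<sigma>\<in>\<Sigma>. \<forall>u\<in>\<sigma>. u m = real n * u (d \<sigma>)}"

text \<open>The affine torus-invariant open subsets of \<open>X\<^sub>\<Sigma>\<close> are the \<open>U\<^sub>\<sigma>\<close>, whose subfan consists of the
  faces of \<open>\<sigma>\<close>.\<close>

definition affine_subfan ::
  "'m monoid \<Rightarrow> ('m \<Rightarrow> real) set set \<Rightarrow> ('m \<Rightarrow> real) set set \<Rightarrow> bool" where
  "affine_subfan M \<Sigma> \<Delta> \<longleftrightarrow> (\<exists>\<sigma>\<in>\<Sigma>. \<Delta> = {\<tau>. cone_face M \<tau> \<sigma>})"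

text \<open>\<open>D\<close> is ample: every point lies in an affine non-vanishing locus of a global section of some
  \<open>\<O>(nD)\<close>, \<open>n \<ge> 1\<close>.  Since \<open>D\<close> is torus-invariant, it is enough to look at torus orbits (one for each
  cone) and at the sections \<open>\<chi>\<^sup>m\<close>.  For a complete fan this says that the support function of \<open>D\<close>
  is strictly convex.\<close>

definition ample ::
  "'m monoid \<Rightarrow> ('m \<Rightarrow> real) set set \<Rightarrow> (('m \<Rightarrow> real) set \<Rightarrow> 'm) \<Rightarrow> bool" where
  "ample M \<Sigma> d \<longleftrightarrow>
     (\<forall>\<sigma>\<in>\<Sigma>. \<exists>n m. n \<ge> 1 \<and> invariant_section M \<Sigma> d n m \<and>
        \<sigma> \<in> nonvanishing \<Sigma> d n m \<and> affine_subfan M \<Sigma> (nonvanishing \<Sigma> d n m))"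

definition projective_fan :: "'m monoid \<Rightarrow> ('m \<Rightarrow> real) set set \<Rightarrow> bool" where
  "projective_fan M \<Sigma> \<longleftrightarrow> complete_fan M \<Sigma> \<and> (\<exists>d. invariant_cartier M \<Sigma> d \<and> ample M \<Sigma> d)"

subsection \<open>Toric varieties\<close>

text \<open>A toric variety is recorded by the character lattice of its torus and its fan.\<close>

type_synonym 'm toric = "'m monoid \<times> ('m \<Rightarrow> real) set set"

definition pull_dual :: "'m monoid \<Rightarrow> ('m \<Rightarrow> 'n) \<Rightarrow> ('n \<Rightarrow> real) \<Rightarrow> 'm \<Rightarrow> real" where
  "pull_dual M f u = (\<lambda>x. if x \<in> carrier M then u (f x) else 0)"

definition pull_fan ::
  "'m monoid \<Rightarrow> ('m \<Rightarrow> 'n) \<Rightarrow> ('n \<Rightarrow> real) set set \<Rightarrow> ('m \<Rightarrow> real) set set" where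
  "pull_fan M f \<Sigma> = (\<lambda>\<sigma>. pull_dual M f ` \<sigma>) ` \<Sigma>"

definition toric_iso :: "'m toric \<Rightarrow> 'n toric \<Rightarrow> bool" where
  "toric_iso V W \<longleftrightarrow> (\<exists>f \<in> iso (fst V) (fst W). snd V = pull_fan (fst V) f (snd W))"

definition prod_cone ::
  "'m monoid \<Rightarrow> 'n monoid \<Rightarrow> ('m \<Rightarrow> real) set \<Rightarrow> ('n \<Rightarrow> real) set \<Rightarrow> ('m \<times> 'n \<Rightarrow> real) set" where
  "prod_cone M N \<sigma> \<tau> =
     {(\<lambda>(x, y). if x \<in> carrier M \<and> y \<in> carrier N then u x + v y else 0) | u v. u \<in> \<sigma> \<and> v \<in> \<tau>}"

definition toric_prod :: "'m toric \<Rightarrow> 'n toric \<Rightarrow> ('m \<times> 'n) toric" (infixr "\<times>\<^sub>t" 80) where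
  "V \<times>\<^sub>t W =
     (fst V \<times>\<times> fst W, {prod_cone (fst V) (fst W) \<sigma> \<tau> | \<sigma> \<tau>. \<sigma> \<in> snd V \<and> \<tau> \<in> snd W})"

definition toric_P1 :: "int toric" where
  "toric_P1 = (integer_group, {cone_gen {}, cone_gen {real_of_int}, cone_gen {\<lambda>x. - real_of_int x}})"

subsection \<open>Demazure models\<close>

definition dual_act :: "('m, 'g) glattice \<Rightarrow> 'g \<Rightarrow> ('m \<Rightarrow> real) \<Rightarrow> 'm \<Rightarrow> real" where
  "dual_act P g u = (\<lambda>x. if x \<in> carrier (lat P) then u (act P (inv\<^bsub>grp P\<^esub> g) x) else 0)"

definition demazure_fan :: "('m, 'g) glattice \<Rightarrow> ('m \<Rightarrow> real) set set \<Rightarrow> bool" where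
  "demazure_fan P \<Sigma> \<longleftrightarrow>
     smooth_fan (lat P) \<Sigma> \<and> projective_fan (lat P) \<Sigma> \<and>
     (\<forall>g\<in>carrier (grp P). \<forall>\<sigma>\<in>\<Sigma>. dual_act P g ` \<sigma> \<in> \<Sigma>)"

text \<open>The toric variety \<open>V\<close>, with its torus identified with \<open>T\<^sub>L\<close> by some isomorphism (of character
  lattices), is a Demazure model of \<open>T\<close>; here \<open>P\<close> is the character lattice of \<open>T\<^sub>L\<close> with its Galois
  action.\<close>

definition demazure_model :: "('m, 'g) glattice \<Rightarrow> 'n toric \<Rightarrow> bool" where
  "demazure_model P V \<longleftrightarrow>
     (\<exists>f \<in> iso (lat P) (fst V). demazure_fan P (pull_fan (lat P) f (snd V)))"

section \<open>Root systems\<close>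

definition cartan :: "'a::real_inner \<Rightarrow> 'a \<Rightarrow> real" where
  "cartan \<beta> \<alpha> = 2 * (\<beta> \<bullet> \<alpha>) / (\<alpha> \<bullet> \<alpha>)"

definition root_reflection :: "'a::real_inner \<Rightarrow> 'a \<Rightarrow> 'a" where
  "root_reflection \<alpha> x = x - cartan x \<alpha> *\<^sub>R \<alpha>"

text \<open>Crystallographic reduced root systems in the subspace \<open>\<real>\<Phi> = span \<Phi>\<close>, which may be a proper
  subspace of the ambient Euclidean space.\<close>

definition root_system :: "'a::euclidean_space set \<Rightarrow> bool" where
  "root_system \<Phi> \<longleftrightarrow>
     finite \<Phi> \<and> 0 \<notin> \<Phi> \<and>
     (\<forall>\<alpha>\<in>\<Phi>. root_reflection \<alpha> ` \<Phi> \<subseteq> \<Phi>) \<and>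
     (\<forall>\<alpha>\<in>\<Phi>. \<forall>\<beta>\<in>\<Phi>. cartan \<beta> \<alpha> \<in> \<int>) \<and>
     (\<forall>\<alpha>\<in>\<Phi>. \<forall>c. c *\<^sub>R \<alpha> \<in> \<Phi> \<longrightarrow> c = 1 \<or> c = -1)"

definition irreducible_roots :: "'a::euclidean_space set \<Rightarrow> bool" where
  "irreducible_roots \<Phi> \<longleftrightarrow>
     \<Phi> \<noteq> {} \<and>
     \<not> (\<exists>\<Phi>\<^sub>1 \<Phi>\<^sub>2. \<Phi>\<^sub>1 \<noteq> {} \<and> \<Phi>\<^sub>2 \<noteq> {} \<and> \<Phi> = \<Phi>\<^sub>1 \<union> \<Phi>\<^sub>2 \<and> (\<forall>\<alpha>\<in>\<Phi>\<^sub>1. \<forall>\<beta>\<in>\<Phi>\<^sub>2. \<alpha> \<bullet> \<beta> = 0))"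

definition simply_laced :: "'a::euclidean_space set \<Rightarrow> bool" where
  "simply_laced \<Phi> \<longleftrightarrow> (\<forall>\<alpha>\<in>\<Phi>. \<forall>\<beta>\<in>\<Phi>. \<beta> \<noteq> \<alpha> \<longrightarrow> \<beta> \<noteq> - \<alpha> \<longrightarrow> \<bar>cartan \<beta> \<alpha>\<bar> \<le> 1)"

definition irreducible_simply_laced :: "'a::euclidean_space set \<Rightarrow> bool" where
  "irreducible_simply_laced \<Phi> \<longleftrightarrow> root_system \<Phi> \<and> irreducible_roots \<Phi> \<and> simply_laced \<Phi>"

definition root_prod :: "'a::euclidean_space set \<Rightarrow> 'b::euclidean_space set \<Rightarrow> ('a \<times> 'b) set"
    (infixr "\<times>\<^sub>r" 80) where
  "\<Phi> \<times>\<^sub>r \<Psi> = (\<lambda>\<alpha>. (\<alpha>, 0)) ` \<Phi> \<union> (\<lambda>\<beta>. (0, \<beta>)) ` \<Psi>"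

subsection \<open>Lattices and groups attached to a root system\<close>

definition int_span :: "'a::real_vector set \<Rightarrow> 'a set" where
  "int_span = module.span (\<lambda>(n::int) x. real_of_int n *\<^sub>R x)"

definition additive_monoid :: "'a::comm_monoid_add set \<Rightarrow> 'a monoid" where
  "additive_monoid S = \<lparr>carrier = S, monoid.mult = (+), one = 0\<rparr>"

definition root_lattice :: "'a::euclidean_space set \<Rightarrow> 'a monoid" where
  "root_lattice \<Phi> = additive_monoid (int_span \<Phi>)"

definition weight_lattice :: "'a::euclidean_space set \<Rightarrow> 'a monoid" where
  "weight_lattice \<Phi> = additive_monoid {x \<in> span \<Phi>. \<forall>\<alpha>\<in>\<Phi>. cartan x \<alpha> \<in> \<int>}"

definition linear_auts :: "'a::real_vector set \<Rightarrow> ('a \<Rightarrow> 'a) set" where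
  "linear_auts S = {f \<in> Bij S. \<exists>g. linear g \<and> (\<forall>x\<in>S. f x = g x)}"

definition aut_group :: "'a::euclidean_space set \<Rightarrow> ('a \<Rightarrow> 'a) monoid" where
  "aut_group \<Phi> = BijGroup (span \<Phi>) \<lparr>carrier := {f \<in> linear_auts (span \<Phi>). f ` \<Phi> = \<Phi>}\<rparr>"

definition weyl_group :: "'a::euclidean_space set \<Rightarrow> ('a \<Rightarrow> 'a) monoid" where
  "weyl_group \<Phi> =
     subgroup_generated (BijGroup (span \<Phi>)) {restrict (root_reflection \<alpha>) (span \<Phi>) | \<alpha>. \<alpha> \<in> \<Phi>}"

text \<open>The pairs \<open>(\<int>\<Phi>, Aut(\<Phi>))\<close> and \<open>(\<Lambda>(\<Phi>), Aut(\<Phi>))\<close>.\<close>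

definition root_glattice :: "'a::euclidean_space set \<Rightarrow> ('a, 'a \<Rightarrow> 'a) glattice" where
  "root_glattice \<Phi> = \<lparr>lat = root_lattice \<Phi>, grp = aut_group \<Phi>, act = (\<lambda>f x. f x)\<rparr>"

definition weight_glattice :: "'a::euclidean_space set \<Rightarrow> ('a, 'a \<Rightarrow> 'a) glattice" where
  "weight_glattice \<Phi> = \<lparr>lat = weight_lattice \<Phi>, grp = aut_group \<Phi>, act = (\<lambda>f x. f x)\<rparr>"

subsection \<open>The toric variety of a root system\<close>

text \<open>The chambers live in \<open>(\<int>\<Phi>)\<^sup>0 \<otimes> \<real>\<close>: the closed chamber of a regular functional \<open>u\<close> consists of
  the functionals on the same closed side as \<open>u\<close> of each root hyperplane \<open>{v. v \<alpha> = 0}\<close>.\<close>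

definition closed_chamber ::
  "'a::euclidean_space set \<Rightarrow> ('a \<Rightarrow> real) \<Rightarrow> ('a \<Rightarrow> real) set" where
  "closed_chamber \<Phi> u = {v \<in> real_dual (root_lattice \<Phi>). \<forall>\<alpha>\<in>\<Phi>. u \<alpha> > 0 \<longrightarrow> v \<alpha> \<ge> 0}"

definition closed_chambers :: "'a::euclidean_space set \<Rightarrow> ('a \<Rightarrow> real) set set" where
  "closed_chambers \<Phi> =
     {closed_chamber \<Phi> u | u. u \<in> real_dual (root_lattice \<Phi>) \<and> (\<forall>\<alpha>\<in>\<Phi>. u \<alpha> \<noteq> 0)}"

definition toric_root :: "'a::euclidean_space set \<Rightarrow> 'a toric" where
  "toric_root \<Phi> =
     (root_lattice \<Phi>, {\<tau>. \<exists>\<sigma>\<in>closed_chambers \<Phi>. cone_face (root_lattice \<Phi>) \<tau> \<sigma>})"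

subsection \<open>Standard models\<close>

definition roots_A :: "(real ^ 'n::finite) set" where
  "roots_A = {axis i 1 - axis j 1 | i j. i \<noteq> j}"

definition roots_D :: "(real ^ 'n::finite) set" where
  "roots_D = {a *\<^sub>R axis i 1 + b *\<^sub>R axis j 1 | a b i j. i \<noteq> j \<and> a \<in> {1, -1} \<and> b \<in> {1, -1}}"

definition A1 :: "(real ^ 2) set" where "A1 = roots_A"

definition A2 :: "(real ^ 3) set" where "A2 = roots_A"

definition A3 :: "(real ^ 4) set" where "A3 = roots_A"

definition A4 :: "(real ^ 5) set" where "A4 = roots_A"

definition D4 :: "(real ^ 4) set" where "D4 = roots_D"

section \<open>The maximal finite subgroups of GL(4, Z)\<close>

text \<open>\<open>\<int>A\<^sub>2 \<otimes> \<int>A\<^sub>2\<close> is realised inside \<open>\<real>\<^sup>3 \<otimes> \<real>\<^sup>3\<close>, the space of \<open>3 \<times> 3\<close> matrices; swapping the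
  tensor factors is transposition.  An automorphism \<open>f\<close> with
  \<open>f (\<alpha> \<otimes> \<beta>) = v \<alpha> \<otimes> w \<beta>\<close> for all roots is \<open>v \<otimes> w\<close>.\<close>

definition outer :: "real ^ 'n \<Rightarrow> real ^ 'm \<Rightarrow> real ^ 'm ^ 'n" where
  "outer x y = (\<chi> i j. x $ i * y $ j)"

definition A2_tensors :: "(real ^ 3 ^ 3) set" where
  "A2_tensors = {outer \<alpha> \<beta> | \<alpha> \<beta>. \<alpha> \<in> A2 \<and> \<beta> \<in> A2}"

definition tensor_group :: "(real ^ 3 ^ 3 \<Rightarrow> real ^ 3 ^ 3) monoid" where
  "tensor_group = subgroup_generated (BijGroup (span A2_tensors))
     ({f \<in> linear_auts (span A2_tensors).
         \<exists>v \<in> carrier (weyl_group A2). \<exists>w \<in> carrier (weyl_group A2).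
           \<forall>\<alpha>\<in>A2. \<forall>\<beta>\<in>A2. f (outer \<alpha> \<beta>) = outer (v \<alpha>) (w \<beta>)} \<union>
      {restrict transpose (span A2_tensors), restrict uminus (span A2_tensors)})"

definition MG1 where
  "MG1 = glattice_sum
     \<lparr>lat = root_lattice A1 \<times>\<times> root_lattice A1, grp = aut_group (A1 \<times>\<^sub>r A1), act = (\<lambda>f x. f x)\<rparr>
     (root_glattice A2)"

definition MG2 where
  "MG2 = glattice_sum (weight_glattice A3) (root_glattice A1)"

definition MG3 where
  "MG3 = glattice_sum (root_glattice A3) (root_glattice A1)"

definition MG4 where
  "MG4 = \<lparr>lat = additive_monoid (int_span A2_tensors), grp = tensor_group, act = (\<lambda>f x. f x)\<rparr>"

definition MG5 where
  "MG5 = \<lparr>lat = root_lattice A2 \<times>\<times> root_lattice A2, grp = aut_group (A2 \<times>\<^sub>r A2), act = (\<lambda>f x. f x)\<rparr>"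

definition MG6 where
  "MG6 = root_glattice A4"

definition MG7 where
  "MG7 = weight_glattice A4"

definition MG8 where
  "MG8 = \<lparr>lat = root_lattice A1 \<times>\<times> root_lattice A1 \<times>\<times> root_lattice A1 \<times>\<times> root_lattice A1,
          grp = aut_group (A1 \<times>\<^sub>r A1 \<times>\<^sub>r A1 \<times>\<^sub>r A1), act = (\<lambda>f x. f x)\<rparr>"

definition MG9 where
  "MG9 = root_glattice D4"

text \<open>\<open>P\<close> is the \<open>i\<close>-th pair of the list.  The pairs have different types, so this is a relation and
  not a function of \<open>i\<close>.\<close>

definition is_MG :: "nat \<Rightarrow> ('m, 'g) glattice \<Rightarrow> bool" where
  "is_MG i P \<longleftrightarrow>
     (i = 1 \<and> glattice_iso P MG1) \<or> (i = 2 \<and> glattice_iso P MG2) \<or>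
     (i = 3 \<and> glattice_iso P MG3) \<or> (i = 4 \<and> glattice_iso P MG4) \<or>
     (i = 5 \<and> glattice_iso P MG5) \<or> (i = 6 \<and> glattice_iso P MG6) \<or>
     (i = 7 \<and> glattice_iso P MG7) \<or> (i = 8 \<and> glattice_iso P MG8) \<or>
     (i = 9 \<and> glattice_iso P MG9)"

end

theory Submission
  imports Defs
begin

text \<open>The torus matters only through its character lattice with Galois action.  Each of the six pairs is
\<open>(\<int>\<Phi>, Aut(\<Phi>))\<close> for a product \<open>\<Phi>\<close> of root systems of types \<open>A\<^sub>n\<close> and \<open>D\<^sub>4\<close>, and for \<^emph>\<open>every\<close> root system
the fan of Weyl chambers is smooth, projective and stable under \<open>Aut(\<Phi>)\<close>; so \<open>X(\<Phi>)\<close> is a Demazure model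
of every torus whose pair is \<open>(\<int>\<Phi>, Aut(\<Phi>))\<close> (\<open>demazure_model_toric_root\<close>).

\<^bold>\<open>The chamber fan.\<close>  A functional \<open>u\<close> on \<open>\<int>\<Phi>\<close> without zeros on \<open>\<Phi>\<close> splits the roots into positive and
negative ones.  The positive roots that are not sums of two positive roots are pairwise obtuse
and lie on one side of a hyperplane, hence are independent over \<open>\<int>\<close> (\<open>simple_independent\<close>), and they
generate \<open>\<int>\<Phi>\<close>.  The chamber of \<open>u\<close> is therefore the cone over the dual basis, which gives smoothness.
Two faces of chambers meet in a common face because a suitable sum of positive roots vanishes
exactly on the intersection (\<open>face_Int_face\<close>).  For projectivity take minus the sum of the positive roots on
each chamber: the resulting support function is \<open>v \<mapsto> - (\<Sum>\<alpha>\<in>\<Phi>. \<bar>v \<alpha>\<bar>) / 2\<close> on all chambers at once, so the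
local data agree on overlaps, and it is strictly convex because \<open>\<bar>v \<alpha>\<bar> = v \<alpha>\<close> for all positive
\<open>\<alpha>\<close> only on the chamber itself (\<open>divisor_eq_iff\<close>).  From the axioms of a root system
these arguments use, besides finiteness and \<open>0 \<notin> \<Phi>\<close>, symmetry under \<open>-1\<close> and the fact that \<open>\<alpha> - \<beta>\<close> is a root when \<open>\<alpha> \<bullet> \<beta> > 0\<close> (\<open>diff_root\<close>).

\<^bold>\<open>Products.\<close>  Lattice and chamber fan of \<open>\<Phi> \<times> \<Psi>\<close> are literally the products of those of \<open>\<Phi>\<close> and
\<open>\<Psi>\<close> (\<open>root_lattice_prod\<close>, \<open>toric_root_prod\<close>), and \<open>X(A\<^sub>1)\<close> is the projective line.  The groups in the first and
third pair are \<open>Aut(\<Phi>) \<times> Aut(\<Psi>)\<close> with \<open>\<Phi>\<close> of type \<open>A\<^sub>2\<close> or \<open>A\<^sub>3\<close> and \<open>\<Psi>\<close> a power of \<open>A\<^sub>1\<close>; this is all of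
\<open>Aut(\<Phi> \<times> \<Psi>)\<close> because the roots of \<open>\<Phi>\<close> are recognised by a property that linear automorphisms preserve:
they can be added to some root with a root as the result (\<open>aut_prod_surj\<close>).

\<^bold>\<open>The torus.\<close>  Transporting the fan to the character lattice of the torus requires that the Galois group really
acts on that lattice, i.e. that the semilinear action on \<open>L[\<int>\<^sup>n]\<close> determined by the descent datum sends group-like
elements to group-like elements (\<open>galois_act_char_lattice\<close>).\<close>

section \<open>The Galois action on the character lattice\<close>

abbreviation "lookup \<equiv> Poly_Mapping.lookup"
abbreviation "keys \<equiv> Poly_Mapping.keys"

lemma lookup_comul:
  "lookup (comul f) (a, b) = (if a = b then lookup f a else 0)"
proof -
  have "lookup (comul f) (a, b) =
      (\<Sum>m\<in>keys f. if m = a then (if a = b then lookup f a else 0) else 0)"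
    unfolding comul_def lookup_sum
    by (intro sum.cong refl) (auto simp: lookup_single when_def)
  then show ?thesis
    by (auto simp: sum.delta in_keys_iff)
qed

lemma lookup_tens:
  "lookup (tens f g) (a, b) = lookup f a * lookup g b"
proof -
  have "lookup (tens f g) (a, b) =
      (\<Sum>m\<in>keys f. \<Sum>n\<in>keys g.
         if n = b then (if m = a then lookup f a * lookup g b else 0) else 0)"
    unfolding tens_def lookup_sum
    by (intro sum.cong refl) (auto simp: lookup_single when_def)
  then show ?thesis
    by (cases "lookup g b = 0") (auto simp: sum.delta in_keys_iff)
qed

lemma lookup_scalar_mult:
  "lookup (scalar c * f) a = c * lookup f a"
  unfolding scalar_def mult_map_scale_conv_mult [symmetric] by (simp add: map.rep_eq when_def)

lemma scalar_mult: "scalar (c * d) = scalar c * scalar d"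
  by (simp add: scalar_def mult_single)

lemma scalar_add: "scalar (c + d) = scalar c + scalar d"
  by (simp add: scalar_def single_add)

lemma scalar_one [simp]: "scalar 1 = 1"
  by (simp add: scalar_def)

lemma scalar_zero [simp]: "scalar 0 = 0"
  by (simp add: scalar_def)

lemma vector_space_laurent:
  "vector_space (\<lambda>c (f :: ('n::finite, 'l::field) laurent). scalar c * f)"
  by unfold_locales (simp_all add: scalar_mult scalar_add algebra_simps)

text \<open>Comparing coefficients at \<open>(a, b)\<close> in \<open>comul f = tens f f\<close> gives \<open>f\<^sub>a f\<^sub>b = 0\<close> for \<open>a \<noteq> b\<close> and \<open>f\<^sub>a f\<^sub>a = f\<^sub>a\<close>,
so a non-zero \<open>f\<close> has a single coefficient, and that coefficient is \<open>1\<close>.\<close>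

lemma grouplike_iff:
  fixes f :: "('n::finite, 'l::field) laurent"
  shows "f dvd 1 \<and> comul f = tens f f \<longleftrightarrow> (\<exists>m. f = Poly_Mapping.single m 1)"
proof
  assume f: "f dvd 1 \<and> comul f = tens f f"
  have prod: "(if a = b then lookup f a else 0) =
      lookup f a * lookup f b" for a b
    using f by (metis lookup_comul lookup_tens)
  have "f \<noteq> 0"
    using f by auto
  then obtain m where m: "lookup f m \<noteq> 0"
    by (metis poly_mapping_eqI lookup_zero)
  have "lookup f m = 1"
    using prod[of m m] m by simp
  moreover have "lookup f a = 0" if "a \<noteq> m" for a
    using prod[of m a] m that by auto
  ultimately have "f = Poly_Mapping.single m 1"
    by (intro poly_mapping_eqI) (auto simp: lookup_single when_def)
  then show "\<exists>m. f = Poly_Mapping.single m 1" ..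
next
  assume "\<exists>m. f = Poly_Mapping.single m 1"
  then obtain m where f: "f = Poly_Mapping.single m 1" ..
  have "1 = f * Poly_Mapping.single (- m) 1"
    by (simp add: f mult_single)
  then have "f dvd 1" ..
  moreover have "comul f = tens f f"
    by (intro poly_mapping_eqI, simp only: split_paired_all lookup_comul lookup_tens)
      (auto simp: f lookup_single when_def)
  ultimately show "f dvd 1 \<and> comul f = tens f f" by simp
qed

lemma carrier_char_lattice:
  "carrier char_lattice = range (\<lambda>m. Poly_Mapping.single m 1)"
  by (auto simp: char_lattice_def grouplike_iff)

lemma char_lattice_closed:
  "x \<in> carrier char_lattice \<Longrightarrow> y \<in> carrier char_lattice \<Longrightarrow>
    x \<otimes>\<^bsub>char_lattice\<^esub> y \<in> carrier char_lattice"
  unfolding carrier_char_lattice by (auto simp: char_lattice_def mult_single)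

lemma galois_setD:
  assumes "\<sigma> \<in> galois_set K"
  shows "bij \<sigma>" "\<sigma> (x + y) = \<sigma> x + \<sigma> y" "\<sigma> (x * y) = \<sigma> x * \<sigma> y" "\<sigma> 1 = 1" "\<sigma> 0 = 0"
    "x \<in> K \<Longrightarrow> \<sigma> x = x"
proof -
  have s: "\<sigma> \<in> ring_iso ring_of_type_algebra ring_of_type_algebra"
    using assms by (simp add: galois_set_def)
  show "bij \<sigma>" 
    using s by (auto simp: ring_iso_def ring_of_type_algebra_def)
  show add: "\<sigma> (x + y) = \<sigma> x + \<sigma> y" for x y
    using ring_iso_memE(3)[OF s, of x y] by (simp add: ring_of_type_algebra_def)
  show "\<sigma> (x * y) = \<sigma> x * \<sigma> y"
    using ring_iso_memE(2)[OF s, of x y] by (simp add: ring_of_type_algebra_def)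
  show "\<sigma> 1 = 1"
    using ring_iso_memE(4)[OF s] by (simp add: ring_of_type_algebra_def)
  show "\<sigma> 0 = 0"
    using add[of 0 0] by (metis add_cancel_right_left)
  show "x \<in> K \<Longrightarrow> \<sigma> x = x"
    using assms by (simp add: galois_set_def)
qed

lemma galois_setI:
  assumes "bij \<sigma>" "\<And>x y. \<sigma> (x + y) = \<sigma> x + \<sigma> y" "\<And>x y. \<sigma> (x * y) = \<sigma> x * \<sigma> y" "\<sigma> 1 = 1"
    "\<And>x. x \<in> K \<Longrightarrow> \<sigma> x = x"
  shows "\<sigma> \<in> galois_set K"
  using assms by (auto simp: galois_set_def ring_iso_def ring_hom_def ring_of_type_algebra_def)

lemma group_galois_group: "group (galois_group K)"
proof -
  interpret B: group "BijGroup (UNIV :: 'a set)"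
    by (rule group_BijGroup)
  have Bij: "\<sigma> \<in> Bij UNIV" if "\<sigma> \<in> galois_set K" for \<sigma> :: "'a \<Rightarrow> 'a"
    using galois_setD(1)[OF that] by (simp add: Bij_def)
  have comp: "\<sigma> \<otimes>\<^bsub>BijGroup UNIV\<^esub> \<tau> = \<sigma> \<circ> \<tau>" if "\<sigma> \<in> galois_set K" "\<tau> \<in> galois_set K" for \<sigma> \<tau> :: "'a \<Rightarrow> 'a"
    using that by (simp add: BijGroup_def Bij compose_def comp_def restrict_def)
  have "subgroup (galois_set K) (BijGroup UNIV)"
  proof
    show "galois_set K \<subseteq> carrier (BijGroup UNIV)"
      using Bij by (auto simp: BijGroup_def)
    show "\<sigma> \<otimes>\<^bsub>BijGroup UNIV\<^esub> \<tau> \<in> galois_set K" if st: "\<sigma> \<in> galois_set K" "\<tau> \<in> galois_set K" for \<sigma> \<tau>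
      unfolding comp[OF st]
      by (rule galois_setI) (auto simp: galois_setD[OF st(1)] galois_setD[OF st(2)] bij_comp)
    show "\<one>\<^bsub>BijGroup UNIV\<^esub> \<in> galois_set K"
      by (auto simp: BijGroup_def bij_def intro!: galois_setI)
    show "inv\<^bsub>BijGroup UNIV\<^esub> \<sigma> \<in> galois_set K" if s: "\<sigma> \<in> galois_set K" for \<sigma>
    proof -
      have inv: "inv\<^bsub>BijGroup UNIV\<^esub> \<sigma> = inv_into UNIV \<sigma>"
        using inv_BijGroup[OF Bij[OF s]] by (simp add: restrict_def)
      have b: "bij \<sigma>" by (rule galois_setD(1)[OF s])
      have eq: "inv_into UNIV \<sigma> x = y \<longleftrightarrow> x = \<sigma> y" for x y
        using b by (metis bij_inv_eq_iff)
      have r: "\<sigma> (inv_into UNIV \<sigma> x) = x" for x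
        using b by (simp add: bij_is_surj surj_f_inv_f)
      show ?thesis unfolding inv
        by (rule galois_setI) (use b in \<open>auto simp: eq r galois_setD[OF s] bij_imp_bij_inv\<close>)
    qed
  qed
  then show ?thesis
    unfolding galois_group_def by (rule B.subgroup_imp_group)
qed

lemma split_torusD:
  assumes H: "split_torus K H"
  shows "1 \<in> H" and "h \<in> H \<Longrightarrow> counit h \<in> K"
    and "h \<in> H \<Longrightarrow> \<exists>ps. set ps \<subseteq> H \<times> H \<and> comul h = (\<Sum>(a, b)\<leftarrow>ps. tens a b)"
proof -
  show "1 \<in> H"
    using H unfolding split_torus_def by (elim conjE)
  have "\<forall>f\<in>H. counit f \<in> K"
    using H unfolding split_torus_def by (elim conjE)
  then show "h \<in> H \<Longrightarrow> counit h \<in> K" by blast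
  have "\<forall>f\<in>H. \<exists>ps. set ps \<subseteq> H \<times> H \<and> comul f = (\<Sum>(a, b)\<leftarrow>ps. tens a b)"
    using H unfolding split_torus_def by (elim conjE)
  then show "h \<in> H \<Longrightarrow> \<exists>ps. set ps \<subseteq> H \<times> H \<and> comul h = (\<Sum>(a, b)\<leftarrow>ps. tens a b)"
    by (rule bspec)
qed

text \<open>A \<open>K\<close>-basis of \<open>H\<close> is an \<open>L\<close>-basis of the whole algebra, so the \<open>\<sigma>\<close>-semilinear extension of the identity
of \<open>H\<close> is forced, and applying \<open>\<sigma>\<close> to coordinates defines it.  That \<open>H\<close> spans over \<open>L\<close> is recorded as well: it
reduces later semilinear identities to elements of \<open>H\<close>.\<close>

lemma galois_act_unique:
  fixes H :: "('n::finite, 'l::field) laurent set"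
  assumes H: "split_torus K H" and \<sigma>: "\<sigma> \<in> galois_set K"
  shows "\<exists>!s. (\<forall>f g. s (f + g) = s f + s g) \<and> (\<forall>c. \<forall>h\<in>H. s (scalar c * h) = scalar (\<sigma> c) * h)"
    and "\<exists>A c. finite A \<and> A \<subseteq> H \<and> f = (\<Sum>b\<in>A. scalar (c b) * b)"
proof -
  interpret V: vector_space "\<lambda>c (f :: ('n, 'l) laurent). scalar c * f"
    by (rule vector_space_laurent)
  obtain B where indep: "V.independent B" and span: "V.span B = UNIV"
    and H_eq: "H = {\<Sum>b\<in>S. scalar (c b) * b | S c. finite S \<and> S \<subseteq> B \<and> c ` S \<subseteq> K}"
    using H unfolding split_torus_def by (elim conjE exE) (rule that)
  let ?r = "V.representation B"
  have "counit (1 :: ('n, 'l) laurent) \<in> K"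
    using split_torusD(1,2)[OF H] by blast
  then have one: "1 \<in> K"
    by (simp add: counit_def)
  have BH: "B \<subseteq> H"
  proof
    fix b assume "b \<in> B"
    then show "b \<in> H" unfolding H_eq
      by (intro CollectI exI[of _ "{b}"] exI[of _ "\<lambda>_. 1"]) (use one in auto)
  qed
  have fin: "finite {b. ?r f b \<noteq> 0}" for f
    by (rule V.finite_representation)
  have sub: "{b. ?r f b \<noteq> 0} \<subseteq> B" for f
    using V.representation_ne_zero by blast
  have rep: "(\<Sum>b | ?r f b \<noteq> 0. scalar (?r f b) * b) = f" for f
    by (rule V.sum_nonzero_representation_eq[OF indep]) (simp add: span)
  show "\<exists>A c. finite A \<and> A \<subseteq> H \<and> f = (\<Sum>b\<in>A. scalar (c b) * b)"
    using fin[of f] subset_trans[OF sub[of f] BH] rep[of f]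
    by (intro exI[of _ "{b. ?r f b \<noteq> 0}"] exI[of _ "?r f"] conjI) (simp_all only:)
  \<comment> \<open>The finite support depends on \<open>f\<close>; \<open>s_eq\<close> allows any larger finite set, so that two summands can share one.\<close>
  define s where "s f = (\<Sum>b | ?r f b \<noteq> 0. scalar (\<sigma> (?r f b)) * b)" for f
  have s_eq: "s f = (\<Sum>b\<in>A. scalar (\<sigma> (?r f b)) * b)" if "finite A" "{b. ?r f b \<noteq> 0} \<subseteq> A" for f A
    unfolding s_def by (rule sum.mono_neutral_left) (use that in \<open>auto simp: galois_setD[OF \<sigma>]\<close>)
  have add: "s (f + g) = s f + s g" for f g
  proof -
    let ?A = "{b. ?r f b \<noteq> 0} \<union> {b. ?r g b \<noteq> 0}"
    have r: "?r (f + g) b = ?r f b + ?r g b" for b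
      using V.representation_add[OF indep, of g f] by (simp add: span add.commute)
    show ?thesis
      using fin[of f] fin[of g] 
      by (subst s_eq[of ?A f], simp, simp, subst s_eq[of ?A g], simp, simp, subst s_eq[of ?A "f + g"])
        (auto simp: r galois_setD[OF \<sigma>] scalar_add distrib_right sum.distrib)
  qed
  have scale: "s (scalar c * h) = scalar (\<sigma> c) * h" if "h \<in> H" for c h
  proof -
    obtain S d where S: "finite S" "S \<subseteq> B" "d ` S \<subseteq> K" and h: "h = (\<Sum>b\<in>S. scalar (d b) * b)"
      using \<open>h \<in> H\<close> unfolding H_eq by blast
    have rh: "?r h = (\<lambda>b. if b \<in> S then d b else 0)"
    proof (rule V.representation_eqI[OF indep])
      have "(\<Sum>b | (if b \<in> S then d b else 0) \<noteq> 0. scalar (if b \<in> S then d b else 0) * b) =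
          (\<Sum>b\<in>S. scalar (if b \<in> S then d b else 0) * b)"
        by (rule sum.mono_neutral_left) (use S in auto)
      then show "(\<Sum>b | (if b \<in> S then d b else 0) \<noteq> 0. scalar (if b \<in> S then d b else 0) * b) = h"
        by (simp add: h)
    qed (use S in \<open>auto simp: span split: if_splits\<close>)
    have r: "?r (scalar c * h) b = c * ?r h b" for b
      using V.representation_scale[OF indep, of h c] by (simp add: span)
    have "s (scalar c * h) = (\<Sum>b\<in>S. scalar (\<sigma> (c * d b)) * b)"
      by (subst s_eq[of S]) (use S in \<open>auto simp: r rh\<close>)
    also have "\<dots> = (\<Sum>b\<in>S. scalar (\<sigma> c) * (scalar (d b) * b))"
    proof (intro sum.cong refl)
      fix b assume "b \<in> S"
      then have "\<sigma> (d b) = d b" using S by (intro galois_setD(6)[OF \<sigma>]) auto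
      then show "scalar (\<sigma> (c * d b)) * b = scalar (\<sigma> c) * (scalar (d b) * b)"
        by (simp add: galois_setD(3)[OF \<sigma>])
    qed
    also have "\<dots> = scalar (\<sigma> c) * h"
      by (simp add: h sum_distrib_left)
    finally show ?thesis .
  qed
  show "\<exists>!s. (\<forall>f g. s (f + g) = s f + s g) \<and> (\<forall>c. \<forall>h\<in>H. s (scalar c * h) = scalar (\<sigma> c) * h)"
  proof (rule ex1I[of _ s])
    show "(\<forall>f g. s (f + g) = s f + s g) \<and> (\<forall>c. \<forall>h\<in>H. s (scalar c * h) = scalar (\<sigma> c) * h)"
      using add scale by blast
    fix t assume t: "(\<forall>f g. t (f + g) = t f + t g) \<and> (\<forall>c. \<forall>h\<in>H. t (scalar c * h) = scalar (\<sigma> c) * h)"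
    have t0: "t 0 = 0"
      using t by (metis add_cancel_right_left)
    have tsum: "t (\<Sum>b\<in>A. g b) = (\<Sum>b\<in>A. t (g b))" for A and g :: "_ \<Rightarrow> ('n, 'l) laurent"
      by (induction A rule: infinite_finite_induct) (auto simp: t t0)
    show "t = s"
    proof
      fix f
      have "t f = (\<Sum>b | ?r f b \<noteq> 0. t (scalar (?r f b) * b))"
        by (subst rep[of f, symmetric]) (rule tsum)
      also have "\<dots> = s f" unfolding s_def
        by (intro sum.cong refl) (use sub[of f] BH t in blast)
      finally show "t f = s f" .
    qed
  qed
qed

lemma galois_act_props:
  fixes H :: "('n::finite, 'l::field) laurent set"
  assumes H: "split_torus K H" and \<sigma>: "\<sigma> \<in> galois_set K"
  shows galois_act_add: "galois_act H \<sigma> (f + g) = galois_act H \<sigma> f + galois_act H \<sigma> g"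
    and galois_act_H: "h \<in> H \<Longrightarrow> galois_act H \<sigma> (scalar c * h) = scalar (\<sigma> c) * h"
  using theI'[OF galois_act_unique(1)[OF assms]] unfolding galois_act_def by blast+

lemma galois_act_sum:
  assumes H: "split_torus K H" and \<sigma>: "\<sigma> \<in> galois_set K"
  shows "galois_act H \<sigma> (\<Sum>b\<in>A. g b) = (\<Sum>b\<in>A. galois_act H \<sigma> (g b))"
proof -
  have "galois_act H \<sigma> 0 = 0"
    using galois_act_add[OF assms, of 0 0] by simp
  then show ?thesis
    by (induction A rule: infinite_finite_induct) (auto simp: galois_act_add[OF assms])
qed

lemma galois_act_scale:
  assumes H: "split_torus K H" and \<sigma>: "\<sigma> \<in> galois_set K"
  shows "galois_act H \<sigma> (scalar c * f) = scalar (\<sigma> c) * galois_act H \<sigma> f"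
proof -
  obtain A d where A: "finite A" "A \<subseteq> H" and f: "f = (\<Sum>b\<in>A. scalar (d b) * b)"
    using galois_act_unique(2)[OF assms] by blast
  have "scalar c * f = (\<Sum>b\<in>A. scalar (c * d b) * b)"
    by (simp add: f sum_distrib_left scalar_mult mult.assoc)
  then have "galois_act H \<sigma> (scalar c * f) = (\<Sum>b\<in>A. scalar (\<sigma> (c * d b)) * b)"
    using A by (auto simp: galois_act_sum[OF assms] galois_act_H[OF assms] intro!: sum.cong)
  also have "\<dots> = scalar (\<sigma> c) * (\<Sum>b\<in>A. scalar (\<sigma> (d b)) * b)"
    by (simp add: sum_distrib_left scalar_mult mult.assoc galois_setD[OF \<sigma>])
  also have "(\<Sum>b\<in>A. scalar (\<sigma> (d b)) * b) = galois_act H \<sigma> f"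
    using A by (auto simp: f galois_act_sum[OF assms] galois_act_H[OF assms] intro!: sum.cong)
  finally show ?thesis .
qed

lemma laurent_sum_monomials:
  fixes f :: "('n::finite, 'l::field) laurent"
  shows "f = (\<Sum>a\<in>keys f. scalar (lookup f a) * Poly_Mapping.single a 1)"
proof (rule poly_mapping_eqI)
  fix k
  have "(\<Sum>a\<in>keys f. lookup f a * (1 when a = k)) =
      (\<Sum>a\<in>keys f. if a = k then lookup f k else 0)"
    by (intro sum.cong refl) (auto simp: when_def)
  then show "lookup f k = lookup
      (\<Sum>a\<in>keys f. scalar (lookup f a) * Poly_Mapping.single a 1) k"
    by (simp add: lookup_sum lookup_scalar_mult lookup_single sum.delta in_keys_iff)
qed

text \<open>When \<open>g k\<close> is additive for every \<open>k\<close>, this expression is additive in the whole polynomial, although the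
supports over which the sums run change.\<close>

definition keysum :: "('k \<Rightarrow> 'l::field \<Rightarrow> 'l) \<Rightarrow> ('k, 'l) poly_mapping \<Rightarrow> 'l" where
  "keysum g F = (\<Sum>k\<in>keys F. g k (lookup F k))"

lemma keysum_superset:
  assumes "finite A" "keys F \<subseteq> A" "\<And>k. g k 0 = 0"
  shows "keysum g F = (\<Sum>k\<in>A. g k (lookup F k))"
  unfolding keysum_def
  by (rule sum.mono_neutral_left) (use assms in \<open>auto simp: in_keys_iff\<close>)

lemma keysum_add:
  assumes "\<And>k. g k 0 = 0" "\<And>k a b. g k (a + b) = g k a + g k b"
  shows "keysum g (F + G) = keysum g F + keysum g G"
  unfolding keysum_def using assms by (rule setsum_keys_plus_distrib)

lemma keysum_tens:
  fixes f g :: "('n::finite, 'l::field) laurent" and u :: "'l \<Rightarrow> 'l"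
  assumes u0: "u 0 = 0" and u: "\<And>x y. u (x * y) = u x * u y"
  shows "keysum (\<lambda>(a, b) v. u v * p a * q b) (tens f g) =
    (\<Sum>a\<in>keys f. u (lookup f a) * p a) *
    (\<Sum>b\<in>keys g. u (lookup g b) * q b)"
proof -
  have "keysum (\<lambda>(a, b) v. u v * p a * q b) (tens f g) =
      (\<Sum>k\<in>keys f \<times> keys g.
         (\<lambda>(a, b) v. u v * p a * q b) k (lookup (tens f g) k))"
  proof (rule keysum_superset)
    show "keys (tens f g) \<subseteq> keys f \<times> keys g"
      by (auto simp: in_keys_iff lookup_tens)
  qed (auto simp: u0)
  also have "\<dots> = (\<Sum>a\<in>keys f. \<Sum>b\<in>keys g.
      (u (lookup f a) * p a) * (u (lookup g b) * q b))"
    unfolding sum.cartesian_product by (intro sum.cong refl) (auto simp: lookup_tens u mult_ac)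
  also have "\<dots> = (\<Sum>a\<in>keys f. u (lookup f a) * p a) *
    (\<Sum>b\<in>keys g. u (lookup g b) * q b)"
    by (simp add: sum_product)
  finally show ?thesis .
qed

text \<open>Let \<open>s\<close> be the action of \<open>\<sigma>\<close>.  On the tensor square \<open>\<sigma>\<close> acts by the semilinear map that sends
\<open>e\<^sub>a \<otimes> e\<^sub>b\<close> to \<open>s e\<^sub>a \<otimes> s e\<^sub>b\<close>; the right-hand side is the coefficient at \<open>(p, q)\<close> of its value at \<open>comul f\<close>.  Both
sides are semilinear in \<open>f\<close>, and they agree on \<open>H\<close>, where \<open>comul h\<close> is a sum of tensors of elements fixed by
\<open>s\<close>.\<close>

lemma galois_act_comul:
  fixes H :: "('n::finite, 'l::field) laurent set"
  assumes H: "split_torus K H" and \<sigma>: "\<sigma> \<in> galois_set K"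
  shows "lookup (comul (galois_act H \<sigma> f)) (p, q) =
    keysum (\<lambda>(a, b) v. \<sigma> v * lookup (galois_act H \<sigma> (Poly_Mapping.single a 1)) p *
                        lookup (galois_act H \<sigma> (Poly_Mapping.single b 1)) q) (comul f)"
    (is "_ = keysum ?S _")
proof -
  let ?s = "galois_act H \<sigma>"
  have S0: "?S k 0 = 0" for k by (cases k) (simp add: galois_setD[OF \<sigma>])
  have S_add: "keysum ?S (F + G) = keysum ?S F + keysum ?S G" for F G
    by (rule keysum_add) (auto simp: galois_setD[OF \<sigma>] algebra_simps)
  have S_zero: "keysum ?S 0 = 0" by (simp add: keysum_def)
  have S_sum: "keysum ?S (\<Sum>x\<in>A. g x) = (\<Sum>x\<in>A. keysum ?S (g x))" for A and g :: "_ \<Rightarrow> ('n, 'l) laurent2"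
    by (induction A rule: infinite_finite_induct) (auto simp: S_zero S_add)
  have s_lookup: "(\<Sum>a\<in>keys g. \<sigma> (lookup g a) *
      lookup (?s (Poly_Mapping.single a 1)) r) = lookup (?s g) r" for g r
    by (subst (3) laurent_sum_monomials)
      (simp add: galois_act_sum[OF assms] galois_act_scale[OF assms] lookup_sum lookup_scalar_mult)
  have s_H: "?s h = h" if "h \<in> H" for h
    using galois_act_H[OF assms that, of 1] by (simp add: galois_setD[OF \<sigma>])
  have S_H: "keysum ?S (comul h) = lookup (comul h) (p, q)" if "h \<in> H" for h
  proof -
    obtain ps where ps: "set ps \<subseteq> H \<times> H" and h: "comul h = (\<Sum>(g, h)\<leftarrow>ps. tens g h)"
      using split_torusD(3)[OF H \<open>h \<in> H\<close>] by blast
    show ?thesis unfolding h using ps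
    proof (induction ps)
      case Nil
      then show ?case by (simp add: S_zero)
    next
      case (Cons x ps)
      obtain a b where x: "x = (a, b)" by (cases x)
      have "keysum ?S (tens a b) = lookup (tens a b) (p, q)"
        using Cons.prems keysum_tens[of \<sigma> _ _ a b] 
        by (simp add: galois_setD[OF \<sigma>] s_lookup lookup_tens x s_H)
      then show ?case
        using Cons by (simp add: x S_add lookup_add)
    qed
  qed
  have S_scale: "keysum ?S (comul (scalar c * h)) = \<sigma> c * keysum ?S (comul h)" for c h
  proof -
    let ?A = "keys (comul h)"
    have "keysum ?S (comul (scalar c * h)) = (\<Sum>k\<in>?A. ?S k (lookup (comul (scalar c * h)) k))"
      by (rule keysum_superset) (auto simp: in_keys_iff lookup_comul lookup_scalar_mult S0 split: if_splits)
    also have "\<dots> = \<sigma> c * keysum ?S (comul h)"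
      unfolding keysum_def sum_distrib_left
      by (intro sum.cong refl) (auto simp: lookup_comul lookup_scalar_mult galois_setD[OF \<sigma>] mult.assoc)
    finally show ?thesis .
  qed
  have comul_sum: "comul (\<Sum>x\<in>A. g x) = (\<Sum>x\<in>A. comul (g x))" for A and g :: "_ \<Rightarrow> ('n, 'l) laurent"
    by (intro poly_mapping_eqI, simp only: split_paired_all lookup_sum lookup_comul) auto
  obtain A c where A: "finite A" "A \<subseteq> H" and f: "f = (\<Sum>b\<in>A. scalar (c b) * b)"
    using galois_act_unique(2)[OF assms] by blast
  have "lookup (comul (?s f)) (p, q) =
      (\<Sum>b\<in>A. \<sigma> (c b) * lookup (comul b) (p, q))"
    using A by (auto simp: f galois_act_sum[OF assms] galois_act_H[OF assms] comul_sum lookup_sum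
        lookup_comul lookup_scalar_mult intro!: sum.cong)
  also have "\<dots> = (\<Sum>b\<in>A. \<sigma> (c b) * keysum ?S (comul b))"
    using A by (intro sum.cong refl) (auto simp: S_H)
  also have "\<dots> = keysum ?S (comul f)"
    by (simp add: f comul_sum S_sum S_scale)
  finally show ?thesis .
qed

text \<open>By the preceding lemma the image of a group-like element satisfies the group-like equation.  It is not zero:
the counit has values in \<open>K\<close> on \<open>H\<close>, so it commutes with the actions of \<open>\<sigma>\<close>, and its value at the image is
\<open>\<sigma> 1 = 1\<close>.\<close>

lemma galois_act_char_lattice:
  fixes H :: "('n::finite, 'l::field) laurent set"
  assumes H: "split_torus K H" and \<sigma>: "\<sigma> \<in> galois_set K"
    and f: "f \<in> carrier char_lattice"
  shows "galois_act H \<sigma> f \<in> carrier char_lattice"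
proof -
  let ?s = "galois_act H \<sigma>"
  obtain m where m: "f = Poly_Mapping.single m 1"
    using f by (auto simp: carrier_char_lattice)
  have comul_f: "comul f = Poly_Mapping.single (m, m) 1"
    by (simp add: m comul_def)
  have coeff: "lookup (comul (?s f)) (p, q) =
      lookup (?s f) p * lookup (?s f) q" for p q
    unfolding galois_act_comul[OF H \<sigma>] comul_f by (simp add: keysum_def galois_setD[OF \<sigma>] m)
  have grp: "comul (?s f) = tens (?s f) (?s f)"
    by (intro poly_mapping_eqI, simp only: split_paired_all coeff lookup_tens)
  have "?s f \<noteq> 0"
  proof
    assume "?s f = 0"
    obtain A c where A: "finite A" "A \<subseteq> H" and fA: "f = (\<Sum>b\<in>A. scalar (c b) * b)"
      using galois_act_unique(2)[OF H \<sigma>] by blast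
    have counit_sum: "counit g = keysum (\<lambda>_ v. v) g" for g :: "('n, 'l) laurent"
      by (simp add: counit_def keysum_def)
    have ca: "counit (g + h) = counit g + counit h" for g h :: "('n, 'l) laurent"
      unfolding counit_sum by (rule keysum_add) auto
    have cs: "counit (\<Sum>x\<in>A. g x) = (\<Sum>x\<in>A. counit (g x))" for A and g :: "_ \<Rightarrow> ('n, 'l) laurent"
      by (induction A rule: infinite_finite_induct) (auto simp: ca, auto simp: counit_def)
    have cc: "counit (scalar c * g) = c * counit g" for c and g :: "('n, 'l) laurent"
      unfolding counit_sum
      by (subst keysum_superset[of "keys g"])
        (auto simp: in_keys_iff lookup_scalar_mult keysum_def sum_distrib_left)
    have sum\<sigma>: "\<sigma> (\<Sum>x\<in>A. g x) = (\<Sum>x\<in>A. \<sigma> (g x))" for A and g :: "_ \<Rightarrow> 'l"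
      by (induction A rule: infinite_finite_induct) (auto simp: galois_setD[OF \<sigma>])
    have cK: "counit b \<in> K" if "b \<in> H" for b
      using split_torusD(2)[OF H that] .
    have "counit (?s f) = (\<Sum>b\<in>A. \<sigma> (c b) * counit b)"
      using A by (auto simp: fA galois_act_sum[OF H \<sigma>] galois_act_H[OF H \<sigma>] cs cc intro!: sum.cong)
    also have "\<dots> = (\<Sum>b\<in>A. \<sigma> (c b * counit b))"
      using A cK by (intro sum.cong refl) (auto simp: galois_setD[OF \<sigma>])
    also have "\<dots> = \<sigma> (counit f)"
      by (simp add: fA cs cc sum\<sigma>)
    also have "\<dots> = 1"
      by (simp add: m counit_def galois_setD[OF \<sigma>])
    finally show False
      using \<open>?s f = 0\<close> by (simp add: counit_def)
  qed
  have "?s f = Poly_Mapping.single n 1" if n: "lookup (?s f) n \<noteq> 0" for n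
  proof (rule poly_mapping_eqI)
    fix k
    show "lookup (?s f) k = lookup (Poly_Mapping.single n 1) k"
      using coeff[of n k] coeff[of n n] n by (auto simp: lookup_comul lookup_single when_def split: if_splits)
  qed
  then show ?thesis
    using \<open>?s f \<noteq> 0\<close> unfolding carrier_char_lattice by (metis poly_mapping_eqI lookup_zero rangeI)
qed

section \<open>Transport of fans along lattice isomorphisms\<close>

lemma real_dual_mult:
  "u \<in> real_dual M \<Longrightarrow> x \<in> carrier M \<Longrightarrow> y \<in> carrier M \<Longrightarrow> u (x \<otimes>\<^bsub>M\<^esub> y) = u x + u y"
  by (simp add: real_dual_def)

lemma real_dual_outside: "u \<in> real_dual M \<Longrightarrow> x \<notin> carrier M \<Longrightarrow> u x = 0"
  by (simp add: real_dual_def)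

lemma int_dual_subset: "int_dual M \<subseteq> real_dual M"
  by (auto simp: int_dual_def)

lemma real_dual_linear_combination:
  assumes "S \<subseteq> real_dual M"
  shows "(\<lambda>x. \<Sum>u\<in>S. c u * u x) \<in> real_dual M"
proof -
  have "(\<Sum>u\<in>S. c u * u (x \<otimes>\<^bsub>M\<^esub> y)) = (\<Sum>u\<in>S. c u * u x) + (\<Sum>u\<in>S. c u * u y)"
    if "x \<in> carrier M" "y \<in> carrier M" for x y
  proof -
    have "c u * u (x \<otimes>\<^bsub>M\<^esub> y) = c u * u x + c u * u y" if "u \<in> S" for u
      using real_dual_mult[of u M x y] assms \<open>u \<in> S\<close> \<open>x \<in> carrier M\<close> \<open>y \<in> carrier M\<close>
      by (simp add: distrib_left subset_iff)
    then have "(\<Sum>u\<in>S. c u * u (x \<otimes>\<^bsub>M\<^esub> y)) = (\<Sum>u\<in>S. c u * u x + c u * u y)"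
      by simp
    then show ?thesis by (simp add: sum.distrib)
  qed
  moreover have "(\<Sum>u\<in>S. c u * u x) = 0" if "x \<notin> carrier M" for x
  proof (intro sum.neutral ballI)
    fix u assume "u \<in> S"
    then show "c u * u x = 0"
      using real_dual_outside[of u M x] assms that by (simp add: subset_iff)
  qed
  ultimately show ?thesis unfolding real_dual_def by blast
qed

lemma cone_gen_subset_real_dual: "S \<subseteq> real_dual M \<Longrightarrow> cone_gen S \<subseteq> real_dual M"
  by (auto simp: cone_gen_def intro!: real_dual_linear_combination)

lemma rational_cone_subset: "rational_cone M \<sigma> \<Longrightarrow> \<sigma> \<subseteq> real_dual M"
  unfolding rational_cone_def using cone_gen_subset_real_dual int_dual_subset by blast

lemma cone_face_subset: "cone_face M \<tau> \<sigma> \<Longrightarrow> \<tau> \<subseteq> \<sigma>"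
  by (auto simp: cone_face_def)

lemma fan_subset_real_dual: "fan M \<Sigma> \<Longrightarrow> \<sigma> \<in> \<Sigma> \<Longrightarrow> \<sigma> \<subseteq> real_dual M"
  unfolding fan_def using rational_cone_subset by blast

lemma pull_dual_apply: "x \<in> carrier M \<Longrightarrow> pull_dual M f u x = u (f x)"
  by (simp add: pull_dual_def)

lemma pull_dual_linear_combination:
  "pull_dual M f (\<lambda>x. \<Sum>u\<in>S. c u * u x) = (\<lambda>x. \<Sum>u\<in>S. c u * pull_dual M f u x)"
  by (auto simp: pull_dual_def)

lemma pull_dual_real_dual:
  assumes f: "f \<in> hom M N" and closed: "\<And>x y. x \<in> carrier M \<Longrightarrow> y \<in> carrier M \<Longrightarrow> x \<otimes>\<^bsub>M\<^esub> y \<in> carrier M"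
    and u: "u \<in> real_dual N"
  shows "pull_dual M f u \<in> real_dual M"
proof -
  have "f x \<in> carrier N" if "x \<in> carrier M" for x
    using f that by (auto simp: hom_def)
  moreover have "f (x \<otimes>\<^bsub>M\<^esub> y) = f x \<otimes>\<^bsub>N\<^esub> f y" if "x \<in> carrier M" "y \<in> carrier M" for x y
    using f that by (auto simp: hom_def)
  ultimately show ?thesis
    using u closed by (auto simp: real_dual_def pull_dual_def)
qed

text \<open>That \<open>M\<close> is closed under its operation has to be demanded: \<open>iso\<close> does not imply it, and without it the
pullback of an additive functional need not be additive.\<close>

locale lattice_iso =
  fixes M :: "'m monoid" and N :: "'n monoid" and f :: "'m \<Rightarrow> 'n"
  assumes iso: "f \<in> iso M N"
    and closed: "\<And>x y. x \<in> carrier M \<Longrightarrow> y \<in> carrier M \<Longrightarrow> x \<otimes>\<^bsub>M\<^esub> y \<in> carrier M"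
begin

definition f_inv :: "'n \<Rightarrow> 'm" where "f_inv = inv_into (carrier M) f"

abbreviation "pull \<equiv> pull_dual M f"
abbreviation "push \<equiv> pull_dual N f_inv"

lemma bij: "bij_betw f (carrier M) (carrier N)"
  using iso by (simp add: iso_def)

lemma f_carrier: "x \<in> carrier M \<Longrightarrow> f x \<in> carrier N"
  using bij by (auto simp: bij_betw_def)

lemma f_inv_carrier: "y \<in> carrier N \<Longrightarrow> f_inv y \<in> carrier M"
  using bij by (auto simp: f_inv_def bij_betw_def inv_into_into)

lemma f_f_inv [simp]: "y \<in> carrier N \<Longrightarrow> f (f_inv y) = y"
  using bij by (simp add: f_inv_def bij_betw_inv_into_right)

lemma f_inv_f [simp]: "x \<in> carrier M \<Longrightarrow> f_inv (f x) = x"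
  using bij by (simp add: f_inv_def bij_betw_inv_into_left)

lemma f_mult: "x \<in> carrier M \<Longrightarrow> y \<in> carrier M \<Longrightarrow> f (x \<otimes>\<^bsub>M\<^esub> y) = f x \<otimes>\<^bsub>N\<^esub> f y"
  using iso by (auto simp: iso_def hom_def)

lemma N_closed: "x \<in> carrier N \<Longrightarrow> y \<in> carrier N \<Longrightarrow> x \<otimes>\<^bsub>N\<^esub> y \<in> carrier N"
  using f_mult[of "f_inv x" "f_inv y"] f_carrier[OF closed[of "f_inv x" "f_inv y"]] by (simp add: f_inv_carrier)

lemma f_inv_hom: "f_inv \<in> hom N M"
proof -
  have "f_inv (x \<otimes>\<^bsub>N\<^esub> y) = f_inv x \<otimes>\<^bsub>M\<^esub> f_inv y" if "x \<in> carrier N" "y \<in> carrier N" for x y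
    using f_mult[of "f_inv x" "f_inv y"] f_inv_f[of "f_inv x \<otimes>\<^bsub>M\<^esub> f_inv y"] that by (simp add: f_inv_carrier closed)
  then show ?thesis
    unfolding hom_def by (auto simp: f_inv_carrier)
qed

lemma pull_push [simp]: "v \<in> real_dual M \<Longrightarrow> pull (push v) = v"
  using real_dual_outside[of v M] by (auto simp: pull_dual_def f_carrier)

lemma push_pull [simp]: "u \<in> real_dual N \<Longrightarrow> push (pull u) = u"
  using real_dual_outside[of u N] by (auto simp: pull_dual_def f_inv_carrier)

lemma pull_real_dual: "u \<in> real_dual N \<Longrightarrow> pull u \<in> real_dual M"
  using iso closed by (intro pull_dual_real_dual) (auto simp: iso_def)

lemma push_real_dual: "v \<in> real_dual M \<Longrightarrow> push v \<in> real_dual N"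
  using f_inv_hom N_closed by (intro pull_dual_real_dual)

lemma pull_int_dual: "u \<in> int_dual N \<Longrightarrow> pull u \<in> int_dual M"
  using pull_real_dual by (auto simp: int_dual_def) (auto simp: pull_dual_def)

lemma push_int_dual: "u \<in> int_dual M \<Longrightarrow> push u \<in> int_dual N"
  using push_real_dual by (auto simp: int_dual_def) (auto simp: pull_dual_def)

lemma pull_inj: "inj_on pull (real_dual N)"
  by (rule inj_on_inverseI[of _ push]) simp

lemma push_image: "\<sigma> \<subseteq> real_dual N \<Longrightarrow> push ` pull ` \<sigma> = \<sigma>"
  by (force simp: image_image subset_iff)

lemma pull_cone_face:
  assumes "cone_face N \<tau> \<sigma>"
  shows "cone_face M (pull ` \<tau>) (pull ` \<sigma>)"
proof -
  obtain m where m: "m \<in> carrier N" "\<forall>u\<in>\<sigma>. u m \<ge> 0" "\<tau> = {u\<in>\<sigma>. u m = 0}"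
    using assms by (auto simp: cone_face_def)
  have "pull u (f_inv m) = u m" for u
    using m(1) by (simp add: pull_dual_apply f_inv_carrier)
  then show ?thesis
    unfolding cone_face_def using m by (intro bexI[of _ "f_inv m"]) (auto simp: f_inv_carrier)
qed

lemma cone_face_pullD:
  assumes "cone_face M \<tau>' (pull ` \<sigma>)"
  obtains \<tau> where "cone_face N \<tau> \<sigma>" "\<tau>' = pull ` \<tau>"
proof -
  obtain m where m: "m \<in> carrier M" "\<forall>u\<in>pull ` \<sigma>. u m \<ge> 0" "\<tau>' = {u\<in>pull ` \<sigma>. u m = 0}"
    using assms by (auto simp: cone_face_def)
  have "pull u m = u (f m)" for u
    using m(1) by (simp add: pull_dual_apply)
  then have "cone_face N {u\<in>\<sigma>. u (f m) = 0} \<sigma>" "\<tau>' = pull ` {u\<in>\<sigma>. u (f m) = 0}"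
    unfolding cone_face_def using m by (auto simp: f_carrier intro!: bexI[of _ "f m"])
  then show ?thesis by (rule that)
qed

lemma pull_cone_gen:
  assumes "S \<subseteq> real_dual N"
  shows "pull ` cone_gen S = cone_gen (pull ` S)"
proof -
  have inj: "inj_on pull S"
    using pull_inj assms by (rule inj_on_subset)
  have sum: "(\<lambda>x. \<Sum>w\<in>pull ` S. c w * w x) = pull (\<lambda>x. \<Sum>u\<in>S. c (pull u) * u x)" for c
    by (simp add: pull_dual_linear_combination sum.reindex[OF inj])
  show ?thesis
  proof (intro equalityI subsetI)
    fix w assume "w \<in> pull ` cone_gen S"
    then obtain c where c: "\<forall>u\<in>S. c u \<ge> 0" and w: "w = pull (\<lambda>x. \<Sum>u\<in>S. c u * u x)"
      by (auto simp: cone_gen_def)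
    have "push (pull u) = u" if "u \<in> S" for u using assms that by auto
    then have "w = (\<lambda>x. \<Sum>w\<in>pull ` S. c (push w) * w x)" "\<forall>w\<in>pull ` S. c (push w) \<ge> 0"
      unfolding w sum using c by (auto intro!: arg_cong[where f = pull] sum.cong)
    then show "w \<in> cone_gen (pull ` S)"
      unfolding cone_gen_def by (intro CollectI exI conjI)
  next
    fix w assume "w \<in> cone_gen (pull ` S)"
    then obtain c where c: "\<forall>u\<in>pull ` S. c u \<ge> 0" and w: "w = (\<lambda>x. \<Sum>w\<in>pull ` S. c w * w x)"
      by (auto simp: cone_gen_def)
    have "(\<lambda>x. \<Sum>u\<in>S. c (pull u) * u x) \<in> cone_gen S"
      unfolding cone_gen_def using c by (intro CollectI exI[of _ "\<lambda>u. c (pull u)"]) auto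
    then show "w \<in> pull ` cone_gen S" unfolding w sum by (rule imageI)
  qed
qed

lemma pull_rational_cone:
  assumes "rational_cone N \<sigma>" shows "rational_cone M (pull ` \<sigma>)"
proof -
  obtain S where S: "finite S" "S \<subseteq> int_dual N" "\<sigma> = cone_gen S"
    using assms by (auto simp: rational_cone_def)
  then have "S \<subseteq> real_dual N"
    using int_dual_subset by blast
  then have "pull ` \<sigma> = cone_gen (pull ` S)"
    using S pull_cone_gen by auto
  then show ?thesis
    unfolding rational_cone_def using S pull_int_dual by (intro exI[of _ "pull ` S"]) auto
qed

lemma pull_strongly_convex:
  assumes "strongly_convex \<sigma>" "\<sigma> \<subseteq> real_dual N" shows "strongly_convex (pull ` \<sigma>)"
  unfolding strongly_convex_def
proof (intro ballI impI)
  fix w assume "w \<in> pull ` \<sigma>" and neg: "(\<lambda>x. - w x) \<in> pull ` \<sigma>"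
  then obtain u v where u: "u \<in> \<sigma>" "w = pull u" and v: "v \<in> \<sigma>" "(\<lambda>x. - w x) = pull v"
    by auto
  have "v = push (pull v)" using v assms by auto
  also have "\<dots> = (\<lambda>x. - push w x)" unfolding v(2)[symmetric] by (auto simp: pull_dual_def)
  also have "push w = u" using u assms by auto
  finally have "u = (\<lambda>x. 0)"
    using assms(1) u v unfolding strongly_convex_def by blast
  then show "w = (\<lambda>x. 0)" unfolding u by (auto simp: pull_dual_def)
qed

text \<open>Coefficient functions on \<open>B\<close> and on its image correspond to each other under \<open>push\<close>, so existence and
uniqueness of integral coordinates carry over.\<close>

lemma pull_int_dual_basis:
  assumes "int_dual_basis N B" shows "int_dual_basis M (pull ` B)"
proof -
  have B: "finite B" "B \<subseteq> int_dual N" "B \<subseteq> real_dual N"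
    using assms int_dual_subset by (auto simp: int_dual_basis_def)
  have inj: "inj_on pull B"
    using pull_inj B(3) by (rule inj_on_subset)
  have sum: "(\<lambda>x. \<Sum>w\<in>pull ` B. of_int (c w) * w x) = pull (\<lambda>x. \<Sum>b\<in>B. of_int (c (pull b)) * b x)"
    for c :: "_ \<Rightarrow> int"
    by (simp add: pull_dual_linear_combination sum.reindex[OF inj])
  have push_b: "push (pull b) = b" if "b \<in> B" for b
    using that B by auto
  have "\<exists>!c. (\<forall>b. b \<notin> pull ` B \<longrightarrow> c b = 0) \<and> v = (\<lambda>x. \<Sum>b\<in>pull ` B. real_of_int (c b) * b x)"
    if v: "v \<in> int_dual M" for v
  proof -
    have vr: "v \<in> real_dual M" using v int_dual_subset by blast
    have "\<exists>!c. (\<forall>b. b \<notin> B \<longrightarrow> c b = 0) \<and> push v = (\<lambda>x. \<Sum>b\<in>B. real_of_int (c b) * b x)"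
      using assms push_int_dual[OF v] unfolding int_dual_basis_def by (elim conjE) (erule bspec)
    then obtain c where c1: "(\<forall>b. b \<notin> B \<longrightarrow> c b = 0) \<and> push v = (\<lambda>x. \<Sum>b\<in>B. real_of_int (c b) * b x)"
      and uniq1: "\<forall>c'. (\<forall>b. b \<notin> B \<longrightarrow> c' b = 0) \<and> push v = (\<lambda>x. \<Sum>b\<in>B. real_of_int (c' b) * b x) \<longrightarrow> c' = c"
      by (rule ex1E)
    note c = c1[THEN conjunct1] c1[THEN conjunct2]
    have uniq: "c' = c" if "\<forall>b. b \<notin> B \<longrightarrow> c' b = 0" "push v = (\<lambda>x. \<Sum>b\<in>B. real_of_int (c' b) * b x)" for c'
      using uniq1 that by simp
    show ?thesis
    proof (rule ex1I[of _ "\<lambda>w. if w \<in> pull ` B then c (push w) else 0"], intro conjI)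
      have "(\<lambda>x. \<Sum>b\<in>B. real_of_int (if pull b \<in> pull ` B then c (push (pull b)) else 0) * b x) = push v"
        unfolding c(2) by (auto simp: push_b intro!: sum.cong)
      then show "v = (\<lambda>x. \<Sum>b\<in>pull ` B. real_of_int (if b \<in> pull ` B then c (push b) else 0) * b x)"
        unfolding sum using vr by simp
    next
      fix d assume d: "(\<forall>b. b \<notin> pull ` B \<longrightarrow> d b = 0) \<and> v = (\<lambda>x. \<Sum>b\<in>pull ` B. real_of_int (d b) * b x)"
      let ?e = "\<lambda>b. if b \<in> B then d (pull b) else 0"
      have lin: "(\<lambda>x. \<Sum>b\<in>B. real_of_int (d (pull b)) * b x) \<in> real_dual N"
        by (rule real_dual_linear_combination[OF B(3)])
      have "push v = push (pull (\<lambda>x. \<Sum>b\<in>B. real_of_int (d (pull b)) * b x))"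
        using d sum by simp
      also have "\<dots> = (\<lambda>x. \<Sum>b\<in>B. real_of_int (d (pull b)) * b x)"
        by (rule push_pull[OF lin])
      also have "\<dots> = (\<lambda>x. \<Sum>b\<in>B. real_of_int (?e b) * b x)"
        by (intro ext sum.cong) auto
      finally have "?e = c" by (intro uniq) auto
      then have "d (pull b) = c b" if "b \<in> B" for b using fun_cong[of ?e c b] that by simp
      moreover have "d w = 0" if "w \<notin> pull ` B" for w
        using d that by simp
      ultimately show "d = (\<lambda>w. if w \<in> pull ` B then c (push w) else 0)"
        using push_b by (intro ext) auto
    qed auto
  qed
  then show ?thesis
    unfolding int_dual_basis_def using B pull_int_dual by blast
qed

lemma pull_fan_fan:
  assumes "fan N \<Sigma>" shows "fan M (pull_fan M f \<Sigma>)"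
proof -
  have sub: "\<sigma> \<subseteq> real_dual N" if "\<sigma> \<in> \<Sigma>" for \<sigma>
    using fan_subset_real_dual[OF assms that] .
  have int: "pull ` \<sigma> \<inter> pull ` \<tau> = pull ` (\<sigma> \<inter> \<tau>)" if "\<sigma> \<in> \<Sigma>" "\<tau> \<in> \<Sigma>" for \<sigma> \<tau>
    using inj_on_image_Int[OF pull_inj sub[OF that(1)] sub[OF that(2)]] by simp
  show ?thesis
    unfolding fan_def
  proof (intro conjI ballI allI impI)
    show "finite (pull_fan M f \<Sigma>)" "pull_fan M f \<Sigma> \<noteq> {}"
      using assms by (auto simp: fan_def pull_fan_def)
  next
    fix \<sigma>' assume "\<sigma>' \<in> pull_fan M f \<Sigma>"
    then obtain \<sigma> where \<sigma>: "\<sigma> \<in> \<Sigma>" "\<sigma>' = pull ` \<sigma>" by (auto simp: pull_fan_def)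
    then show "rational_cone M \<sigma>'" "strongly_convex \<sigma>'"
      using assms sub by (auto simp: fan_def intro!: pull_rational_cone pull_strongly_convex)
    show "\<tau>' \<in> pull_fan M f \<Sigma>" if "cone_face M \<tau>' \<sigma>'" for \<tau>'
      using that \<sigma> assms unfolding \<sigma>(2) by (elim cone_face_pullD) (auto simp: fan_def pull_fan_def)
    fix \<tau>' assume "\<tau>' \<in> pull_fan M f \<Sigma>"
    then obtain \<tau> where \<tau>: "\<tau> \<in> \<Sigma>" "\<tau>' = pull ` \<tau>" by (auto simp: pull_fan_def)
    show "cone_face M (\<sigma>' \<inter> \<tau>') \<sigma>'" "cone_face M (\<sigma>' \<inter> \<tau>') \<tau>'"
      unfolding \<sigma>(2) \<tau>(2) int[OF \<sigma>(1) \<tau>(1)]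
      using assms \<sigma>(1) \<tau>(1) unfolding fan_def by (blast intro: pull_cone_face)+
  qed
qed

lemma pull_fan_smooth:
  assumes "smooth_fan N \<Sigma>" shows "smooth_fan M (pull_fan M f \<Sigma>)"
  unfolding smooth_fan_def
proof (intro conjI ballI)
  show "fan M (pull_fan M f \<Sigma>)"
    using assms pull_fan_fan by (simp add: smooth_fan_def)
  fix \<sigma>' assume "\<sigma>' \<in> pull_fan M f \<Sigma>"
  then obtain \<sigma> where \<sigma>: "\<sigma> \<in> \<Sigma>" "\<sigma>' = pull ` \<sigma>" by (auto simp: pull_fan_def)
  then obtain B S where B: "int_dual_basis N B" "S \<subseteq> B" "\<sigma> = cone_gen S"
    using assms by (auto simp: smooth_fan_def)
  then have "S \<subseteq> real_dual N"
    using int_dual_subset by (auto simp: int_dual_basis_def)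
  then have "\<sigma>' = cone_gen (pull ` S)"
    using \<sigma>(2) B(3) pull_cone_gen by simp
  then show "\<exists>B S. int_dual_basis M B \<and> S \<subseteq> B \<and> \<sigma>' = cone_gen S"
    using pull_int_dual_basis[OF B(1)] image_mono[OF B(2)] by (intro exI conjI)
qed

lemma pull_fan_projective:
  assumes "projective_fan N \<Sigma>" shows "projective_fan M (pull_fan M f \<Sigma>)"
proof -
  have fan: "fan N \<Sigma>" and complete: "\<Union>\<Sigma> = real_dual N"
    using assms by (auto simp: projective_fan_def complete_fan_def)
  obtain d where cart: "invariant_cartier N \<Sigma> d" and ample: "ample N \<Sigma> d"
    using assms by (auto simp: projective_fan_def)
  have sub: "push ` pull ` \<sigma> = \<sigma>" if "\<sigma> \<in> \<Sigma>" for \<sigma>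
    using fan_subset_real_dual[OF fan that] by (rule push_image)
  define d' where "d' \<tau> = f_inv (d (push ` \<tau>))" for \<tau>
  have d_carrier: "d \<sigma> \<in> carrier N" if "\<sigma> \<in> \<Sigma>" for \<sigma>
    using cart that by (simp add: invariant_cartier_def)
  have d': "d' (pull ` \<sigma>) \<in> carrier M" "pull u (d' (pull ` \<sigma>)) = u (d \<sigma>)" if "\<sigma> \<in> \<Sigma>" for \<sigma> u
    using d_carrier[OF that] by (simp_all add: d'_def sub[OF that] f_inv_carrier pull_dual_apply)
  have "\<Union>(pull_fan M f \<Sigma>) = pull ` real_dual N"
    unfolding complete[symmetric] pull_fan_def by blast
  also have "\<dots> = real_dual M"
  proof (intro equalityI subsetI)
    fix v assume "v \<in> real_dual M"
    then show "v \<in> pull ` real_dual N"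
      by (intro image_eqI[of v pull "push v"]) (simp_all add: push_real_dual)
  qed (auto simp: pull_real_dual)
  finally have "complete_fan M (pull_fan M f \<Sigma>)"
    using pull_fan_fan[OF fan] by (simp add: complete_fan_def)
  moreover have "invariant_cartier M (pull_fan M f \<Sigma>) d'"
    unfolding invariant_cartier_def
  proof (intro conjI ballI impI)
    fix \<sigma>' assume "\<sigma>' \<in> pull_fan M f \<Sigma>"
    then obtain \<sigma> where \<sigma>: "\<sigma> \<in> \<Sigma>" "\<sigma>' = pull ` \<sigma>" by (auto simp: pull_fan_def)
    then show "d' \<sigma>' \<in> carrier M" using d' by simp
    fix \<tau>' w assume "\<tau>' \<in> pull_fan M f \<Sigma>" "cone_face M \<tau>' \<sigma>'" "w \<in> \<tau>'"
    then obtain \<tau> where \<tau>: "cone_face N \<tau> \<sigma>" "\<tau>' = pull ` \<tau>"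
      using \<sigma> by (auto elim: cone_face_pullD)
    then have "\<tau> \<in> \<Sigma>" using fan \<sigma> by (auto simp: fan_def)
    then show "w (d' \<sigma>') = w (d' \<tau>')"
      using \<open>w \<in> \<tau>'\<close> \<sigma> \<tau> d' cart by (auto simp: invariant_cartier_def)
  qed
  moreover have "ample M (pull_fan M f \<Sigma>) d'"
    unfolding ample_def
  proof
    fix \<sigma>' assume "\<sigma>' \<in> pull_fan M f \<Sigma>"
    then obtain \<sigma> where \<sigma>: "\<sigma> \<in> \<Sigma>" "\<sigma>' = pull ` \<sigma>" by (auto simp: pull_fan_def)
    then obtain n m where n: "n \<ge> 1" and m: "invariant_section N \<Sigma> d n m" "\<sigma> \<in> nonvanishing \<Sigma> d n m"
      "affine_subfan N \<Sigma> (nonvanishing \<Sigma> d n m)"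
      using ample unfolding ample_def by blast
    have mN: "m \<in> carrier N" using m by (simp add: invariant_section_def)
    have pm: "pull u (f_inv m) = u m" for u
      using mN by (simp add: pull_dual_apply f_inv_carrier)
    have sec: "invariant_section M (pull_fan M f \<Sigma>) d' n (f_inv m)"
      using m(1) by (auto simp: invariant_section_def pull_fan_def f_inv_carrier pm d')
    have nonv: "nonvanishing (pull_fan M f \<Sigma>) d' n (f_inv m) = (`) pull ` nonvanishing \<Sigma> d n m"
      by (auto simp: nonvanishing_def pull_fan_def pm d')
    obtain \<rho> where \<rho>: "\<rho> \<in> \<Sigma>" "nonvanishing \<Sigma> d n m = {\<tau>. cone_face N \<tau> \<rho>}"
      using m(3) by (auto simp: affine_subfan_def)
    have "(`) pull ` {\<tau>. cone_face N \<tau> \<rho>} = {\<tau>. cone_face M \<tau> (pull ` \<rho>)}"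
      by (auto intro: pull_cone_face elim!: cone_face_pullD)
    then have "affine_subfan M (pull_fan M f \<Sigma>) (nonvanishing (pull_fan M f \<Sigma>) d' n (f_inv m))"
      unfolding affine_subfan_def nonv using \<rho> by (intro bexI[of _ "pull ` \<rho>"]) (auto simp: pull_fan_def)
    moreover have "\<sigma>' \<in> nonvanishing (pull_fan M f \<Sigma>) d' n (f_inv m)"
      unfolding nonv \<sigma>(2) using m(2) by (rule imageI)
    ultimately show "\<exists>n m. 1 \<le> n \<and> invariant_section M (pull_fan M f \<Sigma>) d' n m \<and>
        \<sigma>' \<in> nonvanishing (pull_fan M f \<Sigma>) d' n m \<and>
        affine_subfan M (pull_fan M f \<Sigma>) (nonvanishing (pull_fan M f \<Sigma>) d' n m)"
      using n sec by (intro exI conjI)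
  qed
  ultimately show ?thesis
    unfolding projective_fan_def by blast
qed

end

lemma glattice_iso_trans:
  assumes "glattice_iso P Q" "glattice_iso Q R" shows "glattice_iso P R"
proof -
  obtain f h where f: "f \<in> iso (lat P) (lat Q)" "h \<in> iso (grp P) (grp Q)"
    "\<forall>g \<in> carrier (grp P). \<forall>x \<in> carrier (lat P). f (act P g x) = act Q (h g) (f x)"
    using assms(1) unfolding glattice_iso_def by blast
  obtain f' h' where f': "f' \<in> iso (lat Q) (lat R)" "h' \<in> iso (grp Q) (grp R)"
    "\<forall>g \<in> carrier (grp Q). \<forall>x \<in> carrier (lat Q). f' (act Q g x) = act R (h' g) (f' x)"
    using assms(2) unfolding glattice_iso_def by blast
  have "f' \<circ> f \<in> iso (lat P) (lat R)" "h' \<circ> h \<in> iso (grp P) (grp R)"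
    using f f' iso_set_trans by blast+
  moreover have "f x \<in> carrier (lat Q)" if "x \<in> carrier (lat P)" for x
    using f(1) that by (auto simp: iso_def hom_def)
  moreover have "h x \<in> carrier (grp Q)" if "x \<in> carrier (grp P)" for x
    using f(2) that by (auto simp: iso_def hom_def)
  ultimately show ?thesis
    unfolding glattice_iso_def using f(3) f'(3)
    by (intro bexI[of _ "f' \<circ> f"] bexI[of _ "h' \<circ> h"]) auto
qed

lemma glattice_iso_refl: "glattice_iso P P"
  unfolding glattice_iso_def
  by (intro bexI[of _ "\<lambda>x. x"]) (auto simp: iso_def hom_def bij_betw_def)

text \<open>The inverse in the contragredient action is harmless, because the invariance of \<open>\<Sigma>\<close> is known for all
elements of the group of \<open>Q\<close>.  The closure conditions on \<open>P\<close> are not part of being isomorphic to \<open>Q\<close>: functionals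
vanish outside the lattice, so an action that left the lattice would destroy the correspondence.\<close>

lemma demazure_model_transport:
  assumes closed: "\<And>x y. x \<in> carrier (lat P) \<Longrightarrow> y \<in> carrier (lat P) \<Longrightarrow>
      x \<otimes>\<^bsub>lat P\<^esub> y \<in> carrier (lat P)"
    and grp: "group (grp P)"
    and act: "\<And>g x. g \<in> carrier (grp P) \<Longrightarrow> x \<in> carrier (lat P) \<Longrightarrow> act P g x \<in> carrier (lat P)"
    and iso: "glattice_iso P Q"
    and smooth: "smooth_fan (lat Q) \<Sigma>" and proj: "projective_fan (lat Q) \<Sigma>"
    and inv: "\<And>h \<sigma>. h \<in> carrier (grp Q) \<Longrightarrow> \<sigma> \<in> \<Sigma> \<Longrightarrow> pull_dual (lat Q) (act Q h) ` \<sigma> \<in> \<Sigma>"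
  shows "demazure_model P (lat Q, \<Sigma>)"
proof -
  obtain f h where f: "f \<in> iso (lat P) (lat Q)" and h: "h \<in> iso (grp P) (grp Q)"
    and equiv: "\<And>g x. g \<in> carrier (grp P) \<Longrightarrow> x \<in> carrier (lat P) \<Longrightarrow> f (act P g x) = act Q (h g) (f x)"
    using iso unfolding glattice_iso_def by blast
  interpret lattice_iso "lat P" "lat Q" f
    using f closed by unfold_locales
  have "dual_act P a ` pull ` \<sigma> \<in> pull_fan (lat P) f \<Sigma>" if a: "a \<in> carrier (grp P)" and \<sigma>: "\<sigma> \<in> \<Sigma>" for a \<sigma>
  proof -
    let ?b = "inv\<^bsub>grp P\<^esub> a"
    have b: "?b \<in> carrier (grp P)" using group.inv_closed[OF grp a] .
    then have hb: "h ?b \<in> carrier (grp Q)" using h by (auto simp: iso_def hom_def)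
    have "dual_act P a (pull u) = pull (pull_dual (lat Q) (act Q (h ?b)) u)" for u
      unfolding dual_act_def using b by (auto simp: pull_dual_def act f_carrier equiv)
    then have "dual_act P a ` pull ` \<sigma> = pull ` pull_dual (lat Q) (act Q (h ?b)) ` \<sigma>"
      by (simp add: image_image)
    then show ?thesis
      using inv[OF hb \<sigma>] by (auto simp: pull_fan_def)
  qed
  then have "demazure_fan P (pull_fan (lat P) f \<Sigma>)"
    unfolding demazure_fan_def using pull_fan_smooth[OF smooth] pull_fan_projective[OF proj]
    by (auto simp: pull_fan_def)
  then show ?thesis
    unfolding demazure_model_def using f by auto
qed

section \<open>Simple roots and the faces of a chamber\<close>

interpretation int_module: Modules.module "\<lambda>(n::int) (x::'a::real_vector). real_of_int n *\<^sub>R x"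
  by unfold_locales (simp_all add: algebra_simps)

lemma int_span_base: "x \<in> S \<Longrightarrow> x \<in> int_span S"
  unfolding int_span_def by (rule int_module.span_base)

lemma int_span_zero: "0 \<in> int_span S"
  unfolding int_span_def by (rule int_module.span_zero)

lemma int_span_add: "x \<in> int_span S \<Longrightarrow> y \<in> int_span S \<Longrightarrow> x + y \<in> int_span S"
  unfolding int_span_def by (rule int_module.span_add)

lemma int_span_scale: "x \<in> int_span S \<Longrightarrow> real_of_int n *\<^sub>R x \<in> int_span S"
  unfolding int_span_def by (rule int_module.span_scale)

lemma int_span_uminus: "x \<in> int_span S \<Longrightarrow> - x \<in> int_span S"
  unfolding int_span_def by (rule int_module.span_neg)

lemma int_span_sum: "(\<And>a. a \<in> A \<Longrightarrow> h a \<in> int_span S) \<Longrightarrow> (\<Sum>a\<in>A. h a) \<in> int_span S"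
  unfolding int_span_def by (rule int_module.span_sum)

lemma int_span_minimal:
  assumes "S \<subseteq> T" "0 \<in> T" "\<And>x y. x \<in> T \<Longrightarrow> y \<in> T \<Longrightarrow> x + y \<in> T"
    "\<And>n x. x \<in> T \<Longrightarrow> real_of_int n *\<^sub>R x \<in> T"
  shows "int_span S \<subseteq> T"
  unfolding int_span_def
  by (rule int_module.span_minimal) (use assms in \<open>auto simp: int_module.subspace_def\<close>)

lemma int_span_mono: "S \<subseteq> int_span T \<Longrightarrow> int_span S \<subseteq> int_span T"
  unfolding int_span_def by (rule int_module.span_minimal) (simp_all add: int_module.subspace_span)

lemma int_span_finite:
  assumes "finite S" "x \<in> int_span S"
  obtains n :: "'a::real_vector \<Rightarrow> int" where "x = (\<Sum>a\<in>S. real_of_int (n a) *\<^sub>R a)"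
proof -
  have "x \<in> range (\<lambda>n. \<Sum>a\<in>S. real_of_int (n a) *\<^sub>R a)"
    using assms int_module.span_finite[of S] unfolding int_span_def by simp
  then show ?thesis using that by auto
qed

lemma carrier_root_lattice [simp]: "carrier (root_lattice \<Phi>) = int_span \<Phi>"
  and mult_root_lattice [simp]: "x \<otimes>\<^bsub>root_lattice \<Phi>\<^esub> y = x + y"
  by (simp_all add: root_lattice_def additive_monoid_def)

locale roots =
  fixes \<Phi> :: "'a::euclidean_space set"
  assumes root_system: "root_system \<Phi>"
begin

abbreviation "V \<equiv> real_dual (root_lattice \<Phi>)"

lemma V_add: "u \<in> V \<Longrightarrow> x \<in> int_span \<Phi> \<Longrightarrow> y \<in> int_span \<Phi> \<Longrightarrow> u (x + y) = u x + u y"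
  using real_dual_mult[of u "root_lattice \<Phi>"] by simp

lemma V_zero: "u \<in> V \<Longrightarrow> u 0 = 0"
  using V_add[of u 0 0] int_span_zero[of \<Phi>] by simp

lemma V_uminus: "u \<in> V \<Longrightarrow> x \<in> int_span \<Phi> \<Longrightarrow> u (- x) = - u x"
  using V_add[of u x "- x"] int_span_uminus[of x \<Phi>] V_zero[of u] by simp

lemma V_sum: "u \<in> V \<Longrightarrow> (\<And>a. a \<in> A \<Longrightarrow> h a \<in> int_span \<Phi>) \<Longrightarrow> u (\<Sum>a\<in>A. h a) = (\<Sum>a\<in>A. u (h a))"
proof (induction A rule: infinite_finite_induct)
  case (insert a A)
  then have "(\<Sum>a\<in>A. h a) \<in> int_span \<Phi>" by (intro int_span_sum) auto
  then show ?case using insert by (simp add: V_add)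
qed (auto simp: V_zero)

lemma V_scale_nat: "u \<in> V \<Longrightarrow> x \<in> int_span \<Phi> \<Longrightarrow> u (real n *\<^sub>R x) = real n * u x"
proof (induction n)
  case (Suc n)
  have "real n *\<^sub>R x \<in> int_span \<Phi>" using int_span_scale[OF Suc.prems(2), of "int n"] by simp
  then show ?case using Suc V_add[of u x "real n *\<^sub>R x"] by (simp add: algebra_simps)
qed (simp add: V_zero)

lemma V_scale: "u \<in> V \<Longrightarrow> x \<in> int_span \<Phi> \<Longrightarrow> u (real_of_int n *\<^sub>R x) = real_of_int n * u x"
proof (cases n rule: int_cases2)
  case (nonpos k)
  have "real k *\<^sub>R x \<in> int_span \<Phi>" if "x \<in> int_span \<Phi>"
    using int_span_scale[OF that, of "int k"] by simp
  then show "u (real_of_int n *\<^sub>R x) = real_of_int n * u x" if "u \<in> V" "x \<in> int_span \<Phi>"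
    using that by (simp add: nonpos V_uminus V_scale_nat)
qed (simp add: V_scale_nat)

lemma V_lincomb:
  "u \<in> V \<Longrightarrow> A \<subseteq> int_span \<Phi> \<Longrightarrow> u (\<Sum>a\<in>A. real_of_int (n a) *\<^sub>R a) = (\<Sum>a\<in>A. real_of_int (n a) * u a)"
  using V_sum[of u A "\<lambda>a. real_of_int (n a) *\<^sub>R a"] by (simp add: subset_iff int_span_scale V_scale)

lemma finite_roots: "finite \<Phi>"
  using root_system by (simp add: root_system_def)

lemma root_nonzero: "\<alpha> \<in> \<Phi> \<Longrightarrow> \<alpha> \<noteq> 0"
  using root_system by (auto simp: root_system_def)

lemma root_int_span: "\<alpha> \<in> \<Phi> \<Longrightarrow> \<alpha> \<in> int_span \<Phi>"
  by (rule int_span_base)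

lemma uminus_root: assumes "\<alpha> \<in> \<Phi>" shows "- \<alpha> \<in> \<Phi>"
proof -
  have "root_reflection \<alpha> \<alpha> \<in> \<Phi>"
    using root_system assms unfolding root_system_def by blast
  moreover have "cartan \<alpha> \<alpha> = 2"
    using root_nonzero[OF assms] by (simp add: cartan_def)
  ultimately show ?thesis by (simp add: root_reflection_def scaleR_2)
qed

text \<open>If both Cartan integers of \<open>\<alpha>\<close> and \<open>\<beta>\<close> were at least \<open>2\<close>, then \<open>(\<alpha> - \<beta>) \<bullet> (\<alpha> - \<beta>) \<le> 0\<close>.  So one of them
is \<open>1\<close>, and the corresponding reflection maps one root to the difference.\<close>

lemma diff_root:
  assumes "\<alpha> \<in> \<Phi>" "\<beta> \<in> \<Phi>" "\<alpha> \<bullet> \<beta> > 0" "\<alpha> \<noteq> \<beta>"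
  shows "\<alpha> - \<beta> \<in> \<Phi>"
proof -
  have pos: "\<alpha> \<bullet> \<alpha> > 0" "\<beta> \<bullet> \<beta> > 0"
    using assms root_nonzero by auto
  have refl: "root_reflection x y \<in> \<Phi>" if "x \<in> \<Phi>" "y \<in> \<Phi>" for x y
    using root_system that unfolding root_system_def by blast
  have "cartan \<alpha> \<beta> \<in> \<int>" "cartan \<beta> \<alpha> \<in> \<int>"
    using root_system assms unfolding root_system_def by blast+
  then obtain m n :: int where m: "cartan \<alpha> \<beta> = m" and n: "cartan \<beta> \<alpha> = n"
    by (auto elim!: Ints_cases)
  have mn: "of_int m * (\<beta> \<bullet> \<beta>) = 2 * (\<alpha> \<bullet> \<beta>)" "of_int n * (\<alpha> \<bullet> \<alpha>) = 2 * (\<alpha> \<bullet> \<beta>)"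
    using m n pos by (auto simp: cartan_def field_simps inner_commute)
  have "real_of_int m > 0" "real_of_int n > 0"
    using pos assms(3) m[symmetric] n[symmetric] by (simp_all add: cartan_def inner_commute)
  then have mn_pos: "m \<ge> 1" "n \<ge> 1" by simp_all
  have "m = 1 \<or> n = 1"
  proof (rule ccontr)
    assume "\<not> (m = 1 \<or> n = 1)"
    then have "real_of_int m \<ge> 2" "real_of_int n \<ge> 2" using mn_pos by linarith+
    then have "2 * (\<beta> \<bullet> \<beta>) \<le> 2 * (\<alpha> \<bullet> \<beta>)" "2 * (\<alpha> \<bullet> \<alpha>) \<le> 2 * (\<alpha> \<bullet> \<beta>)"
      using pos mult_right_mono[of 2 "real_of_int m" "\<beta> \<bullet> \<beta>"] mult_right_mono[of 2 "real_of_int n" "\<alpha> \<bullet> \<alpha>"] mn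
      by simp_all
    then have "(\<alpha> - \<beta>) \<bullet> (\<alpha> - \<beta>) \<le> 0"
      by (simp add: inner_diff inner_commute)
    then show False using assms(4) by (metis inner_gt_zero_iff not_less right_minus_eq)
  qed
  then show ?thesis
  proof
    assume "m = 1"
    then show ?thesis using refl[OF assms(2,1)] m by (simp add: root_reflection_def)
  next
    assume "n = 1"
    then have "\<beta> - \<alpha> \<in> \<Phi>" using refl[OF assms(1,2)] n by (simp add: root_reflection_def)
    then show ?thesis using uminus_root by fastforce
  qed
qed

end

text \<open>The functional \<open>u\<close> is additive on \<open>\<int>\<Phi>\<close>, so it may be applied to integral combinations of roots but not
to real ones.  That is why independence is proved, and coordinates are taken, over \<open>\<int>\<close>.\<close>

locale regular_functional = roots +
  fixes u
  assumes u_V: "u \<in> real_dual (root_lattice \<Phi>)" and regular: "\<And>\<alpha>. \<alpha> \<in> \<Phi> \<Longrightarrow> u \<alpha> \<noteq> 0"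
begin

definition "pos = {\<alpha> \<in> \<Phi>. u \<alpha> > 0}"
definition "simple = {\<alpha> \<in> pos. \<not> (\<exists>\<beta>\<in>pos. \<exists>\<gamma>\<in>pos. \<alpha> = \<beta> + \<gamma>)}"

lemma simple_pos: "simple \<subseteq> pos" and pos_roots: "pos \<subseteq> \<Phi>" and simple_roots: "simple \<subseteq> \<Phi>"
  by (auto simp: simple_def pos_def)

lemma finite_pos: "finite pos" and finite_simple: "finite simple"
  using finite_roots pos_roots simple_roots finite_subset by blast+

lemma simple_int_span: "a \<in> simple \<Longrightarrow> a \<in> int_span \<Phi>"
  using simple_roots root_int_span by blast

lemma root_pos_or_neg: "\<alpha> \<in> \<Phi> \<Longrightarrow> \<alpha> \<in> pos \<or> - \<alpha> \<in> pos"
  using regular[of \<alpha>] uminus_root[of \<alpha>] V_uminus[OF u_V root_int_span, of \<alpha>] by (auto simp: pos_def)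

text \<open>Otherwise \<open>a - b\<close> would be a root; whether it is positive or negative, it decomposes \<open>a\<close> or \<open>b\<close>.\<close>

lemma simple_obtuse:
  assumes "a \<in> simple" "b \<in> simple" "a \<noteq> b" shows "a \<bullet> b \<le> 0"
proof (rule ccontr)
  assume "\<not> a \<bullet> b \<le> 0"
  then have d: "a - b \<in> \<Phi>"
    using assms simple_roots by (intro diff_root) auto
  show False
  proof (cases "a - b \<in> pos")
    case True
    then have "\<exists>\<beta>\<in>pos. \<exists>\<gamma>\<in>pos. a = \<beta> + \<gamma>"
      using assms simple_pos by (intro bexI[of _ "a - b"] bexI[of _ b]) auto
    then show False using assms(1) by (auto simp: simple_def)
  next
    case False
    then have "b - a \<in> pos" using root_pos_or_neg[OF d] by simp
    then have "\<exists>\<beta>\<in>pos. \<exists>\<gamma>\<in>pos. b = \<beta> + \<gamma>"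
      using assms simple_pos by (intro bexI[of _ "b - a"] bexI[of _ a]) auto
    then show False using assms(2) by (auto simp: simple_def)
  qed
qed

text \<open>Decompose until only simple roots are left; this ends because the summands have smaller values under \<open>u\<close>
and there are finitely many roots.\<close>

lemma pos_nat_combination:
  "\<alpha> \<in> pos \<Longrightarrow> \<exists>n :: 'a \<Rightarrow> nat. \<alpha> = (\<Sum>a\<in>simple. real (n a) *\<^sub>R a)"
proof (induction "card {\<beta> \<in> pos. u \<beta> < u \<alpha>}" arbitrary: \<alpha> rule: less_induct)
  case less
  show ?case
  proof (cases "\<alpha> \<in> simple")
    case True
    have "(\<Sum>a\<in>simple. real (if a = \<alpha> then 1 else 0) *\<^sub>R a) = (\<Sum>a\<in>simple. if a = \<alpha> then \<alpha> else 0)"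
      by (intro sum.cong refl) auto
    also have "\<dots> = \<alpha>" using True finite_simple by simp
    finally show ?thesis by (intro exI[of _ "\<lambda>a. if a = \<alpha> then 1 else 0"]) simp
  next
    case False
    then obtain \<beta> \<gamma> where bc: "\<beta> \<in> pos" "\<gamma> \<in> pos" "\<alpha> = \<beta> + \<gamma>"
      using less.prems by (auto simp: simple_def)
    then have u: "u \<alpha> = u \<beta> + u \<gamma>"
      using V_add[OF u_V] pos_roots root_int_span by blast
    have uu: "u \<beta> < u \<alpha>" "u \<gamma> < u \<alpha>" using u bc by (auto simp: pos_def)
    have "card {x \<in> pos. u x < u y} < card {x \<in> pos. u x < u \<alpha>}" if "y \<in> pos" "u y < u \<alpha>" for y
      using that by (intro psubset_card_mono) (auto simp: finite_pos)
    then obtain m n :: "'a \<Rightarrow> nat"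
      where "\<beta> = (\<Sum>a\<in>simple. real (m a) *\<^sub>R a)" "\<gamma> = (\<Sum>a\<in>simple. real (n a) *\<^sub>R a)"
      using less.hyps[of \<beta>] less.hyps[of \<gamma>] bc(1,2) uu by blast
    then have "\<alpha> = (\<Sum>a\<in>simple. real (m a + n a) *\<^sub>R a)"
      by (simp add: bc(3) scaleR_left_distrib sum.distrib)
    then show ?thesis by (rule exI[of _ "\<lambda>a. m a + n a"])
  qed
qed

lemma simple_sum_zero_one_sided:
  fixes c :: "'a \<Rightarrow> int"
  assumes "P \<subseteq> simple" "\<And>a. a \<in> P \<Longrightarrow> c a > 0" "(\<Sum>a\<in>P. real_of_int (c a) *\<^sub>R a) = 0"
  shows "P = {}"
proof (rule ccontr)
  assume "P \<noteq> {}"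
  have fin: "finite P" using assms(1) finite_simple finite_subset by blast
  have "0 = u (\<Sum>a\<in>P. real_of_int (c a) *\<^sub>R a)"
    using assms(3) V_zero[OF u_V] by simp
  also have "\<dots> = (\<Sum>a\<in>P. real_of_int (c a) * u a)"
    using assms(1) simple_int_span by (intro V_lincomb[OF u_V]) auto
  also have "\<dots> > 0"
    using assms(1,2) simple_pos by (intro sum_pos fin \<open>P \<noteq> {}\<close>) (auto simp: pos_def)
  finally show False by simp
qed

text \<open>Move the terms with negative coefficients to the other side.  Both sides equal a vector \<open>v\<close>, and
\<open>v \<bullet> v \<le> 0\<close> because different simple roots are obtuse.  Hence \<open>v = 0\<close>, and each side is a relation with positive
coefficients, which \<open>u > 0\<close> forbids.\<close>

lemma simple_independent:
  fixes c :: "'a \<Rightarrow> int"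
  assumes zero: "(\<Sum>a\<in>simple. real_of_int (c a) *\<^sub>R a) = 0" and a: "a \<in> simple"
  shows "c a = 0"
proof -
  define P where "P = {a \<in> simple. c a > 0}"
  define N where "N = {a \<in> simple. c a < 0}"
  define v where "v = (\<Sum>a\<in>P. real_of_int (c a) *\<^sub>R a)"
  have fin: "finite P" "finite N" using finite_simple by (auto simp: P_def N_def)
  have "(\<Sum>a\<in>simple. real_of_int (c a) *\<^sub>R a) = (\<Sum>a\<in>P \<union> N. real_of_int (c a) *\<^sub>R a)"
    by (rule sum.mono_neutral_right) (auto simp: P_def N_def finite_simple)
  also have "\<dots> = v + (\<Sum>a\<in>N. real_of_int (c a) *\<^sub>R a)"
    unfolding v_def by (rule sum.union_disjoint) (auto simp: P_def N_def finite_simple)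
  finally have v2: "v = (\<Sum>a\<in>N. real_of_int (- c a) *\<^sub>R a)"
    using zero by (simp add: sum_negf eq_neg_iff_add_eq_0)
  have "v \<bullet> v = (\<Sum>a\<in>P. real_of_int (c a) *\<^sub>R a) \<bullet> (\<Sum>b\<in>N. real_of_int (- c b) *\<^sub>R b)"
    using v2 v_def by simp
  also have "\<dots> = (\<Sum>a\<in>P. \<Sum>b\<in>N. (real_of_int (c a) * real_of_int (- c b)) * (a \<bullet> b))"
    unfolding inner_sum_left inner_sum_right
    by (subst sum.swap, intro sum.cong refl) (simp add: mult.assoc)
  also have "\<dots> \<le> 0"
    by (intro sum_nonpos mult_nonneg_nonpos mult_nonneg_nonneg simple_obtuse) (auto simp: P_def N_def)
  finally have "v = 0" by (metis inner_gt_zero_iff not_less)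
  have "P = {}"
    by (rule simple_sum_zero_one_sided[of P c]) (use \<open>v = 0\<close> v_def in \<open>auto simp: P_def\<close>)
  moreover have "N = {}"
    by (rule simple_sum_zero_one_sided[of N "\<lambda>a. - c a"]) (use \<open>v = 0\<close> v2 in \<open>auto simp: N_def\<close>)
  ultimately show ?thesis using a by (auto simp: P_def N_def) (meson linorder_neqE_linordered_idom)
qed

lemma int_span_simple: "int_span simple = int_span \<Phi>"
proof
  show "int_span simple \<subseteq> int_span \<Phi>"
    by (rule int_span_mono) (use simple_int_span in auto)
  have "\<alpha> \<in> int_span simple" if "\<alpha> \<in> pos" for \<alpha>
  proof -
    obtain n :: "'a \<Rightarrow> nat" where n: "\<alpha> = (\<Sum>a\<in>simple. real (n a) *\<^sub>R a)"
      using pos_nat_combination[OF \<open>\<alpha> \<in> pos\<close>] by blast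
    have "real (n a) *\<^sub>R a \<in> int_span simple" if "a \<in> simple" for a
      using int_span_scale[OF int_span_base[OF that], of "int (n a)"] by simp
    then show ?thesis unfolding n by (rule int_span_sum)
  qed
  then have "\<alpha> \<in> int_span simple" if "\<alpha> \<in> \<Phi>" for \<alpha>
    using root_pos_or_neg[OF that] int_span_uminus[of "- \<alpha>" simple] by auto
  then show "int_span \<Phi> \<subseteq> int_span simple"
    by (intro int_span_mono) auto
qed

definition coord :: "'a \<Rightarrow> 'a \<Rightarrow> int" where
  "coord x = (SOME c. x = (\<Sum>a\<in>simple. real_of_int (c a) *\<^sub>R a))"

lemma coord_sum:
  assumes "x \<in> int_span \<Phi>" shows "x = (\<Sum>a\<in>simple. real_of_int (coord x a) *\<^sub>R a)"
proof -
  obtain n where "x = (\<Sum>a\<in>simple. real_of_int (n a) *\<^sub>R a)"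
    using assms unfolding int_span_simple[symmetric] by (rule int_span_finite[OF finite_simple])
  then show ?thesis
    unfolding coord_def by (rule someI[where P = "\<lambda>c. x = (\<Sum>a\<in>simple. real_of_int (c a) *\<^sub>R a)"])
qed

lemma coord_unique:
  assumes "x = (\<Sum>a\<in>simple. real_of_int (c a) *\<^sub>R a)" "a \<in> simple"
  shows "coord x a = c a"
proof -
  have "x \<in> int_span \<Phi>"
    unfolding assms(1) by (intro int_span_sum int_span_scale simple_int_span)
  then have "(\<Sum>a\<in>simple. real_of_int (coord x a) *\<^sub>R a) = x"
    using coord_sum by simp
  then have "(\<Sum>a\<in>simple. real_of_int (coord x a - c a) *\<^sub>R a) = 0"
    using assms(1) by (simp add: scaleR_left_diff_distrib sum_subtractf)
  then have "coord x a - c a = 0" by (rule simple_independent[OF _ assms(2)])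
  then show ?thesis by simp
qed

text \<open>The fundamental coweights, the basis dual to the simple roots.\<close>

definition coweight :: "'a \<Rightarrow> 'a \<Rightarrow> real" where
  "coweight a x = (if x \<in> int_span \<Phi> then real_of_int (coord x a) else 0)"

lemma coweight_int_dual: assumes "a \<in> simple" shows "coweight a \<in> int_dual (root_lattice \<Phi>)"
proof -
  have "coord (x + y) a = coord x a + coord y a" if "x \<in> int_span \<Phi>" "y \<in> int_span \<Phi>" for x y
    using coord_sum[OF that(1)] coord_sum[OF that(2)] assms
    by (intro coord_unique) (simp_all add: scaleR_left_distrib sum.distrib)
  then show ?thesis
    by (auto simp: int_dual_def real_dual_def coweight_def int_span_add)
qed

lemma coweight_V: "a \<in> simple \<Longrightarrow> coweight a \<in> V"
  using coweight_int_dual int_dual_subset by blast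

lemma coweight_simple:
  assumes "a \<in> simple" "b \<in> simple" shows "coweight a b = (if a = b then 1 else 0)"
proof -
  have "(\<Sum>c\<in>simple. real_of_int (if c = b then 1 else 0) *\<^sub>R c) = (\<Sum>c\<in>simple. if c = b then b else 0)"
    by (intro sum.cong refl) auto
  then have "coord b a = (if a = b then 1 else 0)"
    using assms finite_simple by (intro coord_unique) auto
  then show ?thesis using assms simple_int_span by (simp add: coweight_def)
qed

lemma coweight_inj: "inj_on coweight simple"
  by (rule inj_onI) (metis coweight_simple zero_neq_one)

lemma coweight_expansion:
  assumes "v \<in> V" shows "v x = (\<Sum>a\<in>simple. v a * coweight a x)"
proof (cases "x \<in> int_span \<Phi>")
  case True
  have "v x = v (\<Sum>a\<in>simple. real_of_int (coord x a) *\<^sub>R a)"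
    using coord_sum[OF True] by simp
  also have "\<dots> = (\<Sum>a\<in>simple. real_of_int (coord x a) * v a)"
    using simple_int_span by (intro V_lincomb[OF assms]) auto
  finally show ?thesis using True by (simp add: coweight_def mult.commute)
next
  case False
  then show ?thesis
    using assms real_dual_outside[of v "root_lattice \<Phi>" x] by (simp add: coweight_def)
qed

lemma coweight_basis: "int_dual_basis (root_lattice \<Phi>) (coweight ` simple)"
  unfolding int_dual_basis_def
proof (intro conjI ballI)
  show "finite (coweight ` simple)" "coweight ` simple \<subseteq> int_dual (root_lattice \<Phi>)"
    using finite_simple coweight_int_dual by auto
  fix v assume "v \<in> int_dual (root_lattice \<Phi>)"
  then have v: "v \<in> V" "\<And>x. v x \<in> \<int>" by (auto simp: int_dual_def)
  define c where "c w = (if w \<in> coweight ` simple then \<lfloor>v (inv_into simple coweight w)\<rfloor> else 0)" for w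
  have sum: "(\<Sum>b\<in>coweight ` simple. real_of_int (d b) * b x) = (\<Sum>a\<in>simple. real_of_int (d (coweight a)) * coweight a x)"
    for d :: "_ \<Rightarrow> int" and x
    by (simp add: sum.reindex[OF coweight_inj])
  have c: "real_of_int (c (coweight a)) = v a" if "a \<in> simple" for a
    using that v(2) by (simp add: c_def inv_into_f_f[OF coweight_inj])
  show "\<exists>!c. (\<forall>b. b \<notin> coweight ` simple \<longrightarrow> c b = 0) \<and>
      v = (\<lambda>x. \<Sum>b\<in>coweight ` simple. real_of_int (c b) * b x)"
  proof (rule ex1I[of _ c], intro conjI)
    show "v = (\<lambda>x. \<Sum>b\<in>coweight ` simple. real_of_int (c b) * b x)"
      unfolding sum by (rule ext) (simp add: c coweight_expansion[OF v(1), symmetric] cong: sum.cong)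
  next
    fix d assume d: "(\<forall>b. b \<notin> coweight ` simple \<longrightarrow> d b = 0) \<and>
      v = (\<lambda>x. \<Sum>b\<in>coweight ` simple. real_of_int (d b) * b x)"
    have "v b = real_of_int (d (coweight b))" if "b \<in> simple" for b
    proof -
      have "v b = (\<Sum>a\<in>simple. real_of_int (d (coweight a)) * coweight a b)"
        using d sum by metis
      also have "\<dots> = (\<Sum>a\<in>simple. if a = b then real_of_int (d (coweight b)) else 0)"
        using that by (intro sum.cong refl) (auto simp: coweight_simple)
      finally show ?thesis using that finite_simple by simp
    qed
    then have "d (coweight b) = c (coweight b)" if "b \<in> simple" for b
      using that c by (metis of_int_eq_iff)
    then show "d = c" using d by (intro ext) (auto simp: c_def)
  qed (auto simp: c_def)
qed

lemma pos_value:
  assumes "v \<in> V" "\<And>a. a \<in> simple \<Longrightarrow> v a \<ge> 0" "\<alpha> \<in> pos" shows "v \<alpha> \<ge> 0"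
proof -
  obtain n where n: "\<alpha> = (\<Sum>a\<in>simple. real (n a) *\<^sub>R a)"
    using pos_nat_combination[OF assms(3)] by blast
  have "v \<alpha> = (\<Sum>a\<in>simple. real_of_int (int (n a)) * v a)"
    using V_lincomb[OF assms(1), of simple "\<lambda>a. int (n a)"] n simple_int_span by auto
  also have "\<dots> \<ge> 0" using assms(2) by (intro sum_nonneg) auto
  finally show ?thesis .
qed

lemma chamber_eq: "closed_chamber \<Phi> u = {v \<in> V. \<forall>\<alpha>\<in>pos. v \<alpha> \<ge> 0}"
  by (auto simp: closed_chamber_def pos_def)

lemma chamber_eq_simple: "closed_chamber \<Phi> u = {v \<in> V. \<forall>a\<in>simple. v a \<ge> 0}"
  unfolding chamber_eq using simple_pos pos_value by blast

definition face :: "'a set \<Rightarrow> ('a \<Rightarrow> real) set" where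
  "face J = {v \<in> closed_chamber \<Phi> u. \<forall>a\<in>J. v a = 0}"

lemma face_V: "face J \<subseteq> V"
  by (auto simp: face_def closed_chamber_def)

lemma face_eq_cone_gen:
  assumes "J \<subseteq> simple" shows "face J = cone_gen (coweight ` (simple - J))"
proof -
  have inj: "inj_on coweight (simple - J)"
    using coweight_inj by (rule inj_on_subset) auto
  have val: "(\<Sum>a\<in>simple - J. c a * coweight a b) = (if b \<in> J then 0 else c b)" if "b \<in> simple" for b and c :: "_ \<Rightarrow> real"
  proof -
    have "(\<Sum>a\<in>simple - J. c a * coweight a b) = (\<Sum>a\<in>simple - J. if a = b then c b else 0)"
      using that by (intro sum.cong refl) (auto simp: coweight_simple)
    then show ?thesis using that finite_simple by auto
  qed
  show ?thesis
  proof (intro equalityI subsetI)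
    fix v assume v: "v \<in> face J"
    have vV: "v \<in> V" using v face_V by blast
    define c where "c w = v (inv_into simple coweight w)" for w
    have c: "c (coweight a) = v a" if "a \<in> simple" for a
      using that by (simp add: c_def inv_into_f_f[OF coweight_inj])
    have "v x = (\<Sum>w\<in>coweight ` (simple - J). c w * w x)" for x
    proof -
      have "v x = (\<Sum>a\<in>simple. v a * coweight a x)"
        by (rule coweight_expansion[OF vV])
      also have "\<dots> = (\<Sum>a\<in>simple - J. v a * coweight a x)"
        by (rule sum.mono_neutral_right) (use v finite_simple in \<open>auto simp: face_def\<close>)
      finally show ?thesis by (simp add: sum.reindex[OF inj] c)
    qed
    moreover have "\<forall>w\<in>coweight ` (simple - J). c w \<ge> 0"
      using v by (auto simp: c face_def chamber_eq_simple)
    ultimately show "v \<in> cone_gen (coweight ` (simple - J))"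
      unfolding cone_gen_def by blast
  next
    fix v assume "v \<in> cone_gen (coweight ` (simple - J))"
    then obtain c where c: "\<forall>w\<in>coweight ` (simple - J). c w \<ge> 0"
      and v: "v = (\<lambda>x. \<Sum>w\<in>coweight ` (simple - J). c w * w x)"
      by (auto simp: cone_gen_def)
    have "v \<in> V" unfolding v
      by (rule real_dual_linear_combination) (use coweight_V in auto)
    moreover have "v b = (if b \<in> J then 0 else c (coweight b))" if "b \<in> simple" for b
      unfolding v by (simp add: sum.reindex[OF inj] val[OF that])
    ultimately show "v \<in> face J"
      using assms c by (auto simp: face_def chamber_eq_simple subset_iff)
  qed
qed

lemma coweight_in_face: "a \<in> simple - J \<Longrightarrow> J \<subseteq> simple \<Longrightarrow> coweight a \<in> face J"
  by (auto simp: face_def chamber_eq_simple coweight_V coweight_simple subset_iff)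

text \<open>In the dual basis \<open>v x\<close> is a sum of terms \<open>v a * coweight a x\<close> without negative terms, as the coweights
themselves lie in the face.  So it vanishes iff every term does, and the faces of \<open>face J\<close> are again of the form
\<open>face K\<close>.\<close>

lemma face_of_face:
  assumes J: "J \<subseteq> simple" and nonneg: "\<forall>v\<in>face J. v x \<ge> 0"
  shows "{v \<in> face J. v x = 0} = face (J \<union> {a \<in> simple - J. coweight a x \<noteq> 0})"
proof -
  have "v x = 0 \<longleftrightarrow> (\<forall>a\<in>simple - J. coweight a x \<noteq> 0 \<longrightarrow> v a = 0)" if v: "v \<in> face J" for v
  proof -
    have "v x = (\<Sum>a\<in>simple. v a * coweight a x)"
      using v face_V by (intro coweight_expansion) auto
    also have "\<dots> = (\<Sum>a\<in>simple - J. v a * coweight a x)"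
      by (rule sum.mono_neutral_right) (use v finite_simple in \<open>auto simp: face_def\<close>)
    finally have vx: "v x = (\<Sum>a\<in>simple - J. v a * coweight a x)" .
    have "v a * coweight a x \<ge> 0" if "a \<in> simple - J" for a
      using that v nonneg coweight_in_face[OF that J] by (auto simp: face_def chamber_eq_simple)
    then have "v x = 0 \<longleftrightarrow> (\<forall>a\<in>simple - J. v a * coweight a x = 0)"
      unfolding vx using finite_simple by (intro sum_nonneg_eq_0_iff) auto
    then show ?thesis by auto
  qed
  then show ?thesis by (auto simp: face_def)
qed

text \<open>The sum of the roots in \<open>K\<close> cuts out the smaller face.\<close>

lemma cone_face_face:
  assumes "J \<subseteq> K" "K \<subseteq> simple" shows "cone_face (root_lattice \<Phi>) (face K) (face J)"
proof -
  have K: "finite K" "K \<subseteq> int_span \<Phi>" using assms finite_simple finite_subset simple_int_span by blast+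
  have val: "v (\<Sum>a\<in>K. a) = (\<Sum>a\<in>K. v a)" if "v \<in> face J" for v
    using that face_V K by (intro V_sum) auto
  have nonneg: "v a \<ge> 0" if "v \<in> face J" "a \<in> K" for v a
    using that assms by (auto simp: face_def chamber_eq_simple)
  have "v (\<Sum>a\<in>K. a) = 0 \<longleftrightarrow> (\<forall>a\<in>K. v a = 0)" if "v \<in> face J" for v
    unfolding val[OF that] using K nonneg[OF that] by (intro sum_nonneg_eq_0_iff) auto
  then have "face K = {v \<in> face J. v (\<Sum>a\<in>K. a) = 0}"
    using assms by (auto simp: face_def)
  moreover have "\<forall>v\<in>face J. v (\<Sum>a\<in>K. a) \<ge> 0"
    using nonneg by (auto simp: val intro!: sum_nonneg)
  ultimately show ?thesis
    unfolding cone_face_def using K by (intro bexI[of _ "\<Sum>a\<in>K. a"]) (auto intro: int_span_sum)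
qed

lemma cone_face_faceD:
  assumes "cone_face (root_lattice \<Phi>) \<tau> (face J)" "J \<subseteq> simple"
  obtains K where "J \<subseteq> K" "K \<subseteq> simple" "\<tau> = face K"
proof -
  obtain x where "\<forall>v\<in>face J. v x \<ge> 0" "\<tau> = {v \<in> face J. v x = 0}"
    using assms by (auto simp: cone_face_def)
  then show ?thesis
    using assms(2) by (intro that[of "J \<union> {a \<in> simple - J. coweight a x \<noteq> 0}"]) (auto simp: face_of_face)
qed

lemma face_empty: "face {} = closed_chamber \<Phi> u"
  by (auto simp: face_def)

end

section \<open>The fan of Weyl chambers\<close>

lemma fst_toric_root [simp]: "fst (toric_root \<Phi>) = root_lattice \<Phi>"
  by (simp add: toric_root_def)

lemma mem_toric_root:
  "\<tau> \<in> snd (toric_root \<Phi>) \<longleftrightarrow> (\<exists>\<sigma>\<in>closed_chambers \<Phi>. cone_face (root_lattice \<Phi>) \<tau> \<sigma>)"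
  by (simp add: toric_root_def)

context regular_functional
begin

lemma chamber_in_chambers: "closed_chamber \<Phi> u \<in> closed_chambers \<Phi>"
  using u_V regular by (auto simp: closed_chambers_def)

lemma face_in_fan: "J \<subseteq> simple \<Longrightarrow> face J \<in> snd (toric_root \<Phi>)"
  unfolding mem_toric_root using chamber_in_chambers cone_face_face[of "{}" J] by (auto simp: face_empty)

lemma sum_abs_roots:
  assumes v: "v \<in> V" shows "(\<Sum>\<alpha>\<in>\<Phi>. \<bar>v \<alpha>\<bar>) = 2 * (\<Sum>\<alpha>\<in>pos. \<bar>v \<alpha>\<bar>)"
proof -
  have eq: "\<Phi> = pos \<union> uminus ` pos"
  proof (intro equalityI subsetI)
    fix \<alpha> assume "\<alpha> \<in> \<Phi>"
    then show "\<alpha> \<in> pos \<union> uminus ` pos"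
      using root_pos_or_neg[of \<alpha>] by (auto intro: image_eqI[of \<alpha> uminus "- \<alpha>"])
  qed (use pos_roots uminus_root in auto)
  have disj: "pos \<inter> uminus ` pos = {}"
    using V_uminus[OF u_V root_int_span] pos_roots by (force simp: pos_def)
  have "(\<Sum>\<alpha>\<in>\<Phi>. \<bar>v \<alpha>\<bar>) = (\<Sum>\<alpha>\<in>pos. \<bar>v \<alpha>\<bar>) + (\<Sum>\<alpha>\<in>uminus ` pos. \<bar>v \<alpha>\<bar>)"
    by (subst eq, rule sum.union_disjoint) (use disj finite_pos in auto)
  also have "(\<Sum>\<alpha>\<in>uminus ` pos. \<bar>v \<alpha>\<bar>) = (\<Sum>\<alpha>\<in>pos. \<bar>v (- \<alpha>)\<bar>)"
    by (subst sum.reindex) (auto simp: inj_on_def)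
  also have "\<dots> = (\<Sum>\<alpha>\<in>pos. \<bar>v \<alpha>\<bar>)"
    using V_uminus[OF v root_int_span] pos_roots by (intro sum.cong refl) (auto simp: subset_iff)
  finally show ?thesis by simp
qed

text \<open>Minus twice the Weyl vector.  The lemmas after this definition compare its values with the
function \<open>v \<mapsto> - (\<Sum>\<alpha>\<in>\<Phi>. \<bar>v \<alpha>\<bar>) / 2\<close>, which does not mention \<open>u\<close>: it is the support function of the ample divisor,
and \<open>divisor\<close> is its linear part on the chamber of \<open>u\<close>.\<close>

definition divisor :: 'a where "divisor = - (\<Sum>\<alpha>\<in>pos. \<alpha>)"

lemma divisor_int_span: "divisor \<in> int_span \<Phi>"
  unfolding divisor_def using pos_roots root_int_span by (intro int_span_uminus int_span_sum) auto

lemma divisor_value: assumes "v \<in> V" shows "v divisor = - (\<Sum>\<alpha>\<in>pos. v \<alpha>)"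
proof -
  have "v (\<Sum>\<alpha>\<in>pos. \<alpha>) = (\<Sum>\<alpha>\<in>pos. v \<alpha>)"
    using assms pos_roots root_int_span by (intro V_sum) auto
  moreover have "(\<Sum>\<alpha>\<in>pos. \<alpha>) \<in> int_span \<Phi>"
    using pos_roots root_int_span by (intro int_span_sum) auto
  ultimately show ?thesis
    using assms by (simp add: divisor_def V_uminus)
qed

lemma divisor_ge: assumes "v \<in> V" shows "v divisor \<ge> - (\<Sum>\<alpha>\<in>\<Phi>. \<bar>v \<alpha>\<bar>) / 2"
  unfolding divisor_value[OF assms] sum_abs_roots[OF assms] by (simp add: sum_mono)

lemma divisor_eq_iff:
  assumes "v \<in> V" shows "v divisor = - (\<Sum>\<alpha>\<in>\<Phi>. \<bar>v \<alpha>\<bar>) / 2 \<longleftrightarrow> v \<in> closed_chamber \<Phi> u"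
proof -
  have "v divisor = - (\<Sum>\<alpha>\<in>\<Phi>. \<bar>v \<alpha>\<bar>) / 2 \<longleftrightarrow> (\<Sum>\<alpha>\<in>pos. \<bar>v \<alpha>\<bar> - v \<alpha>) = 0"
    unfolding divisor_value[OF assms] sum_abs_roots[OF assms] by (auto simp: sum_subtractf)
  also have "\<dots> \<longleftrightarrow> (\<forall>\<alpha>\<in>pos. \<bar>v \<alpha>\<bar> - v \<alpha> = 0)"
    by (intro sum_nonneg_eq_0_iff finite_pos) simp
  also have "\<dots> \<longleftrightarrow> v \<in> closed_chamber \<Phi> u"
    unfolding chamber_eq using assms by auto
  finally show ?thesis .
qed

end

context roots
begin

lemma fan_coneE:
  assumes "\<tau> \<in> snd (toric_root \<Phi>)"
  obtains u J where "regular_functional \<Phi> u" "J \<subseteq> regular_functional.simple \<Phi> u"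
    "\<tau> = regular_functional.face \<Phi> u J"
proof -
  obtain u where u: "u \<in> V" "\<forall>\<alpha>\<in>\<Phi>. u \<alpha> \<noteq> 0" and \<tau>: "cone_face (root_lattice \<Phi>) \<tau> (closed_chamber \<Phi> u)"
    using assms by (auto simp: mem_toric_root closed_chambers_def)
  interpret R: regular_functional \<Phi> u
    using u by unfold_locales auto
  show ?thesis
    using \<tau> unfolding R.face_empty[symmetric]
  proof (rule R.cone_face_faceD)
    fix K assume "K \<subseteq> R.simple" "\<tau> = R.face K"
    then show ?thesis by (rule that[OF R.regular_functional_axioms])
  qed simp
qed

text \<open>The root hyperplanes form a null set, so they do not cover the space.\<close>

lemma regular_functional_exists: "\<exists>u. regular_functional \<Phi> u"
proof -
  have "negligible (\<Union>\<alpha>\<in>\<Phi>. {x. \<alpha> \<bullet> x = 0})"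
    using finite_roots root_nonzero by (intro negligible_Union) (auto intro: negligible_hyperplane)
  then have "(\<Union>\<alpha>\<in>\<Phi>. {x. \<alpha> \<bullet> x = 0}) \<noteq> UNIV"
    by (metis non_negligible_UNIV)
  then obtain x where x: "\<forall>\<alpha>\<in>\<Phi>. \<alpha> \<bullet> x \<noteq> 0" by auto
  let ?u = "\<lambda>y. if y \<in> int_span \<Phi> then y \<bullet> x else 0"
  have "regular_functional \<Phi> ?u"
    using x by unfold_locales (auto simp: real_dual_def int_span_add inner_add_left root_int_span)
  then show ?thesis by (intro exI[of _ ?u])
qed

text \<open>Perturb \<open>v\<close> by a regular functional \<open>w\<close>.  Instead of making \<open>w\<close> small, \<open>v\<close> is scaled up until it
dominates \<open>w\<close> on all roots where it is not zero.\<close>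

lemma in_some_chamber:
  assumes v: "v \<in> V" shows "\<exists>u. regular_functional \<Phi> u \<and> v \<in> closed_chamber \<Phi> u"
proof -
  obtain w where "regular_functional \<Phi> w" using regular_functional_exists by blast
  then interpret W: regular_functional \<Phi> w .
  \<comment> \<open>Roots with \<open>v \<alpha> = 0\<close> contribute \<open>0\<close> to this sum, as division by zero gives zero.\<close>
  define C where "C = (\<Sum>\<alpha>\<in>\<Phi>. \<bar>w \<alpha>\<bar> / \<bar>v \<alpha>\<bar>)"
  have C: "C \<ge> 0" unfolding C_def by (intro sum_nonneg) auto
  define u where "u = (\<lambda>x. (1 + C) * v x + w x)"
  have uV: "u \<in> V"
    using v W.u_V by (auto simp: u_def real_dual_def algebra_simps)
  have dominate: "\<bar>w \<alpha>\<bar> < (1 + C) * \<bar>v \<alpha>\<bar>" if "\<alpha> \<in> \<Phi>" "v \<alpha> \<noteq> 0" for \<alpha>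
  proof -
    have "\<bar>w \<alpha>\<bar> / \<bar>v \<alpha>\<bar> \<le> C"
      unfolding C_def using that finite_roots by (intro member_le_sum) auto
    then have "\<bar>w \<alpha>\<bar> \<le> C * \<bar>v \<alpha>\<bar>" using that by (simp add: field_simps)
    then show ?thesis using that by (simp add: algebra_simps)
  qed
  have pos_iff: "v \<alpha> > 0 \<Longrightarrow> u \<alpha> > 0" "v \<alpha> < 0 \<Longrightarrow> u \<alpha> < 0" if "\<alpha> \<in> \<Phi>" for \<alpha>
    using dominate[OF that] by (auto simp: u_def)
  have "u \<alpha> \<noteq> 0" if "\<alpha> \<in> \<Phi>" for \<alpha>
    using pos_iff[OF that] W.regular[OF that] by (cases "v \<alpha>" "0 :: real" rule: linorder_cases) (auto simp: u_def)
  then have "regular_functional \<Phi> u" using uV by unfold_locales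
  moreover have "v \<in> closed_chamber \<Phi> u"
    using v pos_iff(2) by (fastforce simp: closed_chamber_def not_less[symmetric])
  ultimately show ?thesis by blast
qed

text \<open>A point of the first face lies in the second chamber iff it vanishes on the roots that are positive for
\<open>u\<close> and negative for \<open>w\<close>, and it has to vanish on \<open>K\<close>.  All these roots are, up to sign, positive for \<open>u\<close>;
their sum is non-negative on the first face and vanishes exactly on the intersection.\<close>

lemma face_Int_face:
  assumes u: "regular_functional \<Phi> u" and J: "J \<subseteq> regular_functional.simple \<Phi> u"
    and w: "regular_functional \<Phi> w" and K: "K \<subseteq> regular_functional.simple \<Phi> w"
  shows "cone_face (root_lattice \<Phi>) (regular_functional.face \<Phi> u J \<inter> regular_functional.face \<Phi> w K)
    (regular_functional.face \<Phi> u J)"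
proof -
  interpret U: regular_functional \<Phi> u by (rule u)
  interpret W: regular_functional \<Phi> w by (rule w)
  \<comment> \<open>The roots in \<open>A\<close> are non-negative on the first face, and on the second face they are non-positive or zero.\<close>
  define A where "A = {\<alpha> \<in> U.pos. w \<alpha> < 0 \<or> \<alpha> \<in> K \<or> - \<alpha> \<in> K}"
  have A: "finite A" "A \<subseteq> \<Phi>" using U.finite_pos U.pos_roots by (auto simp: A_def)
  have K_roots: "K \<subseteq> \<Phi>" using K W.simple_roots by blast
  have val: "v (\<Sum>\<alpha>\<in>A. \<alpha>) = (\<Sum>\<alpha>\<in>A. v \<alpha>)" if "v \<in> U.face J" for v
    using that U.face_V A root_int_span by (intro V_sum) auto
  have nonneg: "v \<alpha> \<ge> 0" if "v \<in> U.face J" "\<alpha> \<in> A" for v \<alpha>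
    using that by (auto simp: U.face_def U.chamber_eq A_def)
  have "v (\<Sum>\<alpha>\<in>A. \<alpha>) = 0 \<longleftrightarrow> v \<in> W.face K" if v: "v \<in> U.face J" for v
  proof -
    have vV: "v \<in> V" using v U.face_V by blast
    have neg: "v (- \<alpha>) = - v \<alpha>" "w (- \<alpha>) = - w \<alpha>" if "\<alpha> \<in> \<Phi>" for \<alpha>
      using that V_uminus[OF vV] V_uminus[OF W.u_V] root_int_span by auto
    have vpos: "v \<alpha> \<ge> 0" if "\<alpha> \<in> U.pos" for \<alpha>
      using that v by (auto simp: U.face_def U.chamber_eq)
    have "v (\<Sum>\<alpha>\<in>A. \<alpha>) = 0 \<longleftrightarrow> (\<forall>\<alpha>\<in>A. v \<alpha> = 0)"
      unfolding val[OF v] using A nonneg[OF v] by (intro sum_nonneg_eq_0_iff) auto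
    also have "\<dots> \<longleftrightarrow> v \<in> W.face K"
    proof
      assume zero: "\<forall>\<alpha>\<in>A. v \<alpha> = 0"
      have "v \<alpha> \<ge> 0" if \<alpha>: "\<alpha> \<in> \<Phi>" "w \<alpha> > 0" for \<alpha>
      proof (cases "\<alpha> \<in> U.pos")
        case False
        then have "- \<alpha> \<in> A" using U.root_pos_or_neg[OF \<alpha>(1)] \<alpha> neg by (auto simp: A_def)
        then show ?thesis using zero neg \<alpha> by force
      qed (rule vpos)
      moreover have "v \<alpha> = 0" if "\<alpha> \<in> K" for \<alpha>
      proof -
        have \<alpha>: "\<alpha> \<in> \<Phi>" using that K_roots by blast
        then have "\<alpha> \<in> A \<or> - \<alpha> \<in> A" using U.root_pos_or_neg[OF \<alpha>] that by (auto simp: A_def)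
        then show ?thesis using zero neg[OF \<alpha>] by force
      qed
      ultimately show "v \<in> W.face K"
        using vV by (auto simp: W.face_def closed_chamber_def)
    next
      assume vK: "v \<in> W.face K"
      show "\<forall>\<alpha>\<in>A. v \<alpha> = 0"
      proof
        fix \<alpha> assume \<alpha>A: "\<alpha> \<in> A"
        then have \<alpha>: "\<alpha> \<in> \<Phi>" "\<alpha> \<in> U.pos" using A by (auto simp: A_def)
        consider "w \<alpha> < 0" | "\<alpha> \<in> K" | "- \<alpha> \<in> K" using \<alpha>A by (auto simp: A_def)
        then show "v \<alpha> = 0"
        proof cases
          case 1
          then have "v (- \<alpha>) \<ge> 0"
            using vK uminus_root[OF \<alpha>(1)] neg[OF \<alpha>(1)] by (auto simp: W.face_def closed_chamber_def)
          then show ?thesis using vpos[OF \<alpha>(2)] neg[OF \<alpha>(1)] by simp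
        qed (use vK neg[OF \<alpha>(1)] in \<open>auto simp: W.face_def\<close>)
      qed
    qed
    finally show ?thesis .
  qed
  then have "U.face J \<inter> W.face K = {v \<in> U.face J. v (\<Sum>\<alpha>\<in>A. \<alpha>) = 0}" by blast
  moreover have "\<forall>v\<in>U.face J. v (\<Sum>\<alpha>\<in>A. \<alpha>) \<ge> 0"
    using nonneg by (auto simp: val intro!: sum_nonneg)
  moreover have "(\<Sum>\<alpha>\<in>A. \<alpha>) \<in> int_span \<Phi>"
    using A root_int_span by (intro int_span_sum) auto
  ultimately show ?thesis
    unfolding cone_face_def by (intro bexI[of _ "\<Sum>\<alpha>\<in>A. \<alpha>"]) simp_all
qed

lemma fan_toric_root: "fan (root_lattice \<Phi>) (snd (toric_root \<Phi>))"
  unfolding fan_def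
proof (intro conjI ballI allI impI)
  have "snd (toric_root \<Phi>) \<subseteq>
      (\<lambda>(A, J). {v \<in> V. (\<forall>\<alpha>\<in>A. v \<alpha> \<ge> 0) \<and> (\<forall>\<alpha>\<in>J. v \<alpha> = 0)}) ` (Pow \<Phi> \<times> Pow \<Phi>)"
  proof
    fix \<tau> assume "\<tau> \<in> snd (toric_root \<Phi>)"
    then obtain u J where u: "regular_functional \<Phi> u" and J: "J \<subseteq> regular_functional.simple \<Phi> u"
      and \<tau>: "\<tau> = regular_functional.face \<Phi> u J" by (rule fan_coneE)
    interpret U: regular_functional \<Phi> u by (rule u)
    show "\<tau> \<in> (\<lambda>(A, J). {v \<in> V. (\<forall>\<alpha>\<in>A. v \<alpha> \<ge> 0) \<and> (\<forall>\<alpha>\<in>J. v \<alpha> = 0)}) ` (Pow \<Phi> \<times> Pow \<Phi>)"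
      using J U.pos_roots U.simple_roots
      by (intro image_eqI[of _ _ "(U.pos, J)"]) (auto simp: \<tau> U.face_def U.chamber_eq)
  qed
  then show "finite (snd (toric_root \<Phi>))"
    by (rule finite_subset) (simp add: finite_roots)
  obtain u where "regular_functional \<Phi> u" using regular_functional_exists by blast
  then show "snd (toric_root \<Phi>) \<noteq> {}"
    using regular_functional.face_in_fan[of \<Phi> u "{}"] by auto
next
  fix \<sigma> assume "\<sigma> \<in> snd (toric_root \<Phi>)"
  then obtain u J where u: "regular_functional \<Phi> u" and J: "J \<subseteq> regular_functional.simple \<Phi> u"
    and \<sigma>: "\<sigma> = regular_functional.face \<Phi> u J" by (rule fan_coneE)
  interpret U: regular_functional \<Phi> u by (rule u)
  show "rational_cone (root_lattice \<Phi>) \<sigma>"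
    unfolding rational_cone_def \<sigma> U.face_eq_cone_gen[OF J]
    using U.finite_simple U.coweight_int_dual by (intro exI[of _ "U.coweight ` (U.simple - J)"]) auto
  show "strongly_convex \<sigma>"
    unfolding strongly_convex_def
  proof (intro ballI impI)
    fix v assume v: "v \<in> \<sigma>" "(\<lambda>x. - v x) \<in> \<sigma>"
    have vV: "v \<in> V" using v U.face_V by (auto simp: \<sigma>)
    have "v a = 0" if "a \<in> U.simple" for a
      using v that by (force simp: \<sigma> U.face_def U.chamber_eq_simple)
    then show "v = (\<lambda>x. 0)"
      using U.coweight_expansion[OF vV] by (intro ext) (metis (no_types, lifting) mult_zero_left sum.neutral)
  qed
  show "\<tau> \<in> snd (toric_root \<Phi>)" if "cone_face (root_lattice \<Phi>) \<tau> \<sigma>" for \<tau>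
  proof -
    have "cone_face (root_lattice \<Phi>) \<tau> (U.face J)" using that by (simp add: \<sigma>)
    then obtain K where "K \<subseteq> U.simple" "\<tau> = U.face K"
      using J by (rule U.cone_face_faceD)
    then show ?thesis using U.face_in_fan by simp
  qed
  fix \<tau> assume "\<tau> \<in> snd (toric_root \<Phi>)"
  then obtain w K where w: "regular_functional \<Phi> w" and K: "K \<subseteq> regular_functional.simple \<Phi> w"
    and \<tau>: "\<tau> = regular_functional.face \<Phi> w K" by (rule fan_coneE)
  show "cone_face (root_lattice \<Phi>) (\<sigma> \<inter> \<tau>) \<sigma>"
    unfolding \<sigma> \<tau> by (rule face_Int_face[OF u J w K])
  show "cone_face (root_lattice \<Phi>) (\<sigma> \<inter> \<tau>) \<tau>"
    unfolding \<sigma> \<tau> by (subst Int_commute) (rule face_Int_face[OF w K u J])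
qed

lemma smooth_toric_root: "smooth_fan (root_lattice \<Phi>) (snd (toric_root \<Phi>))"
  unfolding smooth_fan_def
proof (intro conjI ballI fan_toric_root)
  fix \<sigma> assume "\<sigma> \<in> snd (toric_root \<Phi>)"
  then obtain u J where u: "regular_functional \<Phi> u" and J: "J \<subseteq> regular_functional.simple \<Phi> u"
    and \<sigma>: "\<sigma> = regular_functional.face \<Phi> u J" by (rule fan_coneE)
  interpret U: regular_functional \<Phi> u by (rule u)
  show "\<exists>B S. int_dual_basis (root_lattice \<Phi>) B \<and> S \<subseteq> B \<and> \<sigma> = cone_gen S"
    unfolding \<sigma> U.face_eq_cone_gen[OF J] using U.coweight_basis
    by (intro exI[of _ "U.coweight ` U.simple"] exI[of _ "U.coweight ` (U.simple - J)"]) auto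
qed

lemma complete_toric_root: "complete_fan (root_lattice \<Phi>) (snd (toric_root \<Phi>))"
  unfolding complete_fan_def
proof (intro conjI fan_toric_root equalityI subsetI)
  fix v assume "v \<in> \<Union>(snd (toric_root \<Phi>))"
  then show "v \<in> V" using fan_subset_real_dual[OF fan_toric_root] by blast
next
  fix v assume "v \<in> V"
  then obtain u where u: "regular_functional \<Phi> u" and v: "v \<in> closed_chamber \<Phi> u"
    using in_some_chamber by blast
  interpret U: regular_functional \<Phi> u by (rule u)
  show "v \<in> \<Union>(snd (toric_root \<Phi>))"
    using v U.face_in_fan[of "{}"] by (auto simp: U.face_empty)
qed

text \<open>A cone may lie in several chambers; any of them may provide the local generator \<open>d \<tau>\<close>, since all give the same
values on \<open>\<tau>\<close>.  For ampleness the section attached to a chamber is non-zero exactly on the faces of that chamber.\<close>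

lemma projective_toric_root: "projective_fan (root_lattice \<Phi>) (snd (toric_root \<Phi>))"
proof -
  let ?\<Sigma> = "snd (toric_root \<Phi>)"
  define d where "d \<tau> = (SOME m. \<exists>u. regular_functional \<Phi> u \<and> \<tau> \<subseteq> closed_chamber \<Phi> u \<and>
      m = regular_functional.divisor \<Phi> u)" for \<tau>
  have d: "d \<tau> \<in> int_span \<Phi>" "\<forall>v\<in>\<tau>. v (d \<tau>) = - (\<Sum>\<alpha>\<in>\<Phi>. \<bar>v \<alpha>\<bar>) / 2" if "\<tau> \<in> ?\<Sigma>" for \<tau>
  proof -
    have "\<exists>m u. regular_functional \<Phi> u \<and> \<tau> \<subseteq> closed_chamber \<Phi> u \<and> m = regular_functional.divisor \<Phi> u"
      using that by (elim fan_coneE) (auto simp: regular_functional.face_def)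
    then have "\<exists>u. regular_functional \<Phi> u \<and> \<tau> \<subseteq> closed_chamber \<Phi> u \<and> d \<tau> = regular_functional.divisor \<Phi> u"
      unfolding d_def by (rule someI_ex)
    then obtain u where u: "regular_functional \<Phi> u" "\<tau> \<subseteq> closed_chamber \<Phi> u"
      "d \<tau> = regular_functional.divisor \<Phi> u" by blast
    interpret U: regular_functional \<Phi> u by (rule u)
    show "d \<tau> \<in> int_span \<Phi>" unfolding u(3) by (rule U.divisor_int_span)
    show "\<forall>v\<in>\<tau>. v (d \<tau>) = - (\<Sum>\<alpha>\<in>\<Phi>. \<bar>v \<alpha>\<bar>) / 2"
      unfolding u(3) using u(2) U.divisor_eq_iff by (auto simp: closed_chamber_def)
  qed
  have "invariant_cartier (root_lattice \<Phi>) ?\<Sigma> d"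
    unfolding invariant_cartier_def
  proof (intro conjI ballI impI)
    fix \<sigma> \<tau> v assume "\<sigma> \<in> ?\<Sigma>" "\<tau> \<in> ?\<Sigma>" "cone_face (root_lattice \<Phi>) \<tau> \<sigma>" "v \<in> \<tau>"
    then show "v (d \<sigma>) = v (d \<tau>)"
      using d(2)[of \<sigma>] d(2)[of \<tau>] cone_face_subset by fastforce
  qed (use d(1) in auto)
  moreover have "ample (root_lattice \<Phi>) ?\<Sigma> d"
    unfolding ample_def
  proof
    fix \<sigma> assume \<sigma>\<Sigma>: "\<sigma> \<in> ?\<Sigma>"
    then obtain u J where u: "regular_functional \<Phi> u" and J: "J \<subseteq> regular_functional.simple \<Phi> u"
      and \<sigma>: "\<sigma> = regular_functional.face \<Phi> u J" by (rule fan_coneE)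
    interpret U: regular_functional \<Phi> u by (rule u)
    let ?m = U.divisor and ?C = "closed_chamber \<Phi> u"
    have sub: "\<tau> \<subseteq> V" if "\<tau> \<in> ?\<Sigma>" for \<tau>
      using fan_subset_real_dual[OF fan_toric_root that] .
    have C: "?C \<in> ?\<Sigma>" using U.face_in_fan[of "{}"] by (simp add: U.face_empty)
    have sec: "invariant_section (root_lattice \<Phi>) ?\<Sigma> d 1 ?m"
      unfolding invariant_section_def
    proof (intro conjI ballI)
      fix \<tau> v assume "\<tau> \<in> ?\<Sigma>" "v \<in> \<tau>"
      then show "real 1 * v (d \<tau>) \<le> v ?m"
        using d(2)[of \<tau>] U.divisor_ge[of v] sub by auto
    qed (simp add: U.divisor_int_span)
    have nonv: "nonvanishing ?\<Sigma> d 1 ?m = {\<tau> \<in> ?\<Sigma>. \<tau> \<subseteq> ?C}"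
    proof -
      have "(\<forall>v\<in>\<tau>. v ?m = real 1 * v (d \<tau>)) \<longleftrightarrow> \<tau> \<subseteq> ?C" if "\<tau> \<in> ?\<Sigma>" for \<tau>
      proof -
        have "v ?m = real 1 * v (d \<tau>) \<longleftrightarrow> v \<in> ?C" if v: "v \<in> \<tau>" for v
          using d(2)[OF \<open>\<tau> \<in> ?\<Sigma>\<close>] U.divisor_eq_iff[of v] sub[OF \<open>\<tau> \<in> ?\<Sigma>\<close>] v
          by (simp add: subset_iff)
        then show ?thesis by blast
      qed
      then show ?thesis by (auto simp: nonvanishing_def)
    qed
    also have "\<dots> = {\<tau>. cone_face (root_lattice \<Phi>) \<tau> ?C}"
    proof (intro equalityI subsetI CollectI)
      fix \<tau> assume "\<tau> \<in> {\<tau> \<in> ?\<Sigma>. \<tau> \<subseteq> ?C}"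
      then have \<tau>: "\<tau> \<in> ?\<Sigma>" "?C \<inter> \<tau> = \<tau>" by auto
      have "cone_face (root_lattice \<Phi>) (?C \<inter> \<tau>) ?C"
        using fan_toric_root C \<tau>(1) unfolding fan_def by blast
      then show "cone_face (root_lattice \<Phi>) \<tau> ?C" unfolding \<tau>(2) .
    next
      fix \<tau> assume "\<tau> \<in> {\<tau>. cone_face (root_lattice \<Phi>) \<tau> ?C}"
      then show "\<tau> \<in> ?\<Sigma> \<and> \<tau> \<subseteq> ?C"
        using U.chamber_in_chambers cone_face_subset by (auto simp: mem_toric_root)
    qed
    finally have "affine_subfan (root_lattice \<Phi>) ?\<Sigma> (nonvanishing ?\<Sigma> d 1 ?m)"
      using C by (auto simp: affine_subfan_def)
    moreover have "\<sigma> \<in> nonvanishing ?\<Sigma> d 1 ?m"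
      unfolding nonv using \<sigma>\<Sigma> by (auto simp: \<sigma> U.face_def)
    ultimately show "\<exists>n m. 1 \<le> n \<and> invariant_section (root_lattice \<Phi>) ?\<Sigma> d n m \<and>
        \<sigma> \<in> nonvanishing ?\<Sigma> d n m \<and> affine_subfan (root_lattice \<Phi>) ?\<Sigma> (nonvanishing ?\<Sigma> d n m)"
      using sec by (intro exI[of _ "1 :: nat"] exI[of _ ?m]) simp
  qed
  ultimately show ?thesis
    unfolding projective_fan_def using complete_toric_root by blast
qed

text \<open>Chambers are defined from \<open>\<Phi>\<close> alone, so pulling back along an automorphism that permutes \<open>\<Phi>\<close> permutes
the chambers: the chamber of \<open>u\<close> becomes the chamber of the pullback of \<open>u\<close>.\<close>

lemma toric_root_invariant:
  assumes g: "g \<in> iso (root_lattice \<Phi>) (root_lattice \<Phi>)" and roots: "g ` \<Phi> = \<Phi>"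
    and \<sigma>: "\<sigma> \<in> snd (toric_root \<Phi>)"
  shows "pull_dual (root_lattice \<Phi>) g ` \<sigma> \<in> snd (toric_root \<Phi>)"
proof -
  interpret L: lattice_iso "root_lattice \<Phi>" "root_lattice \<Phi>" g
    using g by unfold_locales (auto intro: int_span_add)
  obtain u where u: "u \<in> V" "\<forall>\<alpha>\<in>\<Phi>. u \<alpha> \<noteq> 0"
    and face: "cone_face (root_lattice \<Phi>) \<sigma> (closed_chamber \<Phi> u)"
    using \<sigma> by (auto simp: mem_toric_root closed_chambers_def)
  have val: "L.pull v \<alpha> = v (g \<alpha>)" if "\<alpha> \<in> \<Phi>" for v \<alpha>
    using that root_int_span by (simp add: pull_dual_apply)
  have all: "(\<forall>\<alpha>\<in>\<Phi>. P (g \<alpha>)) \<longleftrightarrow> (\<forall>\<alpha>\<in>\<Phi>. P \<alpha>)" for P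
  proof -
    have "(\<forall>\<alpha>\<in>\<Phi>. P (g \<alpha>)) \<longleftrightarrow> (\<forall>\<alpha>\<in>g ` \<Phi>. P \<alpha>)" by blast
    then show ?thesis unfolding roots .
  qed
  have iff: "L.pull v \<in> closed_chamber \<Phi> (L.pull u) \<longleftrightarrow> v \<in> closed_chamber \<Phi> u" if "v \<in> V" for v
    using that L.pull_real_dual[OF that] all[of "\<lambda>\<alpha>. u \<alpha> > 0 \<longrightarrow> v \<alpha> \<ge> 0"]
    by (simp add: closed_chamber_def val cong: ball_cong)
  have "L.pull ` closed_chamber \<Phi> u = closed_chamber \<Phi> (L.pull u)"
  proof (intro equalityI subsetI)
    fix w assume w: "w \<in> closed_chamber \<Phi> (L.pull u)"
    then have "w \<in> V" by (simp add: closed_chamber_def)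
    then have "L.push w \<in> closed_chamber \<Phi> u" "w = L.pull (L.push w)"
      using w iff[of "L.push w"] L.push_real_dual by auto
    then show "w \<in> L.pull ` closed_chamber \<Phi> u" by blast
  qed (use iff in \<open>auto simp: closed_chamber_def\<close>)
  moreover have "\<forall>\<alpha>\<in>\<Phi>. L.pull u \<alpha> \<noteq> 0"
    using u(2) roots val by auto
  ultimately have "L.pull ` closed_chamber \<Phi> u \<in> closed_chambers \<Phi>"
    using L.pull_real_dual[OF u(1)] unfolding closed_chambers_def by blast
  then show ?thesis
    unfolding mem_toric_root using L.pull_cone_face[OF face] by blast
qed

end

lemma linear_image_int_span:
  assumes "linear g" shows "g ` int_span S = int_span (g ` S)"
proof -
  interpret linear g by fact
  interpret h: Modules.module_hom "\<lambda>(n::int) x. real_of_int n *\<^sub>R x" "\<lambda>(n::int) x. real_of_int n *\<^sub>R x" g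
    by unfold_locales (simp_all add: add scale)
  show ?thesis unfolding int_span_def by (rule h.span_image[symmetric])
qed

lemma int_span_subset_span: "int_span S \<subseteq> span S"
  by (rule int_span_minimal) (auto simp: span_superset span_zero span_add span_scale)

lemma aut_group_iso:
  assumes "h \<in> carrier (aut_group \<Phi>)"
  shows "h \<in> iso (root_lattice \<Phi>) (root_lattice \<Phi>)" "h ` \<Phi> = \<Phi>"
proof -
  have h: "h \<in> linear_auts (span \<Phi>)" "h ` \<Phi> = \<Phi>"
    using assms by (auto simp: aut_group_def)
  then show "h ` \<Phi> = \<Phi>" by simp
  obtain g where g: "linear g" "\<forall>x\<in>span \<Phi>. h x = g x"
    using h by (auto simp: linear_auts_def)
  have hg: "h x = g x" if "x \<in> int_span \<Phi>" for x
    using that int_span_subset_span g by blast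
  have "g ` \<Phi> = \<Phi>" using h(2) hg int_span_base by (metis image_cong)
  then have "h ` int_span \<Phi> = int_span \<Phi>"
    using linear_image_int_span[OF g(1), of \<Phi>] hg by (metis image_cong)
  moreover have "inj_on h (int_span \<Phi>)"
    using h(1) int_span_subset_span by (auto simp: linear_auts_def Bij_def bij_betw_def intro: inj_on_subset)
  ultimately have "bij_betw h (int_span \<Phi>) (int_span \<Phi>)" by (simp add: bij_betw_def)
  moreover have "h (x + y) = h x + h y" if "x \<in> int_span \<Phi>" "y \<in> int_span \<Phi>" for x y
    using that hg[of x] hg[of y] hg[of "x + y"] int_span_add[of x \<Phi> y] linear_add[OF g(1), of x y] by simp
  ultimately show "h \<in> iso (root_lattice \<Phi>) (root_lattice \<Phi>)"
    by (auto simp: iso_def hom_def bij_betw_def)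
qed

lemma demazure_model_toric_root:
  assumes "root_system \<Phi>"
    and closed: "\<And>x y. x \<in> carrier (lat P) \<Longrightarrow> y \<in> carrier (lat P) \<Longrightarrow>
      x \<otimes>\<^bsub>lat P\<^esub> y \<in> carrier (lat P)"
    and grp: "group (grp P)"
    and act: "\<And>g x. g \<in> carrier (grp P) \<Longrightarrow> x \<in> carrier (lat P) \<Longrightarrow> act P g x \<in> carrier (lat P)"
    and iso: "glattice_iso P (root_glattice \<Phi>)"
  shows "demazure_model P (toric_root \<Phi>)"
proof -
  interpret roots \<Phi> by unfold_locales fact
  have "demazure_model P (lat (root_glattice \<Phi>), snd (toric_root \<Phi>))"
  proof (rule demazure_model_transport[OF closed grp act iso])
    show "pull_dual (lat (root_glattice \<Phi>)) (act (root_glattice \<Phi>) h) ` \<sigma> \<in> snd (toric_root \<Phi>)"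
      if "h \<in> carrier (grp (root_glattice \<Phi>))" "\<sigma> \<in> snd (toric_root \<Phi>)" for h \<sigma>
      using that toric_root_invariant aut_group_iso[of h \<Phi>] by (simp add: root_glattice_def)
  qed (simp_all add: root_glattice_def smooth_toric_root projective_toric_root)
  then show ?thesis
    by (simp add: root_glattice_def toric_root_def)
qed

section \<open>Products of root systems\<close>

lemma int_span_root_prod: "int_span (\<Phi> \<times>\<^sub>r \<Psi>) = int_span \<Phi> \<times> int_span \<Psi>"
proof
  show "int_span (\<Phi> \<times>\<^sub>r \<Psi>) \<subseteq> int_span \<Phi> \<times> int_span \<Psi>"
    by (rule int_span_minimal)
      (auto simp: root_prod_def zero_prod_def intro: int_span_base int_span_zero int_span_add int_span_scale)
  have l: "(\<lambda>x. (x, 0)) ` int_span \<Phi> = int_span ((\<lambda>x. (x, 0 :: 'b)) ` \<Phi>)"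
    by (rule linear_image_int_span) (simp add: linear_iff)
  have r: "(\<lambda>y. (0, y)) ` int_span \<Psi> = int_span ((\<lambda>y. (0 :: 'a, y)) ` \<Psi>)"
    by (rule linear_image_int_span) (simp add: linear_iff)
  have sub: "int_span ((\<lambda>x. (x, 0)) ` \<Phi>) \<subseteq> int_span (\<Phi> \<times>\<^sub>r \<Psi>)"
    "int_span ((\<lambda>y. (0, y)) ` \<Psi>) \<subseteq> int_span (\<Phi> \<times>\<^sub>r \<Psi>)"
    by (intro int_span_mono subsetI int_span_base, force simp: root_prod_def)+
  show "int_span \<Phi> \<times> int_span \<Psi> \<subseteq> int_span (\<Phi> \<times>\<^sub>r \<Psi>)"
  proof clarify
    fix x y assume "x \<in> int_span \<Phi>" "y \<in> int_span \<Psi>"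
    then have "(x, 0) \<in> int_span (\<Phi> \<times>\<^sub>r \<Psi>)" "(0, y) \<in> int_span (\<Phi> \<times>\<^sub>r \<Psi>)"
      using sub l r by blast+
    then show "(x, y) \<in> int_span (\<Phi> \<times>\<^sub>r \<Psi>)"
      using int_span_add by fastforce
  qed
qed

lemma root_lattice_prod: "root_lattice (\<Phi> \<times>\<^sub>r \<Psi>) = root_lattice \<Phi> \<times>\<times> root_lattice \<Psi>"
proof -
  have "(+) = (\<lambda>(x, y) (x', y'). (x + x' :: 'a, y + y' :: 'b))"
    by (auto simp: fun_eq_iff)
  then show ?thesis
    by (simp add: root_lattice_def additive_monoid_def DirProd_def int_span_root_prod zero_prod_def)
qed

definition dual_sum ::
  "'m monoid \<Rightarrow> 'n monoid \<Rightarrow> ('m \<Rightarrow> real) \<Rightarrow> ('n \<Rightarrow> real) \<Rightarrow> 'm \<times> 'n \<Rightarrow> real" where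
  "dual_sum M N u v = (\<lambda>(x, y). if x \<in> carrier M \<and> y \<in> carrier N then u x + v y else 0)"

lemma prod_cone_image: "prod_cone M N \<sigma> \<tau> = {dual_sum M N u v | u v. u \<in> \<sigma> \<and> v \<in> \<tau>}"
  by (simp add: prod_cone_def dual_sum_def)

abbreviation "root_dual_sum \<Phi> \<Psi> \<equiv> dual_sum (root_lattice \<Phi>) (root_lattice \<Psi>)"
abbreviation "root_prod_cone \<Phi> \<Psi> \<equiv> prod_cone (root_lattice \<Phi>) (root_lattice \<Psi>)"

context
  fixes \<Phi> :: "'a::euclidean_space set" and \<Psi> :: "'b::euclidean_space set"
begin

lemma dual_sum_apply: "x \<in> int_span \<Phi> \<Longrightarrow> y \<in> int_span \<Psi> \<Longrightarrow> root_dual_sum \<Phi> \<Psi> u v (x, y) = u x + v y"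
  by (simp add: dual_sum_def)

lemma dual_zero: "u \<in> real_dual (root_lattice S) \<Longrightarrow> u 0 = 0"
  using real_dual_mult[of u "root_lattice S" 0 0] int_span_zero[of S] by simp

lemma dual_sum_real_dual:
  "u \<in> real_dual (root_lattice \<Phi>) \<Longrightarrow> v \<in> real_dual (root_lattice \<Psi>) \<Longrightarrow> root_dual_sum \<Phi> \<Psi> u v \<in> real_dual (root_lattice (\<Phi> \<times>\<^sub>r \<Psi>))"
  by (auto simp: dual_sum_def real_dual_def int_span_root_prod int_span_add)

lemma dual_sum_cases:
  assumes w: "w \<in> real_dual (root_lattice (\<Phi> \<times>\<^sub>r \<Psi>))"
  obtains u v where "u \<in> real_dual (root_lattice \<Phi>)" "v \<in> real_dual (root_lattice \<Psi>)" "w = root_dual_sum \<Phi> \<Psi> u v"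
proof
  have add: "w (x + x', y + y') = w (x, y) + w (x', y')"
    if "x \<in> int_span \<Phi>" "x' \<in> int_span \<Phi>" "y \<in> int_span \<Psi>" "y' \<in> int_span \<Psi>" for x x' y y'
    using real_dual_mult[OF w, of "(x, y)" "(x', y')"] that by (simp add: int_span_root_prod)
  have out: "w (x, y) = 0" if "x \<notin> int_span \<Phi> \<or> y \<notin> int_span \<Psi>" for x y
    using real_dual_outside[OF w, of "(x, y)"] that by (auto simp: int_span_root_prod)
  show "(\<lambda>x. w (x, 0)) \<in> real_dual (root_lattice \<Phi>)"
    using add[of _ _ 0 0] out by (auto simp: real_dual_def int_span_zero)
  show "(\<lambda>y. w (0, y)) \<in> real_dual (root_lattice \<Psi>)"
    using add[of 0 0] out by (auto simp: real_dual_def int_span_zero)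
  show "w = root_dual_sum \<Phi> \<Psi> (\<lambda>x. w (x, 0)) (\<lambda>y. w (0, y))"
  proof (rule ext)
    fix z :: "'a \<times> 'b"
    obtain x y where z: "z = (x, y)" by (cases z)
    show "w z = root_dual_sum \<Phi> \<Psi> (\<lambda>x. w (x, 0)) (\<lambda>y. w (0, y)) z"
      using add[of x 0 0 y] out[of x y] by (auto simp: z dual_sum_def int_span_zero)
  qed
qed

lemma dual_sum_roots:
  assumes "u \<in> real_dual (root_lattice \<Phi>)" "v \<in> real_dual (root_lattice \<Psi>)"
  shows "\<alpha> \<in> \<Phi> \<Longrightarrow> root_dual_sum \<Phi> \<Psi> u v (\<alpha>, 0) = u \<alpha>" "\<beta> \<in> \<Psi> \<Longrightarrow> root_dual_sum \<Phi> \<Psi> u v (0, \<beta>) = v \<beta>"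
  using dual_zero[OF assms(1)] dual_zero[OF assms(2)]
  by (auto simp: dual_sum_apply int_span_zero int_span_base)

lemma ball_root_prod: "(\<forall>\<gamma>\<in>\<Phi> \<times>\<^sub>r \<Psi>. P \<gamma>) \<longleftrightarrow> (\<forall>\<alpha>\<in>\<Phi>. P (\<alpha>, 0)) \<and> (\<forall>\<beta>\<in>\<Psi>. P (0, \<beta>))"
  by (auto simp: root_prod_def)

lemma closed_chamber_prod:
  assumes u: "u \<in> real_dual (root_lattice \<Phi>)" and v: "v \<in> real_dual (root_lattice \<Psi>)"
  shows "closed_chamber (\<Phi> \<times>\<^sub>r \<Psi>) (root_dual_sum \<Phi> \<Psi> u v) =
    root_prod_cone \<Phi> \<Psi> (closed_chamber \<Phi> u) (closed_chamber \<Psi> v)"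
proof -
  have iff: "root_dual_sum \<Phi> \<Psi> u' v' \<in> closed_chamber (\<Phi> \<times>\<^sub>r \<Psi>) (root_dual_sum \<Phi> \<Psi> u v) \<longleftrightarrow>
      u' \<in> closed_chamber \<Phi> u \<and> v' \<in> closed_chamber \<Psi> v"
    if "u' \<in> real_dual (root_lattice \<Phi>)" "v' \<in> real_dual (root_lattice \<Psi>)" for u' v'
    using that dual_sum_real_dual[OF that]
    by (simp add: closed_chamber_def ball_root_prod dual_sum_roots[OF u v] dual_sum_roots[OF that])
  show ?thesis
  proof (intro equalityI subsetI)
    fix w assume w: "w \<in> closed_chamber (\<Phi> \<times>\<^sub>r \<Psi>) (root_dual_sum \<Phi> \<Psi> u v)"
    then have "w \<in> real_dual (root_lattice (\<Phi> \<times>\<^sub>r \<Psi>))" by (simp add: closed_chamber_def)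
    then obtain u' v' where "u' \<in> real_dual (root_lattice \<Phi>)" "v' \<in> real_dual (root_lattice \<Psi>)" "w = root_dual_sum \<Phi> \<Psi> u' v'"
      by (rule dual_sum_cases)
    then show "w \<in> root_prod_cone \<Phi> \<Psi> (closed_chamber \<Phi> u) (closed_chamber \<Psi> v)"
      using w iff unfolding prod_cone_image by blast
  next
    fix w assume "w \<in> root_prod_cone \<Phi> \<Psi> (closed_chamber \<Phi> u) (closed_chamber \<Psi> v)"
    then obtain u' v' where "u' \<in> closed_chamber \<Phi> u" "v' \<in> closed_chamber \<Psi> v" "w = root_dual_sum \<Phi> \<Psi> u' v'"
      unfolding prod_cone_image by blast
    then show "w \<in> closed_chamber (\<Phi> \<times>\<^sub>r \<Psi>) (root_dual_sum \<Phi> \<Psi> u v)"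
      using iff[of u' v'] by (simp add: closed_chamber_def)
  qed
qed

lemma closed_chambers_prod:
  "closed_chambers (\<Phi> \<times>\<^sub>r \<Psi>) =
    {root_prod_cone \<Phi> \<Psi> \<sigma> \<tau> | \<sigma> \<tau>. \<sigma> \<in> closed_chambers \<Phi> \<and> \<tau> \<in> closed_chambers \<Psi>}"
proof (intro equalityI subsetI)
  fix \<rho> assume "\<rho> \<in> closed_chambers (\<Phi> \<times>\<^sub>r \<Psi>)"
  then obtain w where w: "w \<in> real_dual (root_lattice (\<Phi> \<times>\<^sub>r \<Psi>))" "\<forall>\<gamma>\<in>\<Phi> \<times>\<^sub>r \<Psi>. w \<gamma> \<noteq> 0"
    and \<rho>: "\<rho> = closed_chamber (\<Phi> \<times>\<^sub>r \<Psi>) w" by (auto simp: closed_chambers_def)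
  obtain u v where uv: "u \<in> real_dual (root_lattice \<Phi>)" "v \<in> real_dual (root_lattice \<Psi>)" "w = root_dual_sum \<Phi> \<Psi> u v"
    using w(1) by (rule dual_sum_cases)
  have "(\<forall>\<alpha>\<in>\<Phi>. u \<alpha> \<noteq> 0) \<and> (\<forall>\<beta>\<in>\<Psi>. v \<beta> \<noteq> 0)"
    using w(2) by (simp add: ball_root_prod uv(3) dual_sum_roots[OF uv(1,2)])
  then have "closed_chamber \<Phi> u \<in> closed_chambers \<Phi>" "closed_chamber \<Psi> v \<in> closed_chambers \<Psi>"
    using uv by (auto simp: closed_chambers_def)
  then show "\<rho> \<in> {root_prod_cone \<Phi> \<Psi> \<sigma> \<tau> | \<sigma> \<tau>. \<sigma> \<in> closed_chambers \<Phi> \<and> \<tau> \<in> closed_chambers \<Psi>}"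
    unfolding \<rho> uv(3) closed_chamber_prod[OF uv(1,2)] by blast
next
  fix \<rho> assume "\<rho> \<in> {root_prod_cone \<Phi> \<Psi> \<sigma> \<tau> | \<sigma> \<tau>. \<sigma> \<in> closed_chambers \<Phi> \<and> \<tau> \<in> closed_chambers \<Psi>}"
  then obtain u v where u: "u \<in> real_dual (root_lattice \<Phi>)" "\<forall>\<alpha>\<in>\<Phi>. u \<alpha> \<noteq> 0" and v: "v \<in> real_dual (root_lattice \<Psi>)" "\<forall>\<beta>\<in>\<Psi>. v \<beta> \<noteq> 0"
    and \<rho>: "\<rho> = root_prod_cone \<Phi> \<Psi> (closed_chamber \<Phi> u) (closed_chamber \<Psi> v)"
    by (auto simp: closed_chambers_def)
  have "\<forall>\<gamma>\<in>\<Phi> \<times>\<^sub>r \<Psi>. root_dual_sum \<Phi> \<Psi> u v \<gamma> \<noteq> 0"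
    using u v by (simp add: ball_root_prod dual_sum_roots)
  then show "\<rho> \<in> closed_chambers (\<Phi> \<times>\<^sub>r \<Psi>)"
    unfolding \<rho> closed_chamber_prod[OF u(1) v(1), symmetric] closed_chambers_def
    using dual_sum_real_dual[OF u(1) v(1)] by blast
qed

text \<open>A point \<open>(x, y)\<close> that is non-negative on the product of the cones is so on each factor, because \<open>0\<close> lies in both
cones.  A sum of non-negative values vanishes iff both summands do.\<close>

lemma cone_face_prod:
  assumes \<sigma>: "\<sigma> \<subseteq> real_dual (root_lattice \<Phi>)" "(\<lambda>x. 0) \<in> \<sigma>" and \<tau>: "\<tau> \<subseteq> real_dual (root_lattice \<Psi>)" "(\<lambda>y. 0) \<in> \<tau>"
  shows "cone_face (root_lattice (\<Phi> \<times>\<^sub>r \<Psi>)) \<rho> (root_prod_cone \<Phi> \<Psi> \<sigma> \<tau>) \<longleftrightarrow>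
    (\<exists>\<sigma>' \<tau>'. cone_face (root_lattice \<Phi>) \<sigma>' \<sigma> \<and> cone_face (root_lattice \<Psi>) \<tau>' \<tau> \<and> \<rho> = root_prod_cone \<Phi> \<Psi> \<sigma>' \<tau>')"
proof
  assume "cone_face (root_lattice (\<Phi> \<times>\<^sub>r \<Psi>)) \<rho> (root_prod_cone \<Phi> \<Psi> \<sigma> \<tau>)"
  then obtain x y where x: "x \<in> int_span \<Phi>" and y: "y \<in> int_span \<Psi>"
    and nonneg: "\<And>u v. u \<in> \<sigma> \<Longrightarrow> v \<in> \<tau> \<Longrightarrow> u x + v y \<ge> 0"
    and \<rho>: "\<rho> = {w \<in> root_prod_cone \<Phi> \<Psi> \<sigma> \<tau>. w (x, y) = 0}"
  proof -
    obtain z where z: "z \<in> int_span \<Phi> \<times> int_span \<Psi>" "\<forall>w\<in>root_prod_cone \<Phi> \<Psi> \<sigma> \<tau>. w z \<ge> 0"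
      "\<rho> = {w \<in> root_prod_cone \<Phi> \<Psi> \<sigma> \<tau>. w z = 0}"
      using \<open>cone_face _ _ _\<close> unfolding cone_face_def by (auto simp: int_span_root_prod)
    obtain x y where xy: "z = (x, y)" by (cases z)
    show ?thesis
    proof (rule that)
      fix u v assume "u \<in> \<sigma>" "v \<in> \<tau>"
      then have "root_dual_sum \<Phi> \<Psi> u v \<in> root_prod_cone \<Phi> \<Psi> \<sigma> \<tau>" unfolding prod_cone_image by blast
      then have "root_dual_sum \<Phi> \<Psi> u v (x, y) \<ge> 0" using z(2) xy by blast
      then show "u x + v y \<ge> 0" using z(1) xy by (simp add: dual_sum_apply)
    qed (use z xy in auto)
  qed
  have ux: "u x \<ge> 0" if "u \<in> \<sigma>" for u using nonneg[OF that \<tau>(2)] by simp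
  have vy: "v y \<ge> 0" if "v \<in> \<tau>" for v using nonneg[OF \<sigma>(2) that] by simp
  have "cone_face (root_lattice \<Phi>) {u \<in> \<sigma>. u x = 0} \<sigma>" "cone_face (root_lattice \<Psi>) {v \<in> \<tau>. v y = 0} \<tau>"
    unfolding cone_face_def using x y ux vy by auto
  moreover have "root_dual_sum \<Phi> \<Psi> u v (x, y) = 0 \<longleftrightarrow> u x = 0 \<and> v y = 0" if "u \<in> \<sigma>" "v \<in> \<tau>" for u v
    using ux[OF that(1)] vy[OF that(2)] by (auto simp: dual_sum_apply[OF x y])
  then have "\<rho> = root_prod_cone \<Phi> \<Psi> {u \<in> \<sigma>. u x = 0} {v \<in> \<tau>. v y = 0}"
    unfolding \<rho> prod_cone_image by blast
  ultimately show "\<exists>\<sigma>' \<tau>'. cone_face (root_lattice \<Phi>) \<sigma>' \<sigma> \<and> cone_face (root_lattice \<Psi>) \<tau>' \<tau> \<and> \<rho> = root_prod_cone \<Phi> \<Psi> \<sigma>' \<tau>'"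
    by blast
next
  assume "\<exists>\<sigma>' \<tau>'. cone_face (root_lattice \<Phi>) \<sigma>' \<sigma> \<and> cone_face (root_lattice \<Psi>) \<tau>' \<tau> \<and> \<rho> = root_prod_cone \<Phi> \<Psi> \<sigma>' \<tau>'"
  then obtain x y where x: "x \<in> int_span \<Phi>" and y: "y \<in> int_span \<Psi>"
    and ux: "\<And>u. u \<in> \<sigma> \<Longrightarrow> u x \<ge> 0" and vy: "\<And>v. v \<in> \<tau> \<Longrightarrow> v y \<ge> 0"
    and \<rho>: "\<rho> = root_prod_cone \<Phi> \<Psi> {u \<in> \<sigma>. u x = 0} {v \<in> \<tau>. v y = 0}"
    unfolding cone_face_def by auto
  have "root_dual_sum \<Phi> \<Psi> u v (x, y) = 0 \<longleftrightarrow> u x = 0 \<and> v y = 0" if "u \<in> \<sigma>" "v \<in> \<tau>" for u v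
    using ux[OF that(1)] vy[OF that(2)] by (auto simp: dual_sum_apply[OF x y])
  then have "\<rho> = {w \<in> root_prod_cone \<Phi> \<Psi> \<sigma> \<tau>. w (x, y) = 0}"
    unfolding \<rho> prod_cone_image by blast
  moreover have "\<forall>w\<in>root_prod_cone \<Phi> \<Psi> \<sigma> \<tau>. w (x, y) \<ge> 0"
    using ux vy by (auto simp: prod_cone_image dual_sum_apply[OF x y])
  ultimately show "cone_face (root_lattice (\<Phi> \<times>\<^sub>r \<Psi>)) \<rho> (root_prod_cone \<Phi> \<Psi> \<sigma> \<tau>)"
    unfolding cone_face_def using x y by (intro bexI[of _ "(x, y)"]) (simp_all add: int_span_root_prod)
qed

lemma closed_chambers_basic:
  assumes "\<sigma> \<in> closed_chambers S"
  shows "\<sigma> \<subseteq> real_dual (root_lattice S)" "(\<lambda>x. 0) \<in> \<sigma>"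
  using assms by (auto simp: closed_chambers_def closed_chamber_def real_dual_def)

text \<open>An equality and not only an isomorphism, because the root lattice of the product is the product lattice
on the nose.\<close>

lemma toric_root_prod: "toric_root (\<Phi> \<times>\<^sub>r \<Psi>) = toric_root \<Phi> \<times>\<^sub>t toric_root \<Psi>"
proof (rule prod_eqI)
  show "fst (toric_root (\<Phi> \<times>\<^sub>r \<Psi>)) = fst (toric_root \<Phi> \<times>\<^sub>t toric_root \<Psi>)"
    by (simp add: toric_prod_def root_lattice_prod)
  have "\<rho> \<in> snd (toric_root (\<Phi> \<times>\<^sub>r \<Psi>)) \<longleftrightarrow> (\<exists>\<sigma>\<in>closed_chambers \<Phi>. \<exists>\<tau>\<in>closed_chambers \<Psi>.
      \<exists>\<sigma>' \<tau>'. cone_face (root_lattice \<Phi>) \<sigma>' \<sigma> \<and> cone_face (root_lattice \<Psi>) \<tau>' \<tau> \<and> \<rho> = root_prod_cone \<Phi> \<Psi> \<sigma>' \<tau>')" for \<rho>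
  proof -
    have "\<rho> \<in> snd (toric_root (\<Phi> \<times>\<^sub>r \<Psi>)) \<longleftrightarrow> (\<exists>\<sigma>\<in>closed_chambers \<Phi>. \<exists>\<tau>\<in>closed_chambers \<Psi>.
        cone_face (root_lattice (\<Phi> \<times>\<^sub>r \<Psi>)) \<rho> (root_prod_cone \<Phi> \<Psi> \<sigma> \<tau>))"
      unfolding mem_toric_root closed_chambers_prod by blast
    also have "\<dots> \<longleftrightarrow> (\<exists>\<sigma>\<in>closed_chambers \<Phi>. \<exists>\<tau>\<in>closed_chambers \<Psi>.
        \<exists>\<sigma>' \<tau>'. cone_face (root_lattice \<Phi>) \<sigma>' \<sigma> \<and> cone_face (root_lattice \<Psi>) \<tau>' \<tau> \<and> \<rho> = root_prod_cone \<Phi> \<Psi> \<sigma>' \<tau>')"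
      by (intro bex_cong refl cone_face_prod closed_chambers_basic)
    finally show ?thesis .
  qed
  then show "snd (toric_root (\<Phi> \<times>\<^sub>r \<Psi>)) = snd (toric_root \<Phi> \<times>\<^sub>t toric_root \<Psi>)"
    by (auto simp: toric_prod_def mem_toric_root) blast+
qed

end

lemma span_root_prod: "span (\<Phi> \<times>\<^sub>r \<Psi>) = span \<Phi> \<times> span \<Psi>"
proof
  show "span (\<Phi> \<times>\<^sub>r \<Psi>) \<subseteq> span \<Phi> \<times> span \<Psi>"
    by (rule span_minimal) (auto simp: root_prod_def subspace_Times intro: span_base span_zero)
  have l: "(\<lambda>x. (x, 0)) ` span \<Phi> = span ((\<lambda>x. (x, 0 :: 'b)) ` \<Phi>)"
    by (rule linear_span_image[symmetric]) (simp add: linear_iff)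
  have r: "(\<lambda>y. (0, y)) ` span \<Psi> = span ((\<lambda>y. (0 :: 'a, y)) ` \<Psi>)"
    by (rule linear_span_image[symmetric]) (simp add: linear_iff)
  have sub: "span ((\<lambda>x. (x, 0)) ` \<Phi>) \<subseteq> span (\<Phi> \<times>\<^sub>r \<Psi>)"
    "span ((\<lambda>y. (0, y)) ` \<Psi>) \<subseteq> span (\<Phi> \<times>\<^sub>r \<Psi>)"
    by (intro span_mono, force simp: root_prod_def)+
  show "span \<Phi> \<times> span \<Psi> \<subseteq> span (\<Phi> \<times>\<^sub>r \<Psi>)"
  proof clarify
    fix x y assume "x \<in> span \<Phi>" "y \<in> span \<Psi>"
    then have "(x, 0) \<in> span (\<Phi> \<times>\<^sub>r \<Psi>)" "(0, y) \<in> span (\<Phi> \<times>\<^sub>r \<Psi>)"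
      using sub l r by blast+
    then show "(x, y) \<in> span (\<Phi> \<times>\<^sub>r \<Psi>)"
      using span_add by fastforce
  qed
qed

lemma root_system_prod:
  assumes "root_system \<Phi>" "root_system \<Psi>" shows "root_system (\<Phi> \<times>\<^sub>r \<Psi>)"
proof -
  have cl: "cartan (\<alpha>, 0) (\<beta>, 0) = cartan \<alpha> \<beta>" "cartan (0, \<alpha>') (0, \<beta>') = cartan \<alpha>' \<beta>'"
    "cartan (\<alpha>, 0) (0, \<beta>') = 0" "cartan (0, \<alpha>') (\<beta>, 0) = 0" for \<alpha> \<beta> :: 'a and \<alpha>' \<beta>' :: 'b
    by (simp_all add: cartan_def)
  have "root_reflection \<gamma> \<delta> \<in> \<Phi> \<times>\<^sub>r \<Psi>" if "\<gamma> \<in> \<Phi> \<times>\<^sub>r \<Psi>" "\<delta> \<in> \<Phi> \<times>\<^sub>r \<Psi>" for \<gamma> \<delta>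
    using that assms by (auto simp: root_prod_def root_reflection_def cl root_system_def image_subset_iff)
  moreover have "cartan \<delta> \<gamma> \<in> \<int>" if "\<gamma> \<in> \<Phi> \<times>\<^sub>r \<Psi>" "\<delta> \<in> \<Phi> \<times>\<^sub>r \<Psi>" for \<gamma> \<delta>
    using that assms by (auto simp: root_prod_def cl root_system_def)
  moreover have "c = 1 \<or> c = -1" if "\<gamma> \<in> \<Phi> \<times>\<^sub>r \<Psi>" "c *\<^sub>R \<gamma> \<in> \<Phi> \<times>\<^sub>r \<Psi>" for \<gamma> c
  proof -
    have nz: "\<alpha> \<in> \<Phi> \<Longrightarrow> \<alpha> \<noteq> 0" "\<beta> \<in> \<Psi> \<Longrightarrow> \<beta> \<noteq> 0" for \<alpha> \<beta>
      using assms by (auto simp: root_system_def)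
    have red: "\<alpha> \<in> \<Phi> \<Longrightarrow> c *\<^sub>R \<alpha> \<in> \<Phi> \<Longrightarrow> c = 1 \<or> c = -1"
      "\<beta> \<in> \<Psi> \<Longrightarrow> c *\<^sub>R \<beta> \<in> \<Psi> \<Longrightarrow> c = 1 \<or> c = -1" for \<alpha> \<beta>
      using assms unfolding root_system_def by blast+
    consider \<alpha> where "\<alpha> \<in> \<Phi>" "\<gamma> = (\<alpha>, 0)" | \<beta> where "\<beta> \<in> \<Psi>" "\<gamma> = (0, \<beta>)"
      using \<open>\<gamma> \<in> \<Phi> \<times>\<^sub>r \<Psi>\<close> by (auto simp: root_prod_def)
    then show ?thesis
      using that(2) red nz by cases (auto simp: root_prod_def)
  qed
  moreover have "finite (\<Phi> \<times>\<^sub>r \<Psi>)" "0 \<notin> \<Phi> \<times>\<^sub>r \<Psi>"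
    using assms by (auto simp: root_prod_def root_system_def zero_prod_def)
  ultimately show ?thesis
    unfolding root_system_def by blast
qed

section \<open>Automorphisms of products\<close>

lemma aut_group_mult:
  assumes "f \<in> carrier (aut_group \<Phi>)" "g \<in> carrier (aut_group \<Phi>)"
  shows "f \<otimes>\<^bsub>aut_group \<Phi>\<^esub> g = compose (span \<Phi>) f g"
  using assms by (simp add: aut_group_def BijGroup_def linear_auts_def)

lemma aut_groupI:
  assumes "linear g" "\<And>x. x \<in> span \<Phi> \<Longrightarrow> f x = g x" "f \<in> extensional (span \<Phi>)" 
    "inj_on g (span \<Phi>)" "g ` \<Phi> = \<Phi>"
  shows "f \<in> carrier (aut_group \<Phi>)"
proof -
  have "f ` \<Phi> = g ` \<Phi>" using assms(2) by (intro image_cong refl) (auto intro: span_base)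
  moreover have "f ` span \<Phi> = g ` span \<Phi>" using assms(2) by (intro image_cong refl)
  moreover have "g ` span \<Phi> = span \<Phi>"
    using linear_span_image[OF assms(1), of \<Phi>] assms(5) by simp
  moreover have "inj_on f (span \<Phi>)" using assms(2,4) inj_on_cong by metis
  ultimately show ?thesis
    using assms by (auto simp: aut_group_def linear_auts_def Bij_def bij_betw_def)
qed

lemma aut_groupE:
  assumes "f \<in> carrier (aut_group \<Phi>)"
  obtains g where "linear g" "\<forall>x\<in>span \<Phi>. f x = g x" "f \<in> extensional (span \<Phi>)"
    "inj_on g (span \<Phi>)" "g ` \<Phi> = \<Phi>" "g ` span \<Phi> = span \<Phi>"
proof -
  have f: "f \<in> Bij (span \<Phi>)" "f ` \<Phi> = \<Phi>" and "\<exists>g. linear g \<and> (\<forall>x\<in>span \<Phi>. f x = g x)"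
    using assms by (auto simp: aut_group_def linear_auts_def)
  then obtain g where g: "linear g" "\<forall>x\<in>span \<Phi>. f x = g x" by blast
  have "g ` \<Phi> = f ` \<Phi>" using g(2) by (intro image_cong refl) (simp add: span_base)
  moreover have "inj_on g (span \<Phi>)"
    using f(1) g(2) inj_on_cong[of "span \<Phi>" f g] by (auto simp: Bij_def bij_betw_def)
  moreover have "g ` span \<Phi> = f ` span \<Phi>" using g(2) by (intro image_cong refl) auto
  ultimately show ?thesis
    using that[of g] f g by (auto simp: Bij_def bij_betw_def)
qed

definition aut_prod ::
  "'a::euclidean_space set \<Rightarrow> 'b::euclidean_space set \<Rightarrow> ('a \<Rightarrow> 'a) \<times> ('b \<Rightarrow> 'b) \<Rightarrow> 'a \<times> 'b \<Rightarrow> 'a \<times> 'b" where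
  "aut_prod \<Phi> \<Psi> = (\<lambda>(f, g). restrict (map_prod f g) (span (\<Phi> \<times>\<^sub>r \<Psi>)))"

lemma aut_prod_apply:
  "x \<in> span \<Phi> \<Longrightarrow> y \<in> span \<Psi> \<Longrightarrow> aut_prod \<Phi> \<Psi> (f, g) (x, y) = (f x, g y)"
  by (simp add: aut_prod_def span_root_prod)

lemma aut_prod_carrier:
  assumes "f \<in> carrier (aut_group \<Phi>)" "g \<in> carrier (aut_group \<Psi>)"
  shows "aut_prod \<Phi> \<Psi> (f, g) \<in> carrier (aut_group (\<Phi> \<times>\<^sub>r \<Psi>))"
proof -
  obtain f' where f: "linear f'" "\<forall>x\<in>span \<Phi>. f x = f' x" "f \<in> extensional (span \<Phi>)"
    "inj_on f' (span \<Phi>)" "f' ` \<Phi> = \<Phi>" "f' ` span \<Phi> = span \<Phi>"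
    using assms(1) by (rule aut_groupE)
  obtain g' where g: "linear g'" "\<forall>x\<in>span \<Psi>. g x = g' x" "g \<in> extensional (span \<Psi>)"
    "inj_on g' (span \<Psi>)" "g' ` \<Psi> = \<Psi>" "g' ` span \<Psi> = span \<Psi>"
    using assms(2) by (rule aut_groupE)
  show ?thesis
  proof (rule aut_groupI)
    show "linear (map_prod f' g')"
      using f(1) g(1) by (auto simp: linear_iff)
    show "inj_on (map_prod f' g') (span (\<Phi> \<times>\<^sub>r \<Psi>))"
      unfolding span_root_prod using f(4) g(4) by (rule map_prod_inj_on)
    have "map_prod f' g' ` (\<Phi> \<times>\<^sub>r \<Psi>) = (\<lambda>\<alpha>. (\<alpha>, 0)) ` f' ` \<Phi> \<union> (\<lambda>\<beta>. (0, \<beta>)) ` g' ` \<Psi>"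
      by (simp add: root_prod_def image_Un image_image linear_0[OF f(1)] linear_0[OF g(1)])
    then show "map_prod f' g' ` (\<Phi> \<times>\<^sub>r \<Psi>) = \<Phi> \<times>\<^sub>r \<Psi>"
      by (simp add: f(5) g(5) root_prod_def)
    show "aut_prod \<Phi> \<Psi> (f, g) z = map_prod f' g' z" if "z \<in> span (\<Phi> \<times>\<^sub>r \<Psi>)" for z
      using that by (auto simp: span_root_prod aut_prod_apply f(2) g(2))
  qed (simp add: aut_prod_def)
qed

text \<open>Linear automorphisms preserve the set of roots to which some root can be added with a root as the result.
For \<open>\<Phi> \<times> \<Psi>\<close> this set is \<open>\<Phi>\<close>: sums of roots from different factors are never roots.  So an
automorphism maps each factor to itself and is the product of its restrictions.\<close>

lemma aut_prod_surj:
  assumes split: "\<And>\<alpha>. \<alpha> \<in> \<Phi> \<Longrightarrow> \<exists>\<beta>\<in>\<Phi>. \<alpha> + \<beta> \<in> \<Phi>"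
    and nosplit: "\<And>\<alpha> \<beta>. \<alpha> \<in> \<Psi> \<Longrightarrow> \<beta> \<in> \<Psi> \<Longrightarrow> \<alpha> + \<beta> \<notin> \<Psi>"
    and nz: "0 \<notin> \<Phi>" "0 \<notin> \<Psi>"
    and F: "F \<in> carrier (aut_group (\<Phi> \<times>\<^sub>r \<Psi>))"
  shows "F \<in> aut_prod \<Phi> \<Psi> ` (carrier (aut_group \<Phi>) \<times> carrier (aut_group \<Psi>))"
proof -
  let ?R = "\<Phi> \<times>\<^sub>r \<Psi>"
  obtain G where G: "linear G" "\<forall>x\<in>span ?R. F x = G x" "F \<in> extensional (span ?R)"
    "inj_on G (span ?R)" "G ` ?R = ?R" "G ` span ?R = span ?R"
    using F by (rule aut_groupE)
  have \<Phi>_iff: "(\<exists>\<delta>\<in>?R. \<gamma> + \<delta> \<in> ?R) \<longleftrightarrow> \<gamma> \<in> (\<lambda>\<alpha>. (\<alpha>, 0)) ` \<Phi>" if \<gamma>: "\<gamma> \<in> ?R" for \<gamma>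
  proof
    assume "\<exists>\<delta>\<in>?R. \<gamma> + \<delta> \<in> ?R"
    then show "\<gamma> \<in> (\<lambda>\<alpha>. (\<alpha>, 0)) ` \<Phi>"
      using \<gamma> nosplit nz by (auto simp: root_prod_def)
  next
    assume "\<gamma> \<in> (\<lambda>\<alpha>. (\<alpha>, 0)) ` \<Phi>"
    then obtain \<alpha> where \<alpha>: "\<alpha> \<in> \<Phi>" "\<gamma> = (\<alpha>, 0)" by blast
    then obtain \<beta> where "\<beta> \<in> \<Phi>" "\<alpha> + \<beta> \<in> \<Phi>" using split by blast
    then show "\<exists>\<delta>\<in>?R. \<gamma> + \<delta> \<in> ?R"
      using \<alpha> by (intro bexI[of _ "(\<beta>, 0)"]) (auto simp: root_prod_def)
  qed
  have G_sum: "(\<exists>\<delta>\<in>?R. G \<gamma> + \<delta> \<in> ?R) \<longleftrightarrow> (\<exists>\<delta>\<in>?R. \<gamma> + \<delta> \<in> ?R)" if \<gamma>: "\<gamma> \<in> ?R" for \<gamma>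
  proof -
    have mem: "G z \<in> ?R \<longleftrightarrow> z \<in> ?R" if "z \<in> span ?R" for z
    proof
      assume "G z \<in> ?R"
      then obtain y where "y \<in> ?R" "G z = G y" using G(5) by blast
      then show "z \<in> ?R" using inj_onD[OF G(4)] that span_base by metis
    qed (use G(5) in blast)
    have "(\<exists>\<delta>\<in>?R. G \<gamma> + \<delta> \<in> ?R) \<longleftrightarrow> (\<exists>\<delta>\<in>G ` ?R. G \<gamma> + \<delta> \<in> ?R)"
      by (simp only: G(5))
    also have "\<dots> \<longleftrightarrow> (\<exists>\<delta>\<in>?R. G (\<gamma> + \<delta>) \<in> ?R)"
      by (simp add: linear_add[OF G(1)])
    also have "\<dots> \<longleftrightarrow> (\<exists>\<delta>\<in>?R. \<gamma> + \<delta> \<in> ?R)"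
      using mem[OF span_add[OF span_base[OF \<gamma>] span_base]] by (intro bex_cong refl)
    finally show ?thesis .
  qed
  have G\<Phi>: "G (\<alpha>, 0) \<in> (\<lambda>\<alpha>. (\<alpha>, 0)) ` \<Phi> " if "\<alpha> \<in> \<Phi>" for \<alpha>
  proof -
    have "(\<alpha>, 0) \<in> ?R" using that by (auto simp: root_prod_def)
    then show ?thesis
      using \<Phi>_iff[of "(\<alpha>, 0)"] \<Phi>_iff[of "G (\<alpha>, 0)"] G_sum[of "(\<alpha>, 0)"] G(5) that by blast
  qed
  have G\<Psi>: "G (0, \<beta>) \<in> (\<lambda>\<beta>. (0, \<beta>)) ` \<Psi>" if "\<beta> \<in> \<Psi>" for \<beta>
  proof -
    have R: "(0, \<beta>) \<in> ?R" using that by (auto simp: root_prod_def)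
    moreover have "(0, \<beta>) \<notin> (\<lambda>\<alpha>. (\<alpha>, 0)) ` \<Phi>" using that nz by auto
    ultimately have "G (0, \<beta>) \<notin> (\<lambda>\<alpha>. (\<alpha>, 0)) ` \<Phi>"
      using \<Phi>_iff[of "(0, \<beta>)"] \<Phi>_iff[of "G (0, \<beta>)"] G_sum[of "(0, \<beta>)"] G(5) by blast
    moreover have "G (0, \<beta>) \<in> ?R" using G(5) R by blast
    ultimately show ?thesis by (auto simp: root_prod_def)
  qed
  \<comment> \<open>The restrictions of \<open>G\<close> to the two factors, composed with the projections; \<open>Gx\<close> and \<open>Gy\<close> show that the other components vanish.\<close>
  define f where "f x = fst (G (x, 0))" for x
  define g where "g y = snd (G (0, y))" for y
  have lin_l: "linear (\<lambda>x. G (x, 0))"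
    using linear_compose[OF _ G(1), of "\<lambda>x. (x, 0)"] by (simp add: linear_iff o_def)
  have lin_r: "linear (\<lambda>y. G (0, y))"
    using linear_compose[OF _ G(1), of "\<lambda>y. (0, y)"] by (simp add: linear_iff o_def)
  have lin_f: "linear f"
    unfolding f_def using linear_compose[OF lin_l linear_fst] by (simp add: o_def)
  have lin_g: "linear g"
    unfolding g_def using linear_compose[OF lin_r linear_snd] by (simp add: o_def)
  have Gx: "G (x, 0) = (f x, 0)" if "x \<in> span \<Phi>" for x
  proof -
    have zero: "snd (G (b, 0)) = 0" if "b \<in> \<Phi>" for b using G\<Phi>[OF that] by auto
    have "snd (G (x, 0)) = 0"
      using that
    proof (rule linear_eq_on[of "\<lambda>x. snd (G (x, 0))" "\<lambda>x. 0", rotated 2])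
      show "linear (\<lambda>x. snd (G (x, 0)))"
        using linear_compose[OF lin_l linear_snd] by (simp add: o_def)
    qed (simp_all add: module_hom_zero zero)
    then show ?thesis by (simp add: f_def prod_eq_iff)
  qed
  have Gy: "G (0, y) = (0, g y)" if "y \<in> span \<Psi>" for y
  proof -
    have zero: "fst (G (0, b)) = 0" if "b \<in> \<Psi>" for b using G\<Psi>[OF that] by auto
    have "fst (G (0, y)) = 0"
      using that
    proof (rule linear_eq_on[of "\<lambda>y. fst (G (0, y))" "\<lambda>y. 0", rotated 2])
      show "linear (\<lambda>y. fst (G (0, y)))"
        using linear_compose[OF lin_r linear_fst] by (simp add: o_def)
    qed (simp_all add: module_hom_zero zero)
    then show ?thesis by (simp add: g_def prod_eq_iff)
  qed
  have Gxy: "G (x, y) = (f x, g y)" if "x \<in> span \<Phi>" "y \<in> span \<Psi>" for x y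
    using linear_add[OF G(1), of "(x, 0)" "(0, y)"] Gx[OF that(1)] Gy[OF that(2)] by simp
  have inj: "inj_on f (span \<Phi>)" "inj_on g (span \<Psi>)"
  proof -
    show "inj_on f (span \<Phi>)"
    proof (rule inj_onI)
      fix x y assume xy: "x \<in> span \<Phi>" "y \<in> span \<Phi>" "f x = f y"
      then have "G (x, 0) = G (y, 0)" using Gx by simp
      then show "x = y" using inj_onD[OF G(4), of "(x, 0)" "(y, 0)"] xy by (simp add: span_root_prod span_zero)
    qed
    show "inj_on g (span \<Psi>)"
    proof (rule inj_onI)
      fix x y assume xy: "x \<in> span \<Psi>" "y \<in> span \<Psi>" "g x = g y"
      then have "G (0, x) = G (0, y)" using Gy by simp
      then show "x = y" using inj_onD[OF G(4), of "(0, x)" "(0, y)"] xy by (simp add: span_root_prod span_zero)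
    qed
  qed
  have f\<Phi>: "f ` \<Phi> = \<Phi>"
  proof (intro equalityI subsetI)
    fix \<alpha> assume "\<alpha> \<in> \<Phi>"
    then have "(\<alpha>, 0) \<in> G ` ?R" unfolding G(5) by (auto simp: root_prod_def)
    then obtain \<gamma> where \<gamma>: "\<gamma> \<in> ?R" "G \<gamma> = (\<alpha>, 0)" by (metis imageE)
    then show "\<alpha> \<in> f ` \<Phi>"
      using Gy[OF span_base] nz \<open>\<alpha> \<in> \<Phi>\<close> by (auto simp: root_prod_def f_def intro: rev_image_eqI)
  qed (use G\<Phi> in \<open>fastforce simp: f_def\<close>)
  have g\<Psi>: "g ` \<Psi> = \<Psi>"
  proof (intro equalityI subsetI)
    fix \<beta> assume "\<beta> \<in> \<Psi>"
    then have "(0, \<beta>) \<in> G ` ?R" unfolding G(5) by (auto simp: root_prod_def)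
    then obtain \<gamma> where \<gamma>: "\<gamma> \<in> ?R" "G \<gamma> = (0, \<beta>)" by (metis imageE)
    then show "\<beta> \<in> g ` \<Psi>"
      using Gx[OF span_base] nz \<open>\<beta> \<in> \<Psi>\<close> by (auto simp: root_prod_def g_def intro: rev_image_eqI)
  qed (use G\<Psi> in \<open>fastforce simp: g_def\<close>)
  have "restrict f (span \<Phi>) \<in> carrier (aut_group \<Phi>)" "restrict g (span \<Psi>) \<in> carrier (aut_group \<Psi>)"
    using lin_f lin_g inj f\<Phi> g\<Psi> by (auto intro: aut_groupI)
  moreover have "F = aut_prod \<Phi> \<Psi> (restrict f (span \<Phi>), restrict g (span \<Psi>))"
  proof (rule extensionalityI[OF G(3)])
    fix z assume z: "z \<in> span ?R"
    then obtain x y where xy: "z = (x, y)" "x \<in> span \<Phi>" "y \<in> span \<Psi>" by (auto simp: span_root_prod)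
    then show "F z = aut_prod \<Phi> \<Psi> (restrict f (span \<Phi>), restrict g (span \<Psi>)) z"
      using bspec[OF G(2) z] by (simp add: aut_prod_apply Gxy)
  qed (simp add: aut_prod_def)
  ultimately show ?thesis by blast
qed

lemma glattice_iso_root_prod:
  assumes split: "\<And>\<alpha>. \<alpha> \<in> \<Phi> \<Longrightarrow> \<exists>\<beta>\<in>\<Phi>. \<alpha> + \<beta> \<in> \<Phi>"
    and nosplit: "\<And>\<alpha> \<beta>. \<alpha> \<in> \<Psi> \<Longrightarrow> \<beta> \<in> \<Psi> \<Longrightarrow> \<alpha> + \<beta> \<notin> \<Psi>"
    and nz: "0 \<notin> \<Phi>" "0 \<notin> \<Psi>"
  shows "glattice_iso (glattice_sum (root_glattice \<Phi>) (root_glattice \<Psi>)) (root_glattice (\<Phi> \<times>\<^sub>r \<Psi>))"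
proof -
  have in_span: "x \<in> span S" if "x \<in> int_span S" for x :: "'c::euclidean_space" and S
    using that int_span_subset_span by blast
  have inj: "inj_on (aut_prod \<Phi> \<Psi>) (carrier (aut_group \<Phi>) \<times> carrier (aut_group \<Psi>))"
  proof (rule inj_onI, clarify, rule conjI)
    fix f g f' g' assume fg: "f \<in> carrier (aut_group \<Phi>)" "g \<in> carrier (aut_group \<Psi>)"
      "f' \<in> carrier (aut_group \<Phi>)" "g' \<in> carrier (aut_group \<Psi>)"
      and eq: "aut_prod \<Phi> \<Psi> (f, g) = aut_prod \<Phi> \<Psi> (f', g')"
    have "(f x, g y) = (f' x, g' y)" if "x \<in> span \<Phi>" "y \<in> span \<Psi>" for x y
      using aut_prod_apply[OF that] eq by metis
    then have "f x = f' x" "g y = g' y" if "x \<in> span \<Phi>" "y \<in> span \<Psi>" for x y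
      using that by blast+
    note ext = this[OF _ span_zero] this[OF span_zero]
    show "f = f'" using fg ext by (intro extensionalityI[of f "span \<Phi>" f']) (auto elim: aut_groupE)
    show "g = g'" using fg ext by (intro extensionalityI[of g "span \<Psi>" g']) (auto elim: aut_groupE)
  qed
  have span_closed: "f x \<in> span S" if "f \<in> carrier (aut_group S)" "x \<in> span S" for f x and S :: "'c::euclidean_space set"
    using that by (auto elim!: aut_groupE)
  have "aut_prod \<Phi> \<Psi> \<in> iso (aut_group \<Phi> \<times>\<times> aut_group \<Psi>) (aut_group (\<Phi> \<times>\<^sub>r \<Psi>))"
  proof (rule isoI)
    show "aut_prod \<Phi> \<Psi> \<in> hom (aut_group \<Phi> \<times>\<times> aut_group \<Psi>) (aut_group (\<Phi> \<times>\<^sub>r \<Psi>))"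
    proof (rule homI)
      fix p q assume "p \<in> carrier (aut_group \<Phi> \<times>\<times> aut_group \<Psi>)" "q \<in> carrier (aut_group \<Phi> \<times>\<times> aut_group \<Psi>)"
      then obtain f g f' g' where p: "p = (f, g)" "f \<in> carrier (aut_group \<Phi>)" "g \<in> carrier (aut_group \<Psi>)"
        and q: "q = (f', g')" "f' \<in> carrier (aut_group \<Phi>)" "g' \<in> carrier (aut_group \<Psi>)" by auto
      have "aut_prod \<Phi> \<Psi> (compose (span \<Phi>) f f', compose (span \<Psi>) g g') z =
          compose (span (\<Phi> \<times>\<^sub>r \<Psi>)) (aut_prod \<Phi> \<Psi> (f, g)) (aut_prod \<Phi> \<Psi> (f', g')) z" for z
      proof (cases "z \<in> span (\<Phi> \<times>\<^sub>r \<Psi>)")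
        case True
        then obtain x y where "z = (x, y)" "x \<in> span \<Phi>" "y \<in> span \<Psi>" by (auto simp: span_root_prod)
        then show ?thesis
          using p q True by (simp add: aut_prod_apply compose_def span_closed)
      qed (simp add: aut_prod_def compose_def)
      then show "aut_prod \<Phi> \<Psi> (p \<otimes>\<^bsub>aut_group \<Phi> \<times>\<times> aut_group \<Psi>\<^esub> q) =
          aut_prod \<Phi> \<Psi> p \<otimes>\<^bsub>aut_group (\<Phi> \<times>\<^sub>r \<Psi>)\<^esub> aut_prod \<Phi> \<Psi> q"
        using p q by (simp add: aut_group_mult aut_prod_carrier fun_eq_iff)
    qed (auto simp: aut_prod_carrier)
    show "bij_betw (aut_prod \<Phi> \<Psi>) (carrier (aut_group \<Phi> \<times>\<times> aut_group \<Psi>)) (carrier (aut_group (\<Phi> \<times>\<^sub>r \<Psi>)))"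
      unfolding bij_betw_def
      using inj aut_prod_surj[OF split nosplit nz] aut_prod_carrier by auto
  qed
  then show ?thesis
    unfolding glattice_iso_def
    by (intro bexI[of _ "\<lambda>x. x"] bexI[of _ "aut_prod \<Phi> \<Psi>"])
      (auto simp: glattice_sum_def root_glattice_def root_lattice_prod aut_prod_apply in_span
        iso_def hom_def bij_betw_def)
qed

lemma glattice_sum_commute: "glattice_iso (glattice_sum P Q) (glattice_sum Q P)"
proof -
  have swap: "prod.swap \<in> iso (A \<times>\<times> B) (B \<times>\<times> A)" for A :: "'x monoid" and B :: "'y monoid"
    by (auto simp: iso_def hom_def bij_betw_def)
  show ?thesis
    unfolding glattice_iso_def
    by (intro bexI[of _ prod.swap]) (auto simp: glattice_sum_def swap)
qed

lemma prod_cone_pull: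
  assumes "f \<in> hom M M'" "g \<in> hom N N'"
  shows "pull_dual (M \<times>\<times> N) (map_prod f g) ` prod_cone M' N' \<sigma> \<tau> =
    prod_cone M N (pull_dual M f ` \<sigma>) (pull_dual N g ` \<tau>)"
proof -
  have "pull_dual (M \<times>\<times> N) (map_prod f g) (dual_sum M' N' u v) =
      dual_sum M N (pull_dual M f u) (pull_dual N g v)" for u v
    using assms by (auto simp: fun_eq_iff pull_dual_def dual_sum_def hom_def)
  then have "{pull_dual (M \<times>\<times> N) (map_prod f g) (dual_sum M' N' u v) | u v. u \<in> \<sigma> \<and> v \<in> \<tau>} =
      {dual_sum M N (pull_dual M f u) (pull_dual N g v) | u v. u \<in> \<sigma> \<and> v \<in> \<tau>}"
    by simp
  then show ?thesis
    unfolding prod_cone_image by blast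
qed

lemma toric_iso_prod:
  assumes "toric_iso V V'" "toric_iso W W'" shows "toric_iso (V \<times>\<^sub>t W) (V' \<times>\<^sub>t W')"
proof -
  obtain f where f: "f \<in> iso (fst V) (fst V')" "snd V = pull_fan (fst V) f (snd V')"
    using assms(1) unfolding toric_iso_def by blast
  obtain g where g: "g \<in> iso (fst W) (fst W')" "snd W = pull_fan (fst W) g (snd W')"
    using assms(2) unfolding toric_iso_def by blast
  have hom: "f \<in> hom (fst V) (fst V')" "g \<in> hom (fst W) (fst W')"
    using f g by (auto simp: iso_def)
  have "bij_betw (map_prod f g) (carrier (fst V) \<times> carrier (fst W)) (carrier (fst V') \<times> carrier (fst W'))"
    using f(1) g(1) by (simp add: iso_def bij_betw_def map_prod_inj_on map_prod_surj_on)
  then have "map_prod f g \<in> iso (fst V \<times>\<times> fst W) (fst V' \<times>\<times> fst W')"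
    using hom by (auto simp: iso_def hom_def)
  moreover have "snd (V \<times>\<^sub>t W) = pull_fan (fst V \<times>\<times> fst W) (map_prod f g) (snd (V' \<times>\<^sub>t W'))"
    unfolding toric_prod_def snd_conv f(2) g(2) pull_fan_def
    using prod_cone_pull[OF hom] by (auto simp: image_iff) metis+
  ultimately show ?thesis
    unfolding toric_iso_def by (auto simp: toric_prod_def)
qed

lemma toric_iso_refl: "(\<And>\<sigma>. \<sigma> \<in> snd V \<Longrightarrow> \<sigma> \<subseteq> real_dual (fst V)) \<Longrightarrow> toric_iso V V"
proof -
  assume sub: "\<And>\<sigma>. \<sigma> \<in> snd V \<Longrightarrow> \<sigma> \<subseteq> real_dual (fst V)"
  have "pull_dual (fst V) (\<lambda>x. x) u = u" if "u \<in> real_dual (fst V)" for u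
    using real_dual_outside[OF that] by (auto simp: pull_dual_def)
  then have "pull_dual (fst V) (\<lambda>x. x) ` \<sigma> = \<sigma>" if "\<sigma> \<in> snd V" for \<sigma>
    using sub[OF that] by (force simp: subset_iff)
  then have "snd V = pull_fan (fst V) (\<lambda>x. x) (snd V)"
    by (force simp: pull_fan_def)
  moreover have "(\<lambda>x. x) \<in> iso (fst V) (fst V)"
    by (auto simp: iso_def hom_def bij_betw_def)
  ultimately show ?thesis unfolding toric_iso_def by blast
qed

section \<open>Root systems of types A and D\<close>

text \<open>All roots have squared length \<open>2\<close>, so Cartan integers are inner products.  An inner product of absolute value \<open>2\<close>
is the equality case of the Cauchy-Schwarz inequality and occurs only for \<open>\<beta> = \<alpha>\<close> or \<open>\<beta> = - \<alpha>\<close>.\<close>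

lemma norm_two_root_system:
  fixes \<Phi> :: "'a::euclidean_space set"
  assumes fin: "finite \<Phi>" and norm: "\<And>\<alpha>. \<alpha> \<in> \<Phi> \<Longrightarrow> \<alpha> \<bullet> \<alpha> = 2"
    and int: "\<And>\<alpha> \<beta>. \<alpha> \<in> \<Phi> \<Longrightarrow> \<beta> \<in> \<Phi> \<Longrightarrow> \<beta> \<bullet> \<alpha> \<in> \<int>"
    and refl: "\<And>\<alpha> \<beta>. \<alpha> \<in> \<Phi> \<Longrightarrow> \<beta> \<in> \<Phi> \<Longrightarrow> \<beta> - (\<beta> \<bullet> \<alpha>) *\<^sub>R \<alpha> \<in> \<Phi>"
  shows "root_system \<Phi>" "simply_laced \<Phi>"
proof -
  have cartan: "cartan \<beta> \<alpha> = \<beta> \<bullet> \<alpha>" if "\<alpha> \<in> \<Phi>" for \<alpha> \<beta>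
    using norm[OF that] by (simp add: cartan_def)
  have "c = 1 \<or> c = -1" if "\<alpha> \<in> \<Phi>" "c *\<^sub>R \<alpha> \<in> \<Phi>" for c \<alpha>
  proof -
    have "c * c = 1" using norm[OF that(1)] norm[OF that(2)] by simp
    then show ?thesis by (simp add: square_eq_1_iff)
  qed
  moreover have "0 \<notin> \<Phi>" using norm[of 0] by auto
  ultimately show "root_system \<Phi>"
    unfolding root_system_def using fin int refl
    by (auto simp: cartan root_reflection_def)
  have "\<bar>\<beta> \<bullet> \<alpha>\<bar> \<le> 1" if ab: "\<alpha> \<in> \<Phi>" "\<beta> \<in> \<Phi>" "\<beta> \<noteq> \<alpha>" "\<beta> \<noteq> - \<alpha>" for \<alpha> \<beta>
  proof -
    have "(\<beta> - \<alpha>) \<bullet> (\<beta> - \<alpha>) > 0" "(\<beta> + \<alpha>) \<bullet> (\<beta> + \<alpha>) > 0"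
      using ab(3,4) unfolding inner_gt_zero_iff by (simp_all add: eq_neg_iff_add_eq_0)
    then have "\<bar>\<beta> \<bullet> \<alpha>\<bar> < 2"
      using norm[OF ab(1)] norm[OF ab(2)] by (simp add: inner_diff_left inner_diff_right inner_add_left inner_add_right inner_commute[of \<alpha> \<beta>])
    moreover obtain n :: int where n: "\<beta> \<bullet> \<alpha> = n"
      using int[OF ab(1,2)] by (auto elim: Ints_cases)
    ultimately have "\<bar>n\<bar> \<le> 1" by linarith
    then show ?thesis unfolding n by linarith
  qed
  then show "simply_laced \<Phi>"
    by (auto simp: simply_laced_def cartan)
qed

lemma irreducible_rootsI:
  assumes "\<Phi> \<noteq> {}"
    and link: "\<And>\<alpha> \<beta>. \<alpha> \<in> \<Phi> \<Longrightarrow> \<beta> \<in> \<Phi> \<Longrightarrow> \<exists>\<gamma>\<in>\<Phi>. \<alpha> \<bullet> \<gamma> \<noteq> 0 \<and> \<gamma> \<bullet> \<beta> \<noteq> 0"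
  shows "irreducible_roots \<Phi>"
  unfolding irreducible_roots_def
proof (intro conjI assms(1), rule notI)
  assume "\<exists>\<Phi>\<^sub>1 \<Phi>\<^sub>2. \<Phi>\<^sub>1 \<noteq> {} \<and> \<Phi>\<^sub>2 \<noteq> {} \<and> \<Phi> = \<Phi>\<^sub>1 \<union> \<Phi>\<^sub>2 \<and> (\<forall>\<alpha>\<in>\<Phi>\<^sub>1. \<forall>\<beta>\<in>\<Phi>\<^sub>2. \<alpha> \<bullet> \<beta> = 0)"
  then obtain \<Phi>\<^sub>1 \<Phi>\<^sub>2 \<alpha> \<beta> where "\<alpha> \<in> \<Phi>\<^sub>1" "\<beta> \<in> \<Phi>\<^sub>2" "\<Phi> = \<Phi>\<^sub>1 \<union> \<Phi>\<^sub>2" "\<forall>\<alpha>\<in>\<Phi>\<^sub>1. \<forall>\<beta>\<in>\<Phi>\<^sub>2. \<alpha> \<bullet> \<beta> = 0"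
    by blast
  then show False using link[of \<alpha> \<beta>] by blast
qed

text \<open>The description by integrality and length makes closure under reflections immediate, since reflections in roots
preserve both.  Conversely a sum of integer squares is \<open>2\<close> only for two entries \<open>1\<close> or \<open>-1\<close>.\<close>

lemma roots_D_iff:
  fixes x :: "real ^ 'n::finite"
  shows "x \<in> roots_D \<longleftrightarrow> (\<forall>i. x $ i \<in> \<int>) \<and> x \<bullet> x = 2"
proof
  assume "x \<in> roots_D"
  then obtain a b i j where x: "x = a *\<^sub>R axis i 1 + b *\<^sub>R axis j 1" and ij: "i \<noteq> j"
    and ab: "a \<in> {1, -1}" "b \<in> {1, -1}" by (auto simp: roots_D_def)
  have "x $ k \<in> \<int>" for k
    using ab by (auto simp: x axis_def)
  moreover have "x \<bullet> x = 2"
    using ab ij by (auto simp: x inner_add inner_axis_axis)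
  ultimately show "(\<forall>i. x $ i \<in> \<int>) \<and> x \<bullet> x = 2" by blast
next
  assume x: "(\<forall>i. x $ i \<in> \<int>) \<and> x \<bullet> x = 2"
  have sum: "(\<Sum>k\<in>UNIV. (x $ k)\<^sup>2) = 2"
    using x by (simp add: inner_vec_def power2_eq_square)
  have cases: "x $ k = 0 \<or> x $ k = 1 \<or> x $ k = -1" for k
  proof -
    obtain n :: int where n: "x $ k = n" using x by (metis Ints_cases)
    have "(x $ k)\<^sup>2 \<le> (\<Sum>k\<in>UNIV. (x $ k)\<^sup>2)" by (rule member_le_sum) auto
    then have "n\<^sup>2 \<le> 2" unfolding sum n by (metis of_int_le_numeral_iff of_int_power)
    then have "\<bar>n\<bar> < 2" by (rule contrapos_pp) (use power_mono[of 2 "\<bar>n\<bar>" 2] in auto)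
    then show ?thesis using n by force
  qed
  have "(\<Sum>k\<in>UNIV. (x $ k)\<^sup>2) = (\<Sum>k\<in>UNIV. if x $ k \<noteq> 0 then 1 else 0)"
    using cases by (intro sum.cong refl) (metis one_power2 power2_minus zero_power2)
  also have "\<dots> = real (card {k. x $ k \<noteq> 0})"
    by (subst sum.If_cases) auto
  finally have "card {k. x $ k \<noteq> 0} = 2" using sum by simp
  then obtain i j where ij: "i \<noteq> j" "{k. x $ k \<noteq> 0} = {i, j}" by (auto simp: card_2_iff)
  have "x $ k = (x $ i *\<^sub>R axis i 1 + x $ j *\<^sub>R axis j 1) $ k" for k
  proof -
    have "x $ k = 0" if "k \<noteq> i" "k \<noteq> j" using ij(2) that by blast
    then show ?thesis using ij(1) by (cases "k = i"; cases "k = j") (simp_all add: axis_def)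
  qed
  then have "x = x $ i *\<^sub>R axis i 1 + x $ j *\<^sub>R axis j 1" unfolding vec_eq_iff by blast
  moreover have "x $ i \<in> {1, -1}" "x $ j \<in> {1, -1}" using cases ij by (auto simp: set_eq_iff)
  ultimately show "x \<in> roots_D" using ij(1) unfolding roots_D_def by blast
qed

lemma roots_A_iff:
  fixes x :: "real ^ 'n::finite"
  shows "x \<in> roots_A \<longleftrightarrow> x \<in> roots_D \<and> (\<Sum>k\<in>UNIV. x $ k) = 0"
proof
  assume "x \<in> roots_A"
  then obtain i j where x: "x = axis i 1 - axis j 1" and ij: "i \<noteq> j" by (auto simp: roots_A_def)
  have "x = 1 *\<^sub>R axis i 1 + (-1) *\<^sub>R axis j 1" by (simp add: x)
  then have "x \<in> roots_D" unfolding roots_D_def using ij by blast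
  then show "x \<in> roots_D \<and> (\<Sum>k\<in>UNIV. x $ k) = 0"
    by (simp add: x axis_def sum_subtractf)
next
  assume x: "x \<in> roots_D \<and> (\<Sum>k\<in>UNIV. x $ k) = 0"
  then obtain a b i j where ab: "x = a *\<^sub>R axis i 1 + b *\<^sub>R axis j 1" and ij: "i \<noteq> j"
    and ab1: "a \<in> {1, -1}" "b \<in> {1, -1}" by (auto simp: roots_D_def)
  have "(\<Sum>k\<in>UNIV. x $ k) = a + b"
    by (simp add: ab axis_def sum.distrib if_distrib[of "(*) _"] cong: if_cong)
  then have "a = 1 \<and> b = -1 \<or> a = -1 \<and> b = 1" using x ab1 by auto
  then have "x = axis i 1 - axis j 1 \<or> x = axis j 1 - axis i 1" by (auto simp: ab)
  then show "x \<in> roots_A" using ij unfolding roots_A_def by auto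
qed

lemma finite_roots_D: "finite (roots_D :: (real ^ 'n::finite) set)"
proof -
  have "roots_D \<subseteq> (\<lambda>(a, b, i, j). a *\<^sub>R axis i 1 + b *\<^sub>R axis j (1 :: real)) `
      ({1, -1} \<times> {1, -1} \<times> (UNIV :: 'n set) \<times> UNIV)"
  proof
    fix x :: "real ^ 'n" assume "x \<in> roots_D"
    then obtain a b i j where "x = a *\<^sub>R axis i 1 + b *\<^sub>R axis j 1" "a \<in> {1, -1}" "b \<in> {1, -1}"
      by (auto simp: roots_D_def)
    then show "x \<in> (\<lambda>(a, b, i, j). a *\<^sub>R axis i 1 + b *\<^sub>R axis j (1 :: real)) `
        ({1, -1} \<times> {1, -1} \<times> (UNIV :: 'n set) \<times> UNIV)"
      by (intro image_eqI[of _ _ "(a, b, i, j)"]) simp_all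
  qed
  then show ?thesis by (rule finite_subset) simp
qed

lemma roots_D_inner_int:
  assumes "x \<in> roots_D" "y \<in> roots_D" shows "x \<bullet> y \<in> \<int>"
  using assms by (auto simp: roots_D_iff inner_vec_def intro!: Ints_sum Ints_mult)

lemma roots_D_reflection:
  assumes "x \<in> roots_D" "y \<in> roots_D" shows "y - (y \<bullet> x) *\<^sub>R x \<in> roots_D"
proof -
  have "(y - (y \<bullet> x) *\<^sub>R x) \<bullet> (y - (y \<bullet> x) *\<^sub>R x) = y \<bullet> y - (y \<bullet> x) * (y \<bullet> x) * (2 - x \<bullet> x)"
    by (simp add: inner_diff inner_commute[of x y] algebra_simps)
  then show ?thesis
    using assms roots_D_inner_int[OF assms(2,1)] by (auto simp: roots_D_iff intro!: Ints_diff Ints_mult)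
qed

lemma roots_D_root_system: "root_system (roots_D :: (real ^ 'n::finite) set)"
  and roots_D_simply_laced: "simply_laced (roots_D :: (real ^ 'n::finite) set)"
  by (intro norm_two_root_system finite_roots_D roots_D_inner_int roots_D_reflection;
      simp add: roots_D_iff)+

lemma roots_A_root_system: "root_system (roots_A :: (real ^ 'n::finite) set)"
  and roots_A_simply_laced: "simply_laced (roots_A :: (real ^ 'n::finite) set)"
proof -
  have D: "x \<in> roots_D" if "x \<in> roots_A" for x :: "real ^ 'n"
    using that by (simp add: roots_A_iff)
  have fin: "finite (roots_A :: (real ^ 'n) set)"
    by (rule finite_subset[OF _ finite_roots_D]) (use D in blast)
  have norm: "x \<bullet> x = 2" if "x \<in> roots_A" for x :: "real ^ 'n"
    using D[OF that] by (simp add: roots_D_iff)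
  have refl: "y - (y \<bullet> x) *\<^sub>R x \<in> roots_A" if "x \<in> roots_A" "y \<in> roots_A" for x y :: "real ^ 'n"
    using that roots_D_reflection[of x y]
    by (simp add: roots_A_iff sum_subtractf flip: sum_distrib_left)
  show "root_system (roots_A :: (real ^ 'n) set)" "simply_laced (roots_A :: (real ^ 'n) set)"
    using norm_two_root_system[OF fin norm roots_D_inner_int[OF D D] refl] by blast+
qed

lemma inner_axis_diff:
  "(axis i 1 - axis j 1) \<bullet> (axis k 1 - axis l (1::real)) =
    (if i = k then 1 else 0) - (if i = l then 1 else 0) - (if j = k then 1 else 0) + (if j = l then 1 else 0)"
  by (simp add: inner_diff inner_axis_axis)

lemma roots_A_irreducible:
  assumes "CARD('n::finite) \<ge> 2" shows "irreducible_roots (roots_A :: (real ^ 'n) set)"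
proof (rule irreducible_rootsI)
  obtain i j :: 'n where "i \<noteq> j"
    using assms card_le_Suc0_iff_eq[of "UNIV :: 'n set"] by force
  then show "(roots_A :: (real ^ 'n) set) \<noteq> {}" by (auto simp: roots_A_def)
next
  fix \<alpha> \<beta> :: "real ^ 'n" assume "\<alpha> \<in> roots_A" "\<beta> \<in> roots_A"
  then obtain i j k l where \<alpha>: "\<alpha> = axis i 1 - axis j 1" "i \<noteq> j" and \<beta>: "\<beta> = axis k 1 - axis l 1" "k \<noteq> l"
    by (auto simp: roots_A_def)
  show "\<exists>\<gamma>\<in>roots_A. \<alpha> \<bullet> \<gamma> \<noteq> 0 \<and> \<gamma> \<bullet> \<beta> \<noteq> 0"
  proof (cases "i = k")
    case True
    then show ?thesis
      using \<alpha> \<beta> by (intro bexI[of _ \<alpha>]) (auto simp: roots_A_def inner_axis_diff)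
  next
    case False
    then show ?thesis
      using \<alpha> \<beta> by (intro bexI[of _ "axis i 1 - axis k 1"]) (auto simp: roots_A_def inner_axis_diff)
  qed
qed

lemma roots_A_split:
  assumes "CARD('n::finite) \<ge> 3" and "\<alpha> \<in> (roots_A :: (real ^ 'n) set)"
  shows "\<exists>\<beta>\<in>roots_A. \<alpha> + \<beta> \<in> roots_A"
proof -
  obtain i j where \<alpha>: "\<alpha> = axis i 1 - axis j 1" "i \<noteq> j" using assms(2) by (auto simp: roots_A_def)
  have "card {i, j} < CARD('n)" using assms(1) card_insert_le_m1[of 2 "{j}" i] by simp
  then have "{i, j} \<noteq> UNIV" by (metis less_irrefl)
  then obtain k where k: "k \<noteq> i" "k \<noteq> j" by auto
  have "\<alpha> + (axis j 1 - axis k 1) = axis i 1 - axis k 1" by (simp add: \<alpha>)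
  moreover have "axis j 1 - axis k 1 \<in> (roots_A :: (real ^ 'n) set)" "axis i 1 - axis k 1 \<in> (roots_A :: (real ^ 'n) set)"
    using k by (auto simp: roots_A_def)
  ultimately show ?thesis by (intro bexI[of _ "axis j 1 - axis k 1"]) (simp_all only:)
qed

text \<open>The linking root is \<open>e\<^sub>p + e\<^sub>q\<close>.  If the supports of \<open>\<alpha>\<close> and \<open>\<beta>\<close> are disjoint, take \<open>p\<close> and \<open>q\<close> from the two
supports.  Otherwise take \<open>p\<close> in both and \<open>q\<close> in neither; four coordinates leave room for \<open>q\<close>, as then the supports
cover at most three.\<close>

lemma roots_D_irreducible:
  assumes card: "CARD('n::finite) \<ge> 4" shows "irreducible_roots (roots_D :: (real ^ 'n) set)"
proof (rule irreducible_rootsI)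
  obtain i j :: 'n where "i \<noteq> j"
    using card card_le_Suc0_iff_eq[of "UNIV :: 'n set"] by force
  then have "1 *\<^sub>R axis i 1 + 1 *\<^sub>R axis j 1 \<in> (roots_D :: (real ^ 'n) set)"
    unfolding roots_D_def by blast
  then show "(roots_D :: (real ^ 'n) set) \<noteq> {}" by blast
next
  fix \<alpha> \<beta> :: "real ^ 'n" assume \<alpha>\<beta>: "\<alpha> \<in> roots_D" "\<beta> \<in> roots_D"
  have supp: "\<exists>i j. i \<noteq> j \<and> x $ i \<noteq> 0 \<and> x $ j \<noteq> 0 \<and> (\<forall>k. k \<noteq> i \<longrightarrow> k \<noteq> j \<longrightarrow> x $ k = 0)"
    if "x \<in> roots_D" for x :: "real ^ 'n"
  proof -
    obtain a b i j where "x = a *\<^sub>R axis i 1 + b *\<^sub>R axis j 1" "i \<noteq> j" "a \<in> {1, -1}" "b \<in> {1, -1}"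
      using \<open>x \<in> roots_D\<close> by (auto simp: roots_D_def)
    then show ?thesis by (intro exI[of _ i] exI[of _ j]) (auto simp: axis_def)
  qed
  obtain i j where \<alpha>: "i \<noteq> j" "\<alpha> $ i \<noteq> 0" "\<alpha> $ j \<noteq> 0" "\<And>k. k \<noteq> i \<Longrightarrow> k \<noteq> j \<Longrightarrow> \<alpha> $ k = 0"
    using supp[OF \<alpha>\<beta>(1)] by blast
  obtain k l where \<beta>: "k \<noteq> l" "\<beta> $ k \<noteq> 0" "\<beta> $ l \<noteq> 0" "\<And>m. m \<noteq> k \<Longrightarrow> m \<noteq> l \<Longrightarrow> \<beta> $ m = 0"
    using supp[OF \<alpha>\<beta>(2)] by blast
  have val: "\<alpha> \<bullet> (axis p 1 + axis q 1) = \<alpha> $ p + \<alpha> $ q" "(axis p 1 + axis q 1) \<bullet> \<beta> = \<beta> $ p + \<beta> $ q" for p q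
    by (simp_all add: inner_add inner_axis inner_axis')
  have "\<exists>p q. p \<noteq> q \<and> \<alpha> $ p + \<alpha> $ q \<noteq> 0 \<and> \<beta> $ p + \<beta> $ q \<noteq> 0"
  proof (cases "{i, j} \<inter> {k, l} = {}")
    case True
    then show ?thesis using \<alpha> \<beta> by (intro exI[of _ i] exI[of _ k]) auto
  next
    case False
    then obtain p where p: "p \<in> {i, j}" "p \<in> {k, l}" by blast
    have "card ({i, j} \<union> {k, l}) \<le> 3"
      using False \<alpha>(1) \<beta>(1) by (auto simp: card_insert_if)
    then have "{i, j} \<union> {k, l} \<noteq> UNIV" using card by (metis Suc_n_not_le_n eval_nat_numeral(2,3) le_trans semiring_norm(26,27))
    then obtain q where "q \<notin> {i, j} \<union> {k, l}" by blast
    then show ?thesis using p \<alpha> \<beta> by (intro exI[of _ p] exI[of _ q]) auto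
  qed
  then obtain p q where pq: "p \<noteq> q" "\<alpha> $ p + \<alpha> $ q \<noteq> 0" "\<beta> $ p + \<beta> $ q \<noteq> 0" by blast
  then have "1 *\<^sub>R axis p 1 + 1 *\<^sub>R axis q 1 \<in> (roots_D :: (real ^ 'n) set)"
    unfolding roots_D_def by blast
  then show "\<exists>\<gamma>\<in>roots_D. \<alpha> \<bullet> \<gamma> \<noteq> 0 \<and> \<gamma> \<bullet> \<beta> \<noteq> 0"
    using pq val by (intro bexI[of _ "axis p 1 + axis q 1"]) auto
qed

definition A1_root :: "real ^ 2" where "A1_root = axis 1 1 - axis 2 1"

lemma A1_eq: "A1 = {A1_root, - A1_root}"
proof (intro equalityI subsetI)
  fix x assume "x \<in> A1"
  then obtain i j :: 2 where x: "x = axis i 1 - axis j 1" "i \<noteq> j" by (auto simp: A1_def roots_A_def)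
  then have "i = 1 \<and> j = 2 \<or> i = 2 \<and> j = 1" using exhaust_2[of i] exhaust_2[of j] by auto
  then show "x \<in> {A1_root, - A1_root}" using x by (auto simp: A1_root_def)
next
  fix x assume "x \<in> {A1_root, - A1_root}"
  then have "x = axis 1 1 - axis 2 1 \<or> x = axis 2 1 - axis 1 1" by (auto simp: A1_root_def)
  moreover have "(1 :: 2) \<noteq> 2" "(2 :: 2) \<noteq> 1" by simp_all
  ultimately show "x \<in> A1" unfolding A1_def roots_A_def by blast
qed

lemma A1_root_1 [simp]: "A1_root $ 1 = 1"
  by (simp add: A1_root_def axis_def)

lemma A1_nosplit: "\<alpha> \<in> A1 \<Longrightarrow> \<beta> \<in> A1 \<Longrightarrow> \<alpha> + \<beta> \<notin> A1"
proof
  have comp: "\<gamma> $ 1 = 1 \<or> \<gamma> $ 1 = -1" if "\<gamma> \<in> A1" for \<gamma> :: "real ^ 2"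
    using that by (auto simp: A1_eq)
  assume "\<alpha> \<in> A1" "\<beta> \<in> A1" "\<alpha> + \<beta> \<in> A1"
  from this[THEN comp] show False by auto
qed

text \<open>Carries the criterion that tells powers of \<open>A\<^sub>1\<close> apart from the other factors over to products.\<close>

lemma nosplit_prod:
  assumes "\<And>\<alpha> \<beta>. \<alpha> \<in> \<Phi> \<Longrightarrow> \<beta> \<in> \<Phi> \<Longrightarrow> \<alpha> + \<beta> \<notin> \<Phi>" "\<And>\<alpha> \<beta>. \<alpha> \<in> \<Psi> \<Longrightarrow> \<beta> \<in> \<Psi> \<Longrightarrow> \<alpha> + \<beta> \<notin> \<Psi>"
    and "0 \<notin> \<Phi>" "0 \<notin> \<Psi>" and "\<alpha> \<in> \<Phi> \<times>\<^sub>r \<Psi>" "\<beta> \<in> \<Phi> \<times>\<^sub>r \<Psi>"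
  shows "\<alpha> + \<beta> \<notin> \<Phi> \<times>\<^sub>r \<Psi>"
  using assms by (auto simp: root_prod_def)

lemma int_span_A1: "int_span A1 = range (\<lambda>n. real_of_int n *\<^sub>R A1_root)"
proof
  show "int_span A1 \<subseteq> range (\<lambda>n. real_of_int n *\<^sub>R A1_root)"
  proof (rule int_span_minimal)
    have "- A1_root = real_of_int (-1) *\<^sub>R A1_root" "A1_root = real_of_int 1 *\<^sub>R A1_root" by simp_all
    then show "A1 \<subseteq> range (\<lambda>n. real_of_int n *\<^sub>R A1_root)" unfolding A1_eq by blast
    show "0 \<in> range (\<lambda>n. real_of_int n *\<^sub>R A1_root)" by (rule range_eqI[of _ _ 0]) simp
  next
    fix x y assume "x \<in> range (\<lambda>n. real_of_int n *\<^sub>R A1_root)" "y \<in> range (\<lambda>n. real_of_int n *\<^sub>R A1_root)"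
    then obtain m n where "x = real_of_int m *\<^sub>R A1_root" "y = real_of_int n *\<^sub>R A1_root" by auto
    then have "x + y = real_of_int (m + n) *\<^sub>R A1_root" by (simp add: scaleR_left_distrib)
    then show "x + y \<in> range (\<lambda>n. real_of_int n *\<^sub>R A1_root)" by blast
  next
    fix n x assume "x \<in> range (\<lambda>n. real_of_int n *\<^sub>R A1_root)"
    then obtain m where "x = real_of_int m *\<^sub>R A1_root" by auto
    then have "real_of_int n *\<^sub>R x = real_of_int (n * m) *\<^sub>R A1_root" by simp
    then show "real_of_int n *\<^sub>R x \<in> range (\<lambda>n. real_of_int n *\<^sub>R A1_root)" by blast
  qed
  show "range (\<lambda>n. real_of_int n *\<^sub>R A1_root) \<subseteq> int_span A1"
    by (intro image_subsetI int_span_scale int_span_base) (simp add: A1_eq)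
qed

lemma A1_multiple [simp]: "real_of_int n *\<^sub>R A1_root \<in> int_span A1"
  unfolding int_span_A1 by (rule rangeI)

text \<open>The first coordinate identifies the lattice \<open>\<int>A\<^sub>1\<close> with \<open>\<int>\<close>.  The functionals on \<open>\<int>A\<^sub>1\<close> are the multiples of the pullback
\<open>\<omega>\<close> of the inclusion of \<open>\<int>\<close> into \<open>\<real>\<close>, and the two chambers are the rays \<open>R 1\<close> and \<open>R (-1)\<close> spanned by \<open>\<omega>\<close> and
\<open>- \<omega>\<close>.\<close>

lemma toric_root_A1: "toric_iso (toric_root A1) toric_P1"
proof -
  interpret A: roots A1
    by unfold_locales (simp add: A1_def roots_A_root_system)
  let ?Z = "root_lattice A1"
  let ?\<alpha> = A1_root
  define f :: "real ^ 2 \<Rightarrow> int" where "f x = \<lfloor>x $ 1\<rfloor>" for x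
  have f_scale: "f (real_of_int n *\<^sub>R ?\<alpha>) = n" for n by (simp add: f_def)
  have iso: "f \<in> iso ?Z integer_group"
  proof -
    have "f (x + y) = f x + f y" if "x \<in> int_span A1" "y \<in> int_span A1" for x y
      using that by (auto simp: int_span_A1 f_def)
    moreover have "bij_betw f (int_span A1) UNIV"
      by (rule bij_betw_byWitness[of _ "\<lambda>n. real_of_int n *\<^sub>R ?\<alpha>"]) (auto simp: int_span_A1 f_scale)
    ultimately show ?thesis by (auto simp: iso_def hom_def integer_group_def)
  qed
  define \<omega> where "\<omega> = pull_dual ?Z f real_of_int"
  have \<omega>: "\<omega> (real_of_int n *\<^sub>R ?\<alpha>) = n" for n
    using A1_multiple[of n] by (simp add: \<omega>_def pull_dual_apply f_scale del: A1_multiple)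
  have \<omega>_out: "\<omega> x = 0" if "x \<notin> int_span A1" for x using that by (simp add: \<omega>_def pull_dual_def)
  have roots: "?\<alpha> \<in> A1" "- ?\<alpha> \<in> A1" by (auto simp: A1_eq)
  have V: "v = (\<lambda>x. v ?\<alpha> * \<omega> x)" if "v \<in> A.V" for v
  proof
    fix x show "v x = v ?\<alpha> * \<omega> x"
    proof (cases "x \<in> int_span A1")
      case True
      then obtain n where "x = real_of_int n *\<^sub>R ?\<alpha>" by (auto simp: int_span_A1)
      then show ?thesis using A.V_scale[OF that int_span_base[OF roots(1)]] by (simp add: \<omega>)
    qed (use real_dual_outside[OF that, of x] \<omega>_out[of x] in simp)
  qed
  have \<omega>1: "\<omega> ?\<alpha> = 1" using \<omega>[of 1] by simp
  have VI: "(\<lambda>x. c * \<omega> x) \<in> A.V" for c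
  proof -
    have "\<omega> (x + y) = \<omega> x + \<omega> y" if xy: "x \<in> int_span A1" "y \<in> int_span A1" for x y
    proof -
      obtain m n where "x = real_of_int m *\<^sub>R ?\<alpha>" "y = real_of_int n *\<^sub>R ?\<alpha>"
        using xy by (auto simp: int_span_A1)
      then show ?thesis using \<omega>[of "m + n"] \<omega>[of m] \<omega>[of n] by (simp add: scaleR_left_distrib)
    qed
    then show ?thesis by (simp add: real_dual_def \<omega>_out distrib_left)
  qed
  define R where "R s = {\<lambda>x. c * \<omega> x | c. s * c \<ge> (0 :: real)}" for s :: real
  have chamber: "closed_chamber A1 (\<lambda>x. c * \<omega> x) = R (sgn c)" if "c \<noteq> 0" for c
  proof -
    have neg: "v (- ?\<alpha>) = - v ?\<alpha>" if "v \<in> A.V" for v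
      using A.V_uminus[OF that int_span_base[OF roots(1)]] .
    have iff: "v \<in> closed_chamber A1 (\<lambda>x. c * \<omega> x) \<longleftrightarrow> v \<in> A.V \<and> sgn c * v ?\<alpha> \<ge> 0" for v
      using \<open>c \<noteq> 0\<close> neg[of v] neg[OF VI[of c]]
      by (auto simp: closed_chamber_def A1_eq \<omega>1 sgn_if)
    show ?thesis
    proof (intro equalityI subsetI)
      fix v assume "v \<in> closed_chamber A1 (\<lambda>x. c * \<omega> x)"
      then show "v \<in> R (sgn c)" unfolding iff R_def using V by blast
    next
      fix v assume "v \<in> R (sgn c)"
      then show "v \<in> closed_chamber A1 (\<lambda>x. c * \<omega> x)" unfolding iff R_def using VI by (auto simp: \<omega>1)
    qed
  qed
  have chambers: "closed_chambers A1 = {R 1, R (-1)}"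
  proof (intro equalityI subsetI)
    fix \<sigma> assume "\<sigma> \<in> closed_chambers A1"
    then obtain u where u: "u \<in> A.V" "u ?\<alpha> \<noteq> 0" "\<sigma> = closed_chamber A1 u"
      using roots by (auto simp: closed_chambers_def)
    have "\<sigma> = R (sgn (u ?\<alpha>))"
      unfolding u(3) using chamber[OF u(2)] V[OF u(1)] by simp
    then show "\<sigma> \<in> {R 1, R (-1)}" using u(2) by (auto simp: sgn_if)
  next
    have "R (sgn c) \<in> closed_chambers A1" if "c \<noteq> 0" for c
    proof -
      have "\<forall>\<alpha>\<in>A1. c * \<omega> \<alpha> \<noteq> 0"
        using that \<omega>[of "-1"] by (auto simp: A1_eq \<omega>1)
      then show ?thesis
        unfolding chamber[OF that, symmetric] closed_chambers_def using VI by blast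
    qed
    from this[of 1] this[of "-1"] show "\<sigma> \<in> closed_chambers A1" if "\<sigma> \<in> {R 1, R (-1)}" for \<sigma>
      using that by auto
  qed
  have faces: "cone_face ?Z \<tau> (R s) \<longleftrightarrow> \<tau> = R s \<or> \<tau> = {\<lambda>x. 0}" if s: "s = 1 \<or> s = -1" for s \<tau>
  proof
    assume "cone_face ?Z \<tau> (R s)"
    then obtain n where n: "\<forall>v\<in>R s. v (real_of_int n *\<^sub>R ?\<alpha>) \<ge> 0" "\<tau> = {v \<in> R s. v (real_of_int n *\<^sub>R ?\<alpha>) = 0}"
      unfolding cone_face_def by (auto simp: int_span_A1)
    show "\<tau> = R s \<or> \<tau> = {\<lambda>x. 0}"
    proof (cases "n = 0")
      case True
      then show ?thesis unfolding n(2) using \<omega>[of 0] by (auto simp: R_def)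
    next
      case False
      then have "\<tau> = {\<lambda>x. 0}" unfolding n(2) by (auto simp: R_def \<omega> intro: exI[of _ 0])
      then show ?thesis ..
    qed
  next
    have face: "cone_face ?Z {v \<in> R s. v (real_of_int n *\<^sub>R ?\<alpha>) = 0} (R s)" if "s * n \<ge> 0" for n :: int
      unfolding cone_face_def
    proof (intro bexI[of _ "real_of_int n *\<^sub>R ?\<alpha>"] conjI ballI refl)
      fix v assume "v \<in> R s"
      then obtain c where c: "v = (\<lambda>x. c * \<omega> x)" "s * c \<ge> 0" by (auto simp: R_def)
      have "c * real_of_int n \<ge> 0" using s c(2) that by (auto simp: mult_nonpos_nonpos)
      then show "v (real_of_int n *\<^sub>R ?\<alpha>) \<ge> 0" by (simp add: c \<omega>)
    qed simp
    \<comment> \<open>The lattice point \<open>0\<close> cuts out the whole ray, and the generator on the side of \<open>s\<close> cuts out the origin.\<close>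
    have "{v \<in> R s. v (real_of_int 0 *\<^sub>R ?\<alpha>) = 0} = R s" using \<omega>[of 0] by (auto simp: R_def)
    moreover have "{v \<in> R s. v (real_of_int \<lfloor>s\<rfloor> *\<^sub>R ?\<alpha>) = 0} = {\<lambda>x. 0}"
      using s \<omega>1 \<omega>[of "-1"] unfolding R_def by (auto intro: exI[of _ 0])
    moreover assume "\<tau> = R s \<or> \<tau> = {\<lambda>x. 0}"
    ultimately show "cone_face ?Z \<tau> (R s)"
      using face[of 0] face[of "\<lfloor>s\<rfloor>"] s by auto
  qed
  have lhs: "snd (toric_root A1) = {{\<lambda>x. 0}, R 1, R (-1)}"
    by (auto simp: mem_toric_root chambers faces)
  have zero: "pull_dual ?Z f ` cone_gen {} = {\<lambda>x. 0}"
    by (auto simp: cone_gen_def pull_dual_def)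
  have gen: "cone_gen {u} = {\<lambda>x. c * u x | c. c \<ge> 0}" for u :: "int \<Rightarrow> real"
  proof -
    have "(\<exists>c. v = (\<lambda>x. c u * u x) \<and> c u \<ge> 0) \<longleftrightarrow> (\<exists>c. v = (\<lambda>x. c * u x) \<and> c \<ge> 0)" for v
    proof
      assume "\<exists>c. v = (\<lambda>x. c * u x) \<and> c \<ge> 0"
      then obtain c where "v = (\<lambda>x. c * u x) \<and> c \<ge> 0" ..
      then show "\<exists>c. v = (\<lambda>x. c u * u x) \<and> c u \<ge> 0" by (intro exI[of _ "\<lambda>_. c"])
    qed blast
    then show ?thesis unfolding cone_gen_def by auto
  qed
  have ray: "pull_dual ?Z f ` cone_gen {\<lambda>x. s * real_of_int x} = R s" if s: "s = 1 \<or> s = -1" for s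
  proof -
    have p: "pull_dual ?Z f (\<lambda>x. c * (s * real_of_int x)) = (\<lambda>x. (s * c) * \<omega> x)" for c
      by (auto simp: pull_dual_def \<omega>_def)
    have "pull_dual ?Z f ` cone_gen {\<lambda>x. s * real_of_int x} = {\<lambda>x. (s * c) * \<omega> x | c. c \<ge> 0}"
    proof -
      have "pull_dual ?Z f ` cone_gen {\<lambda>x. s * real_of_int x} =
          {pull_dual ?Z f (\<lambda>x. c * (s * real_of_int x)) | c. c \<ge> 0}"
        unfolding gen by blast
      then show ?thesis by (simp only: p)
    qed
    also have "\<dots> = R s"
    proof (intro equalityI subsetI)
      fix v assume "v \<in> R s"
      then obtain c where "v = (\<lambda>x. c * \<omega> x)" "s * c \<ge> 0" by (auto simp: R_def)
      then have "v = (\<lambda>x. (s * (s * c)) * \<omega> x)" "s * c \<ge> 0" using s by auto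
      then show "v \<in> {\<lambda>x. (s * c) * \<omega> x | c. c \<ge> 0}" by blast
    next
      fix v assume "v \<in> {\<lambda>x. (s * c) * \<omega> x | c. c \<ge> 0}"
      then obtain c where "v = (\<lambda>x. (s * c) * \<omega> x)" "c \<ge> 0" by blast
      moreover have "s * (s * c) = c" using s by auto
      ultimately show "v \<in> R s"
        unfolding R_def by (intro CollectI exI[of _ "s * c"] conjI) (simp_all only:)
    qed
    finally show ?thesis .
  qed
  have "snd (toric_root A1) = pull_fan ?Z f (snd toric_P1)"
    unfolding lhs using zero ray[of 1] ray[of "-1"] by (simp add: pull_fan_def toric_P1_def)
  then show ?thesis
    unfolding toric_iso_def using iso by (intro bexI[of _ f]) (auto simp: toric_P1_def)
qed

section \<open>Demazure models of four-dimensional tori\<close>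

lemma torus_demazure_model:
  assumes H: "split_torus K H" and "root_system \<Phi>"
    and iso: "glattice_iso (torus_glattice K H) (root_glattice \<Phi>)"
  shows "demazure_model (torus_glattice K H) (toric_root \<Phi>)"
proof (rule demazure_model_toric_root[OF _ _ _ _ iso])
  show "root_system \<Phi>" by fact
qed (use galois_act_char_lattice[OF H] char_lattice_closed group_galois_group in
    \<open>auto simp: torus_glattice_def galois_group_def\<close>)

lemma A1_system: "root_system A1" "irreducible_simply_laced A1"
  and A2_system: "root_system A2" "irreducible_simply_laced A2"
  and A3_system: "root_system A3" "irreducible_simply_laced A3"
  and A4_system: "root_system A4" "irreducible_simply_laced A4"
  and D4_system: "root_system D4" "irreducible_simply_laced D4"
  unfolding irreducible_simply_laced_def A1_def A2_def A3_def A4_def D4_def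
  by (simp_all add: roots_A_root_system roots_A_simply_laced roots_A_irreducible
      roots_D_root_system roots_D_simply_laced roots_D_irreducible)

lemma root_zero: "root_system \<Phi> \<Longrightarrow> 0 \<notin> \<Phi>"
  by (simp add: root_system_def)

lemma toric_root_iso_refl: "root_system \<Phi> \<Longrightarrow> toric_iso (toric_root \<Phi>) (toric_root \<Phi>)"
  by (rule toric_iso_refl) (simp add: fan_subset_real_dual[OF roots.fan_toric_root[OF roots.intro]])

text \<open>The two summands of the lattice occur in the opposite order in \<open>\<Phi>\<close>, hence the swap.\<close>

lemma MG1_iso: "glattice_iso MG1 (root_glattice (A2 \<times>\<^sub>r A1 \<times>\<^sub>r A1))"
proof -
  have "MG1 = glattice_sum (root_glattice (A1 \<times>\<^sub>r A1)) (root_glattice A2)"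
    by (simp add: MG1_def root_glattice_def root_lattice_prod)
  then have "glattice_iso MG1 (glattice_sum (root_glattice A2) (root_glattice (A1 \<times>\<^sub>r A1)))"
    by (rule ssubst) (rule glattice_sum_commute)
  moreover have "glattice_iso (glattice_sum (root_glattice A2) (root_glattice (A1 \<times>\<^sub>r A1)))
      (root_glattice (A2 \<times>\<^sub>r A1 \<times>\<^sub>r A1))"
  proof (rule glattice_iso_root_prod)
    show "\<exists>\<beta>\<in>A2. \<alpha> + \<beta> \<in> A2" if "\<alpha> \<in> A2" for \<alpha>
      using that roots_A_split[of \<alpha>] by (simp add: A2_def)
    show "\<alpha> + \<beta> \<notin> A1 \<times>\<^sub>r A1" if "\<alpha> \<in> A1 \<times>\<^sub>r A1" "\<beta> \<in> A1 \<times>\<^sub>r A1" for \<alpha> \<beta>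
      using A1_nosplit A1_nosplit root_zero[OF A1_system(1)] root_zero[OF A1_system(1)] that by (rule nosplit_prod)
  qed (simp_all add: root_zero root_system_prod A1_system A2_system)
  ultimately show ?thesis by (rule glattice_iso_trans)
qed

lemma MG3_iso: "glattice_iso MG3 (root_glattice (A3 \<times>\<^sub>r A1))"
  unfolding MG3_def
proof (rule glattice_iso_root_prod)
  show "\<exists>\<beta>\<in>A3. \<alpha> + \<beta> \<in> A3" if "\<alpha> \<in> A3" for \<alpha>
    using that roots_A_split[of \<alpha>] by (simp add: A3_def)
qed (simp_all add: A1_nosplit root_zero A1_system A3_system)

lemma MG5_eq: "MG5 = root_glattice (A2 \<times>\<^sub>r A2)"
  by (simp add: MG5_def root_glattice_def root_lattice_prod)

lemma MG8_eq: "MG8 = root_glattice (A1 \<times>\<^sub>r A1 \<times>\<^sub>r A1 \<times>\<^sub>r A1)"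
  by (simp add: MG8_def root_glattice_def root_lattice_prod)

theorem proposition6p7:
  fixes K :: "'l::field set"
    and H :: "('n::finite, 'l) laurent set"
    and i :: nat
  assumes "finite_galois K"
    and "split_torus K H"
    and "is_MG i (torus_glattice K H)"
  shows
    "(i = 1 \<longrightarrow>
        root_system (A2 \<times>\<^sub>r A1 \<times>\<^sub>r A1) \<and>
        glattice_iso MG1 (root_glattice (A2 \<times>\<^sub>r A1 \<times>\<^sub>r A1)) \<and>
        irreducible_simply_laced A2 \<and> irreducible_simply_laced A1 \<and>
        demazure_model (torus_glattice K H)
          (toric_root A2 \<times>\<^sub>t toric_root A1 \<times>\<^sub>t toric_root A1) \<and>
        toric_iso (toric_root A2 \<times>\<^sub>t toric_root A1 \<times>\<^sub>t toric_root A1)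
          (toric_root A2 \<times>\<^sub>t toric_P1 \<times>\<^sub>t toric_P1)) \<and>
     (i = 3 \<longrightarrow>
        root_system (A3 \<times>\<^sub>r A1) \<and>
        glattice_iso MG3 (root_glattice (A3 \<times>\<^sub>r A1)) \<and>
        irreducible_simply_laced A3 \<and> irreducible_simply_laced A1 \<and>
        demazure_model (torus_glattice K H) (toric_root A3 \<times>\<^sub>t toric_root A1) \<and>
        toric_iso (toric_root A3 \<times>\<^sub>t toric_root A1) (toric_root A3 \<times>\<^sub>t toric_P1)) \<and>
     (i = 5 \<longrightarrow>
        root_system (A2 \<times>\<^sub>r A2) \<and>
        glattice_iso MG5 (root_glattice (A2 \<times>\<^sub>r A2)) \<and>
        irreducible_simply_laced A2 \<and>
        demazure_model (torus_glattice K H) (toric_root A2 \<times>\<^sub>t toric_root A2)) \<and>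
     (i = 6 \<longrightarrow>
        root_system A4 \<and>
        glattice_iso MG6 (root_glattice A4) \<and>
        irreducible_simply_laced A4 \<and>
        demazure_model (torus_glattice K H) (toric_root A4)) \<and>
     (i = 8 \<longrightarrow>
        root_system (A1 \<times>\<^sub>r A1 \<times>\<^sub>r A1 \<times>\<^sub>r A1) \<and>
        glattice_iso MG8 (root_glattice (A1 \<times>\<^sub>r A1 \<times>\<^sub>r A1 \<times>\<^sub>r A1)) \<and>
        irreducible_simply_laced A1 \<and>
        demazure_model (torus_glattice K H)
          (toric_root A1 \<times>\<^sub>t toric_root A1 \<times>\<^sub>t toric_root A1 \<times>\<^sub>t toric_root A1) \<and>
        toric_iso (toric_root A1 \<times>\<^sub>t toric_root A1 \<times>\<^sub>t toric_root A1 \<times>\<^sub>t toric_root A1)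
          (toric_P1 \<times>\<^sub>t toric_P1 \<times>\<^sub>t toric_P1 \<times>\<^sub>t toric_P1)) \<and>
     (i = 9 \<longrightarrow>
        root_system D4 \<and>
        glattice_iso MG9 (root_glattice D4) \<and>
        irreducible_simply_laced D4 \<and>
        demazure_model (torus_glattice K H) (toric_root D4))"
proof (intro conjI impI)
  have model: "demazure_model (torus_glattice K H) (toric_root \<Phi>)"
    if "root_system \<Phi>" "glattice_iso M (root_glattice \<Phi>)" "glattice_iso (torus_glattice K H) M"
    for \<Phi> :: "'a::euclidean_space set" and M :: "('b, 'c) glattice"
    using torus_demazure_model[OF assms(2) that(1)] glattice_iso_trans[OF that(3,2)] .
  note root_systems = A1_system(1) A2_system(1) A3_system(1) A4_system(1) D4_system(1)
  show R1: "root_system (A2 \<times>\<^sub>r A1 \<times>\<^sub>r A1)" and R3: "root_system (A3 \<times>\<^sub>r A1)"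
    and R5: "root_system (A2 \<times>\<^sub>r A2)" and R8: "root_system (A1 \<times>\<^sub>r A1 \<times>\<^sub>r A1 \<times>\<^sub>r A1)"
    by (intro root_system_prod root_systems)+
  show "glattice_iso MG1 (root_glattice (A2 \<times>\<^sub>r A1 \<times>\<^sub>r A1))" by (rule MG1_iso)
  show "glattice_iso MG3 (root_glattice (A3 \<times>\<^sub>r A1))" by (rule MG3_iso)
  show I5: "glattice_iso MG5 (root_glattice (A2 \<times>\<^sub>r A2))" unfolding MG5_eq by (rule glattice_iso_refl)
  show I6: "glattice_iso MG6 (root_glattice A4)" unfolding MG6_def by (rule glattice_iso_refl)
  show I8: "glattice_iso MG8 (root_glattice (A1 \<times>\<^sub>r A1 \<times>\<^sub>r A1 \<times>\<^sub>r A1))"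
    unfolding MG8_eq by (rule glattice_iso_refl)
  show I9: "glattice_iso MG9 (root_glattice D4)" unfolding MG9_def by (rule glattice_iso_refl)
  show "demazure_model (torus_glattice K H) (toric_root A2 \<times>\<^sub>t toric_root A1 \<times>\<^sub>t toric_root A1)" if "i = 1"
    using model[OF R1 MG1_iso] assms(3) that by (simp add: is_MG_def toric_root_prod)
  show "demazure_model (torus_glattice K H) (toric_root A3 \<times>\<^sub>t toric_root A1)" if "i = 3"
    using model[OF R3 MG3_iso] assms(3) that by (simp add: is_MG_def toric_root_prod)
  show "demazure_model (torus_glattice K H) (toric_root A2 \<times>\<^sub>t toric_root A2)" if "i = 5"
    using model[OF R5 I5] assms(3) that by (simp add: is_MG_def toric_root_prod)
  show "demazure_model (torus_glattice K H) (toric_root A4)" if "i = 6"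
    using model[OF A4_system(1) I6] assms(3) that by (simp add: is_MG_def)
  show "demazure_model (torus_glattice K H)
      (toric_root A1 \<times>\<^sub>t toric_root A1 \<times>\<^sub>t toric_root A1 \<times>\<^sub>t toric_root A1)" if "i = 8"
    using model[OF R8 I8] assms(3) that by (simp add: is_MG_def toric_root_prod)
  show "demazure_model (torus_glattice K H) (toric_root D4)" if "i = 9"
    using model[OF D4_system(1) I9] assms(3) that by (simp add: is_MG_def)
qed (intro toric_iso_prod toric_root_iso_refl toric_root_A1 A1_system A2_system A3_system A4_system D4_system)+

end
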